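(* Let $k\geq1$ be an integer and let $s\ge 0$. The spectrum of $\mathscr{L}_k$ (on $X^s$) in the open right half-plane is a finite set of isolated positive real eigenvalues of finite algebraic multiplicity. More precisely, $$\sigma(\mathscr{L}_k)\cap\{\operatorname{Re}z>0\}=\bigcup_{0<|n|<k}\{\lambda_{k,n,j}:1\leq j\leq N_{k,n}\},$$ where the union is over the finitely many integers $n$ with $0<|n|<k$. (Thus the unstable spectrum of the full operator is discrete, and no additional unstable spectrum is created by the direct sum over high transverse modes.)
   Context: On $\mathbb{T}^2=(\mathbb{R}/2\pi\mathbb{Z})^2$, for $s\geq0$ let $X^s=H^{s-1}_0(\mathbb{T}^2;\mathbb{C})\times H^s(\mathbb{T}^2;\mathbb{C})\ni(\omega,F)$, where the subscript $0$ denotes mean zero. Define $A_k=I-(1+k^2)(1-\Delta)^{-1}$, $B_k=-(1+k^2)\Delta^{-1}$, and the bounded operator on $X^s$ $$\mathscr{L}_k=-k\cos(kx_1)\,\partial_{x_2}\begin{pmatrix}0 & A_k \\ B_k & 0\end{pmatrix}$$ (the linearization at the equilibrium $\psi_\ast=0$, $\Phi_\ast=\sin(kx_1)$ of the inertial MHD system). For an integer $n\neq0$, let $A_{k,n},B_{k,n}$ be the Fourier multipliers on functions of $x_1\in\mathbb{T}=\mathbb{R}/2\pi\mathbb{Z}$ given by $$A_{k,n}e^{\mathrm{i}mx_1}=\frac{m^2+n^2-k^2}{m^2+n^2+1}e^{\mathrm{i}mx_1},\qquad B_{k,n}e^{\mathrm{i}mx_1}=\frac{1+k^2}{m^2+n^2}e^{\mathrm{i}mx_1}\qquad(m\in\mathbb{Z}),$$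 let $C_k$ be multiplication by $\cos(kx_1)$, and on $L^2(\mathbb{T})$ set $D_{k,n}=C_kB_{k,n}C_k$ (a positive, injective, compact self-adjoint operator) and $K_{k,n}=D_{k,n}^{1/2}A_{k,n}D_{k,n}^{1/2}$ (compact, self-adjoint). Put $N_{k,n}=\#\{m\in\mathbb{Z}:m^2+n^2<k^2\}$; this is the number of negative eigenvalues of $K_{k,n}$ counted with multiplicity. Enumerate these negative eigenvalues (with multiplicity) as $-\nu_{k,n,j}$, $1\leq j\leq N_{k,n}$, and set $\lambda_{k,n,j}=|n|k\sqrt{\nu_{k,n,j}}$. *)

theory Defs
  imports "HOL-Complex_Analysis.Complex_Analysis" "HOL-Library.Function_Algebras"
begin

section \<open>Operators on complex normed spaces given by a carrier and a norm\<close>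

text \<open>
  The Sobolev spaces depend on a real parameter, so they cannot be types. A complex normed space
  is given by a carrier set \<open>V\<close>, a linear subspace of an ambient complex vector space, and a norm
  \<open>N\<close> that only matters on \<open>V\<close>. Operators are total functions on the ambient space of which
  only the values on \<open>V\<close> matter.
\<close>

class complex_vector = ab_group_add +
  fixes scaleC :: "complex \<Rightarrow> 'a \<Rightarrow> 'a"  (infixr "*\<^sub>C" 75)
  assumes scaleC_add_right: "c *\<^sub>C (x + y) = c *\<^sub>C x + c *\<^sub>C y"
    and scaleC_add_left: "(c + d) *\<^sub>C x = c *\<^sub>C x + d *\<^sub>C x"
    and scaleC_scaleC: "c *\<^sub>C (d *\<^sub>C x) = (c * d) *\<^sub>C x"
    and scaleC_one: "1 *\<^sub>C x = x"

global_interpretation complex_vector: vector_space "scaleC :: complex \<Rightarrow> 'a \<Rightarrow> 'a::complex_vector"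
  by unfold_locales (rule scaleC_add_right scaleC_add_left scaleC_scaleC scaleC_one)+

instantiation complex :: complex_vector
begin
definition scaleC_complex :: "complex \<Rightarrow> complex \<Rightarrow> complex" where
  "c *\<^sub>C z = c * z"
instance by standard (simp_all add: scaleC_complex_def algebra_simps)
end

instantiation "fun" :: (type, complex_vector) complex_vector
begin
definition scaleC_fun :: "complex \<Rightarrow> ('a \<Rightarrow> 'b) \<Rightarrow> 'a \<Rightarrow> 'b" where
  "c *\<^sub>C f = (\<lambda>x. c *\<^sub>C f x)"
instance
  by standard (simp_all add: scaleC_fun_def fun_eq_iff scaleC_add_right scaleC_add_left
      scaleC_scaleC scaleC_one)
end

instantiation prod :: (complex_vector, complex_vector) complex_vector
begin
definition scaleC_prod :: "complex \<Rightarrow> 'a \<times> 'b \<Rightarrow> 'a \<times> 'b" where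
  "c *\<^sub>C p = (c *\<^sub>C fst p, c *\<^sub>C snd p)"
instance
  by standard (simp_all add: scaleC_prod_def prod_eq_iff scaleC_add_right scaleC_add_left
      scaleC_scaleC scaleC_one)
end

definition bounded_linear_between ::
  "'a::complex_vector set \<Rightarrow> ('a \<Rightarrow> real) \<Rightarrow> 'b::complex_vector set \<Rightarrow> ('b \<Rightarrow> real) \<Rightarrow> ('a \<Rightarrow> 'b) \<Rightarrow> bool"
where
  "bounded_linear_between V N W M T \<longleftrightarrow>
     (\<forall>x\<in>V. T x \<in> W) \<and>
     (\<forall>x\<in>V. \<forall>y\<in>V. T (x + y) = T x + T y) \<and>
     (\<forall>c. \<forall>x\<in>V. T (c *\<^sub>C x) = c *\<^sub>C T x) \<and>
     (\<exists>C. \<forall>x\<in>V. M (T x) \<le> C * N x)"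

definition is_resolvent ::
  "'a::complex_vector set \<Rightarrow> ('a \<Rightarrow> real) \<Rightarrow> ('a \<Rightarrow> 'a) \<Rightarrow> complex \<Rightarrow> ('a \<Rightarrow> 'a) \<Rightarrow> bool"
where
  "is_resolvent V N T z R \<longleftrightarrow>
     bounded_linear_between V N V N R \<and>
     (\<forall>x\<in>V. R (z *\<^sub>C x - T x) = x \<and> z *\<^sub>C R x - T (R x) = x)"

definition spectrum ::
  "'a::complex_vector set \<Rightarrow> ('a \<Rightarrow> real) \<Rightarrow> ('a \<Rightarrow> 'a) \<Rightarrow> complex set" where
  "spectrum V N T = {z. \<not> (\<exists>R. is_resolvent V N T z R)}"

text \<open>Outside the spectrum, the values of the resolvent on the carrier are uniquely determined.\<close>

definition resolvent ::
  "'a::complex_vector set \<Rightarrow> ('a \<Rightarrow> real) \<Rightarrow> ('a \<Rightarrow> 'a) \<Rightarrow> complex \<Rightarrow> 'a \<Rightarrow> 'a" where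
  "resolvent V N T z = (SOME R. is_resolvent V N T z R)"

definition eigenspace :: "'a::complex_vector set \<Rightarrow> ('a \<Rightarrow> 'a) \<Rightarrow> complex \<Rightarrow> 'a set" where
  "eigenspace V T z = {x \<in> V. T x = z *\<^sub>C x}"

definition eigenvalue :: "'a::complex_vector set \<Rightarrow> ('a \<Rightarrow> 'a) \<Rightarrow> complex \<Rightarrow> bool" where
  "eigenvalue V T z \<longleftrightarrow> (\<exists>x \<in> eigenspace V T z. x \<noteq> 0)"

definition finite_dimensional :: "'a::complex_vector set \<Rightarrow> bool" where
  "finite_dimensional S \<longleftrightarrow> (\<exists>b. finite b \<and> S \<subseteq> complex_vector.span b)"

text \<open>
  The Riesz projection \<open>P = (2\<pi>i)\<^sup>-\<^sup>1 \<oint> (w - T)\<^sup>-\<^sup>1 dw\<close> over the circle of radius \<open>r\<close> around \<open>z\<close>.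
  The operator-valued integral is understood weakly, that is, after applying bounded linear
  functionals. On a Banach space these determine \<open>P\<close>, and the integrand is norm continuous,
  so that this is the usual integral. The algebraic multiplicity of an isolated point \<open>z\<close> of the
  spectrum is the rank of \<open>P\<close> for a circle that separates \<open>z\<close> from the rest of the spectrum.
\<close>

definition is_riesz_projection ::
  "'a::complex_vector set \<Rightarrow> ('a \<Rightarrow> real) \<Rightarrow> ('a \<Rightarrow> 'a) \<Rightarrow> complex \<Rightarrow> real \<Rightarrow> ('a \<Rightarrow> 'a) \<Rightarrow> bool"
where
  "is_riesz_projection V N T z r P \<longleftrightarrow>
     bounded_linear_between V N V N P \<and>
     (\<forall>l. bounded_linear_between V N (UNIV :: complex set) cmod l \<longrightarrow>
       (\<forall>x\<in>V. ((\<lambda>w. l (resolvent V N T w x)) has_contour_integral (2 * pi * \<i> * l (P x)))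
                 (circlepath z r)))"

definition finite_algebraic_multiplicity ::
  "'a::complex_vector set \<Rightarrow> ('a \<Rightarrow> real) \<Rightarrow> ('a \<Rightarrow> 'a) \<Rightarrow> complex \<Rightarrow> bool" where
  "finite_algebraic_multiplicity V N T z \<longleftrightarrow>
     (\<exists>r>0. spectrum V N T \<inter> cball z r = {z} \<and>
        (\<exists>P. is_riesz_projection V N T z r P \<and> finite_dimensional (P ` V)))"

section \<open>Fourier coefficients on the torus\<close>

text \<open>
  Functions and distributions on \<open>\<T>\<close> and \<open>\<T>\<^sup>2\<close>, where \<open>\<T> = \<real>/2\<pi>\<int>\<close>, are represented by their
  families of Fourier coefficients with respect to \<open>exp(imx\<^sub>1)\<close> and \<open>exp(i(mx\<^sub>1 + nx\<^sub>2))\<close>.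
\<close>

definition fourier1 :: "(real \<Rightarrow> complex) \<Rightarrow> int \<Rightarrow> complex" where
  "fourier1 f m = integral {0..2*pi} (\<lambda>x. f x * cis (- (of_int m * x))) / (2 * pi)"

definition fourier2 :: "(real \<times> real \<Rightarrow> complex) \<Rightarrow> int \<times> int \<Rightarrow> complex" where
  "fourier2 f = (\<lambda>(m, n). integral (cbox (0, 0) (2*pi, 2*pi))
      (\<lambda>(x, y). f (x, y) * cis (- (of_int m * x + of_int n * y))) / (2 * pi)\<^sup>2)"

text \<open>If \<open>a\<close> are the Fourier coefficients of a trigonometric polynomial \<open>g\<close>, then
  \<open>convolve a\<close> is multiplication by \<open>g\<close>.\<close>

definition convolve :: "('i::ab_group_add \<Rightarrow> complex) \<Rightarrow> ('i \<Rightarrow> complex) \<Rightarrow> 'i \<Rightarrow> complex" where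
  "convolve a u = (\<lambda>p. \<Sum>\<^sub>\<infinity>q. a (p - q) * u q)"

definition fourier_multiplier :: "('i \<Rightarrow> complex) \<Rightarrow> ('i \<Rightarrow> complex) \<Rightarrow> 'i \<Rightarrow> complex" where
  "fourier_multiplier a u = (\<lambda>p. a p * u p)"

section \<open>The linearized operator on \<open>\<T>\<^sup>2\<close>\<close>

definition sobolev_weight :: "real \<Rightarrow> int \<times> int \<Rightarrow> real" where
  "sobolev_weight s = (\<lambda>(m, n). (1 + (of_int m)\<^sup>2 + (of_int n)\<^sup>2) powr s)"

definition sobolev :: "real \<Rightarrow> (int \<times> int \<Rightarrow> complex) set" where
  "sobolev s = {u. (\<lambda>p. sobolev_weight s p * (cmod (u p))\<^sup>2) summable_on UNIV}"

definition sobolev_norm :: "real \<Rightarrow> (int \<times> int \<Rightarrow> complex) \<Rightarrow> real" where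
  "sobolev_norm s u = sqrt (\<Sum>\<^sub>\<infinity>p. sobolev_weight s p * (cmod (u p))\<^sup>2)"

definition sobolev_mean_zero :: "real \<Rightarrow> (int \<times> int \<Rightarrow> complex) set" where
  "sobolev_mean_zero s = {u \<in> sobolev s. u (0, 0) = 0}"

type_synonym state = "(int \<times> int \<Rightarrow> complex) \<times> (int \<times> int \<Rightarrow> complex)"

definition Xspace :: "real \<Rightarrow> state set" where
  "Xspace s = sobolev_mean_zero (s - 1) \<times> sobolev s"

definition Xnorm :: "real \<Rightarrow> state \<Rightarrow> real" where
  "Xnorm s = (\<lambda>(\<omega>, F). sqrt ((sobolev_norm (s - 1) \<omega>)\<^sup>2 + (sobolev_norm s F)\<^sup>2))"

definition laplace_symbol :: "int \<times> int \<Rightarrow> complex" where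
  "laplace_symbol = (\<lambda>(m, n). - ((of_int m)\<^sup>2 + (of_int n)\<^sup>2))"

definition opA :: "int \<Rightarrow> (int \<times> int \<Rightarrow> complex) \<Rightarrow> int \<times> int \<Rightarrow> complex" where
  "opA k u = u - (1 + (of_int k)\<^sup>2) *\<^sub>C fourier_multiplier (\<lambda>p. inverse (1 - laplace_symbol p)) u"

text \<open>The inverse Laplacian is only applied to mean-zero elements; since \<open>inverse 0 = 0\<close>, it
  takes values in mean-zero elements.\<close>

definition opB :: "int \<Rightarrow> (int \<times> int \<Rightarrow> complex) \<Rightarrow> int \<times> int \<Rightarrow> complex" where
  "opB k u = - (1 + (of_int k)\<^sup>2) *\<^sub>C fourier_multiplier (\<lambda>p. inverse (laplace_symbol p)) u"

definition partial2 :: "(int \<times> int \<Rightarrow> complex) \<Rightarrow> int \<times> int \<Rightarrow> complex" where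
  "partial2 = fourier_multiplier (\<lambda>(m, n). \<i> * of_int n)"

definition cos_mult2 :: "int \<Rightarrow> (int \<times> int \<Rightarrow> complex) \<Rightarrow> int \<times> int \<Rightarrow> complex" where
  "cos_mult2 k = convolve (fourier2 (\<lambda>(x, y). complex_of_real (cos (of_int k * x))))"

definition opL :: "int \<Rightarrow> state \<Rightarrow> state" where
  "opL k = (\<lambda>(\<omega>, F). (- of_int k *\<^sub>C cos_mult2 k (partial2 (opA k F)),
                       - of_int k *\<^sub>C cos_mult2 k (partial2 (opB k \<omega>))))"

section \<open>The reduced operators on \<open>L\<^sup>2(\<T>)\<close>\<close>

text \<open>\<open>L\<^sup>2(\<T>)\<close> is represented by the square-summable families of Fourier coefficients; the
  inner product corresponds to normalized Lebesgue measure on \<open>\<T>\<close>.\<close>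

definition l2 :: "(int \<Rightarrow> complex) set" where
  "l2 = {u. (\<lambda>m. (cmod (u m))\<^sup>2) summable_on UNIV}"

definition l2_norm :: "(int \<Rightarrow> complex) \<Rightarrow> real" where
  "l2_norm u = sqrt (\<Sum>\<^sub>\<infinity>m. (cmod (u m))\<^sup>2)"

definition l2_inner :: "(int \<Rightarrow> complex) \<Rightarrow> (int \<Rightarrow> complex) \<Rightarrow> complex" where
  "l2_inner u v = (\<Sum>\<^sub>\<infinity>m. u m * cnj (v m))"

definition positive_selfadjoint :: "((int \<Rightarrow> complex) \<Rightarrow> int \<Rightarrow> complex) \<Rightarrow> bool" where
  "positive_selfadjoint S \<longleftrightarrow>
     bounded_linear_between l2 l2_norm l2 l2_norm S \<and>
     (\<forall>u\<in>l2. \<forall>v\<in>l2. l2_inner (S u) v = l2_inner u (S v)) \<and>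
     (\<forall>u\<in>l2. Re (l2_inner (S u) u) \<ge> 0)"

text \<open>The positive square root of a positive operator exists and is unique on \<open>l2\<close>; its values
  outside \<open>l2\<close> are irrelevant.\<close>

definition op_sqrt :: "((int \<Rightarrow> complex) \<Rightarrow> int \<Rightarrow> complex) \<Rightarrow> (int \<Rightarrow> complex) \<Rightarrow> int \<Rightarrow> complex" where
  "op_sqrt D = (SOME S. positive_selfadjoint S \<and> (\<forall>u\<in>l2. S (S u) = D u))"

definition opA1 :: "int \<Rightarrow> int \<Rightarrow> (int \<Rightarrow> complex) \<Rightarrow> int \<Rightarrow> complex" where
  "opA1 k n = fourier_multiplier
     (\<lambda>m. ((of_int m)\<^sup>2 + (of_int n)\<^sup>2 - (of_int k)\<^sup>2) / ((of_int m)\<^sup>2 + (of_int n)\<^sup>2 + 1))"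

definition opB1 :: "int \<Rightarrow> int \<Rightarrow> (int \<Rightarrow> complex) \<Rightarrow> int \<Rightarrow> complex" where
  "opB1 k n = fourier_multiplier (\<lambda>m. (1 + (of_int k)\<^sup>2) / ((of_int m)\<^sup>2 + (of_int n)\<^sup>2))"

definition cos_mult1 :: "int \<Rightarrow> (int \<Rightarrow> complex) \<Rightarrow> int \<Rightarrow> complex" where
  "cos_mult1 k = convolve (fourier1 (\<lambda>x. complex_of_real (cos (of_int k * x))))"

definition opD :: "int \<Rightarrow> int \<Rightarrow> (int \<Rightarrow> complex) \<Rightarrow> int \<Rightarrow> complex" where
  "opD k n = cos_mult1 k \<circ> opB1 k n \<circ> cos_mult1 k"

definition opK :: "int \<Rightarrow> int \<Rightarrow> (int \<Rightarrow> complex) \<Rightarrow> int \<Rightarrow> complex" where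
  "opK k n = op_sqrt (opD k n) \<circ> opA1 k n \<circ> op_sqrt (opD k n)"

definition Nneg :: "int \<Rightarrow> int \<Rightarrow> nat" where
  "Nneg k n = card {m::int. m\<^sup>2 + n\<^sup>2 < k\<^sup>2}"

text \<open>\<open>- \<nu> 1, \<dots>, - \<nu> N\<close> lists the negative eigenvalues of \<open>T\<close>, each one as often as the dimension
  of its eigenspace.\<close>

definition enumerates_negative_eigenvalues ::
  "'a::complex_vector set \<Rightarrow> ('a \<Rightarrow> 'a) \<Rightarrow> nat \<Rightarrow> (nat \<Rightarrow> real) \<Rightarrow> bool" where
  "enumerates_negative_eigenvalues V T N \<nu> \<longleftrightarrow>
     (\<forall>j\<in>{1..N}. - \<nu> j < 0) \<and>
     (\<forall>\<mu><0. finite_dimensional (eigenspace V T (complex_of_real \<mu>)) \<and>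
        card {j\<in>{1..N}. - \<nu> j = \<mu>} = complex_vector.dim (eigenspace V T (complex_of_real \<mu>)))"

definition nu :: "int \<Rightarrow> int \<Rightarrow> nat \<Rightarrow> real" where
  "nu k n = (SOME \<nu>. enumerates_negative_eigenvalues l2 (opK k n) (Nneg k n) \<nu>)"

definition lam :: "int \<Rightarrow> int \<Rightarrow> nat \<Rightarrow> real" where
  "lam k n j = \<bar>of_int n\<bar> * of_int k * sqrt (nu k n j)"

section \<open>Multiplication by the cosine on Fourier coefficients\<close>

text \<open>
  On coefficient families, the multiplication operators shift and average; for integrable \<open>f\<close>
  they give the Fourier coefficients of the pointwise product.
\<close>

lemma integral_cis_int:
  "((\<lambda>x. cis (of_int m * x)) has_integral (if m = 0 then complex_of_real (2 * pi) else 0)) {0..2*pi}"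
proof (cases "m = 0")
  case True
  then show ?thesis
    using has_integral_const_real[of "1::complex" 0 "2*pi"] by (simp add: scaleR_conv_of_real)
next
  case False
  have "((\<lambda>x. cis (of_int m * x)) has_integral
      (cis (of_int m * (2*pi)) / (\<i> * of_int m) - cis (of_int m * 0) / (\<i> * of_int m))) {0..2*pi}"
  proof (rule fundamental_theorem_of_calculus)
    fix x :: real
    have "((\<lambda>x. exp (\<i> * of_int m * of_real x) / (\<i> * of_int m)) has_vector_derivative
        exp (\<i> * of_int m * of_real x)) (at x within {0..2*pi})"
      using False
      by (auto intro!: derivative_eq_intros has_vector_derivative_real_field simp: field_simps)
    then show "((\<lambda>x. cis (of_int m * x) / (\<i> * of_int m)) has_vector_derivative
        cis (of_int m * x)) (at x within {0..2*pi})"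
      by (simp add: cis_conv_exp mult_ac)
  qed simp
  moreover have "cis (of_int m * (2*pi)) = 1"
    using cis_multiple_2pi[of "of_int m"] by (simp add: mult_ac)
  ultimately show ?thesis
    using False by simp
qed

lemma cos_as_cis: "complex_of_real (cos x) = (cis x + cis (- x)) / 2"
  by (simp add: complex_eq_iff)

lemma fourier1_cos:
  "fourier1 (\<lambda>x. complex_of_real (cos (of_int k * x))) m =
     ((if m = k then 1 else 0) + (if m = - k then 1 else 0)) / 2"
proof -
  have "((\<lambda>x. (cis (of_int (k - m) * x) + cis (of_int (- k - m) * x)) / 2) has_integral
      ((if k - m = 0 then complex_of_real (2 * pi) else 0) +
       (if - k - m = 0 then complex_of_real (2 * pi) else 0)) / 2) {0..2*pi}"
    by (intro has_integral_divide has_integral_add integral_cis_int)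
  also have "(\<lambda>x. (cis (of_int (k - m) * x) + cis (of_int (- k - m) * x)) / 2) =
      (\<lambda>x. complex_of_real (cos (of_int k * x)) * cis (- (of_int m * x)))"
    by (simp add: cos_as_cis fun_eq_iff ring_distribs add_divide_distrib cis_mult algebra_simps)
  finally show ?thesis
    unfolding fourier1_def by (auto simp: integral_unique)
qed

lemma fourier2_cos:
  "fourier2 (\<lambda>(x, y). complex_of_real (cos (of_int k * x))) (m, n) =
     (if n = 0 then ((if m = k then 1 else 0) + (if m = - k then 1 else 0)) / 2 else 0)"
proof -
  have "integral (cbox (0, 0) (2*pi, 2*pi))
      (\<lambda>(x, y). complex_of_real (cos (of_int k * x)) * cis (- (of_int m * x + of_int n * y))) =
    integral (cbox 0 (2*pi)) (\<lambda>x. integral (cbox 0 (2*pi)) (\<lambda>y.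
      complex_of_real (cos (of_int k * x)) * cis (- (of_int m * x + of_int n * y))))"
    by (subst integral_prod_continuous)
      (auto intro!: continuous_intros simp: case_prod_unfold cis_conv_exp)
  also have "\<dots> = integral {0..2*pi} (\<lambda>x. complex_of_real (cos (of_int k * x)) *
      cis (- (of_int m * x)) * (if n = 0 then complex_of_real (2 * pi) else 0))"
  proof -
    have "integral {0..2*pi} (\<lambda>y. complex_of_real (cos (of_int k * x)) *
        cis (- (of_int m * x + of_int n * y))) =
      complex_of_real (cos (of_int k * x)) * cis (- (of_int m * x)) * (if n = 0 then complex_of_real (2 * pi) else 0)"
      for x
    proof -
      have "cis (- (of_int m * x + of_int n * y)) = cis (- (of_int m * x)) * cis (of_int (- n) * y)"
        for y
        by (simp add: cis_mult)
      then show ?thesis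
        using integral_unique[OF integral_cis_int[of "- n"]]
        by (simp add: mult.assoc del: minus_add_distrib)
    qed
    then show ?thesis
      by (simp only: cbox_interval)
  qed
  also have "\<dots> = fourier1 (\<lambda>x. complex_of_real (cos (of_int k * x))) m * (2 * pi) *
      (if n = 0 then complex_of_real (2 * pi) else 0)"
    by (simp add: fourier1_def)
  finally show ?thesis
    unfolding fourier2_def by (simp add: fourier1_cos power2_eq_square)
qed

lemma infsum_two_points:
  fixes u :: "'i \<Rightarrow> complex"
  assumes "\<And>q. q \<noteq> p \<Longrightarrow> q \<noteq> p' \<Longrightarrow> a q = 0"
    and "a p = (if p = p' then 2 else 1) * c" and "a p' = a p"
  shows "(\<Sum>\<^sub>\<infinity>q. a q * u q) = c * (u p + u p')"
proof -
  have "(\<Sum>\<^sub>\<infinity>q. a q * u q) = (\<Sum>\<^sub>\<infinity>q\<in>{p, p'}. a q * u q)"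
    using assms(1) by (intro infsum_cong_neutral) auto
  moreover have "(\<Sum>q\<in>{p, p'}. a q * u q) = c * (u p + u p')"
  proof (cases "p = p'")
    case True
    then have "a p' = 2 * c" using assms(2) by simp
    with True show ?thesis by simp
  next
    case False
    then have "a p = c" "a p' = c" using assms(2,3) by simp_all
    with False show ?thesis by (simp add: algebra_simps)
  qed
  ultimately show ?thesis by simp
qed

lemma cos_mult1_eq: "cos_mult1 k u m = (u (m - k) + u (m + k)) / 2"
proof -
  have "cos_mult1 k u m = 1 / 2 * (u (m - k) + u (m + k))"
    unfolding cos_mult1_def convolve_def fourier1_cos by (rule infsum_two_points) auto
  then show ?thesis by simp
qed

lemma cos_mult2_eq: "cos_mult2 k u (m, n) = (u (m - k, n) + u (m + k, n)) / 2"
proof -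
  have "cos_mult2 k u (m, n) = 1 / 2 * (u (m - k, n) + u (m + k, n))"
    unfolding cos_mult2_def convolve_def
    by (rule infsum_two_points) (auto simp: fourier2_cos split: if_splits)
  then show ?thesis by simp
qed

lemma integrable_bounded_continuous_mult:
  fixes f g :: "'a::euclidean_space \<Rightarrow> complex"
  assumes "f absolutely_integrable_on cbox a b" and "continuous_on (cbox a b) g"
  shows "(\<lambda>x. g x * f x) integrable_on cbox a b"
proof -
  have "bounded (g ` cbox a b)"
    by (intro compact_imp_bounded compact_continuous_image assms(2) compact_cbox)
  moreover have "g \<in> borel_measurable (lebesgue_on (cbox a b))"
    by (intro continuous_imp_measurable_on_sets_lebesgue assms(2) lmeasurable_cbox fmeasurableD)
  ultimately have "(\<lambda>x. g x * f x) absolutely_integrable_on cbox a b"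
    by (intro absolutely_integrable_bounded_measurable_product[OF bilinear_times] assms(1)
        lmeasurable_cbox fmeasurableD)
  then show ?thesis
    by (rule set_lebesgue_integral_eq_integral(1))
qed

lemma fourier1_cos_mult:
  assumes "f absolutely_integrable_on {0..2*pi}"
  shows "fourier1 (\<lambda>x. complex_of_real (cos (of_int k * x)) * f x) = cos_mult1 k (fourier1 f)"
proof
  fix m
  have int: "(\<lambda>x. cis (- (of_int j * x)) * f x) integrable_on {0..2*pi}" for j
    using assms integrable_bounded_continuous_mult[where f = f and a = 0 and b = "2*pi" and
        g = "\<lambda>x. cis (- (of_int j * x))"]
    by (simp add: continuous_intros)
  have "integral {0..2*pi} (\<lambda>x. complex_of_real (cos (of_int k * x)) * f x * cis (- (of_int m * x)))
     = integral {0..2*pi} (\<lambda>x. cis (- (of_int (m - k) * x)) * f x / 2 +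
         cis (- (of_int (m + k) * x)) * f x / 2)"
  proof (intro integral_cong)
    fix x :: real
    have "cis (- (of_int (m - k) * x)) = cis (of_int k * x) * cis (- (of_int m * x))"
      "cis (- (of_int (m + k) * x)) = cis (- (of_int k * x)) * cis (- (of_int m * x))"
      by (simp_all add: cis_mult algebra_simps)
    then show "complex_of_real (cos (of_int k * x)) * f x * cis (- (of_int m * x)) =
        cis (- (of_int (m - k) * x)) * f x / 2 + cis (- (of_int (m + k) * x)) * f x / 2"
      by (simp only: cos_as_cis) (simp add: field_simps)
  qed
  also have "\<dots> = integral {0..2*pi} (\<lambda>x. cis (- (of_int (m - k) * x)) * f x) / 2 +
      integral {0..2*pi} (\<lambda>x. cis (- (of_int (m + k) * x)) * f x) / 2"
    by (subst Henstock_Kurzweil_Integration.integral_add) (auto intro!: integrable_on_divide int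
        simp del: of_int_diff of_int_add minus_add_distrib)
  finally show "fourier1 (\<lambda>x. complex_of_real (cos (of_int k * x)) * f x) m =
      cos_mult1 k (fourier1 f) m"
    unfolding cos_mult1_eq fourier1_def
    by (simp add: mult.commute[of "f _"] add_divide_distrib)
qed

lemma fourier2_cos_mult:
  assumes "f absolutely_integrable_on cbox (0, 0) (2*pi, 2*pi)"
  shows "fourier2 (\<lambda>(x, y). complex_of_real (cos (of_int k * x)) * f (x, y)) = 
    cos_mult2 k (fourier2 f)"
proof (intro ext, clarify)
  fix m n
  let ?S = "cbox (0, 0) (2*pi, 2*pi)"
  let ?e = "\<lambda>j p. cis (- (of_int j * fst p + of_int n * snd p))"
  have int: "(\<lambda>p. ?e j p * f p) integrable_on ?S" for j
    using assms by (intro integrable_bounded_continuous_mult)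
      (auto simp: cis_conv_exp intro!: continuous_intros)
  have "integral ?S (\<lambda>p. complex_of_real (cos (of_int k * fst p)) * f p * ?e m p)
     = integral ?S (\<lambda>p. ?e (m - k) p * f p / 2 + ?e (m + k) p * f p / 2)"
  proof (intro integral_cong)
    fix p :: "real \<times> real"
    have "?e (m - k) p = cis (of_int k * fst p) * ?e m p"
      "?e (m + k) p = cis (- (of_int k * fst p)) * ?e m p"
      by (simp_all add: cis_mult algebra_simps)
    then show "complex_of_real (cos (of_int k * fst p)) * f p * ?e m p =
        ?e (m - k) p * f p / 2 + ?e (m + k) p * f p / 2"
      by (simp only: cos_as_cis) (simp add: field_simps)
  qed
  also have "\<dots> = integral ?S (\<lambda>p. ?e (m - k) p * f p) / 2 + integral ?S (\<lambda>p. ?e (m + k) p * f p) / 2"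
    by (subst Henstock_Kurzweil_Integration.integral_add) (auto intro!: integrable_on_divide int
        simp del: of_int_diff of_int_add minus_add_distrib)
  finally show "fourier2 (\<lambda>(x, y). complex_of_real (cos (of_int k * x)) * f (x, y)) (m, n) =
      cos_mult2 k (fourier2 f) (m, n)"
    unfolding cos_mult2_eq fourier2_def
    by (simp add: mult.commute[of "f _"] add_divide_distrib case_prod_unfold)
qed

end

theory Submission
  imports Defs
begin

text \<open>
  Conjugation with the Sobolev weights turns the operator on \<open>X\<^sup>s\<close> into an operator on square-summable
  families whose matrix entries agree at infinity with those of a skew-adjoint operator. For
  \<open>Re z > 0\<close>, the operator \<open>z - L\<close> is therefore a finite-rank perturbation of a coercive operator, so
  that it is invertible unless \<open>z\<close> is an eigenvalue. In this way all transverse modes are treated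
  at once, and no estimates of the individual resolvents are needed.

  An eigenfunction with \<open>Re z > 0\<close> has a component in some mode \<open>n \<noteq> 0\<close>, and eliminating \<open>\<omega>\<close> gives
  \<open>D A F = \<mu> F\<close> with \<open>\<mu> = - z\<^sup>2 / (k n)\<^sup>2\<close>. The non-zero eigenvalues of \<open>D A\<close> are those of
  \<open>K = D\<^sup>1\<^sup>/\<^sup>2 A D\<^sup>1\<^sup>/\<^sup>2\<close>, and the negative ones are counted by Sylvester's law of inertia. At such a \<open>z\<close>, the
  form \<open>\<langle>B \<omega>, \<omega>'\<rangle> - \<langle>A F, F'\<rangle>\<close> is positive on the eigenspace and makes eigenvectors left
  eigenvectors, which gives the Riesz projection explicitly.
\<close>

section \<open>Linear algebra and coercive operators\<close>

text \<open>The obstacle is that \<open>opL k\<close> is an operator of order zero: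
  \<open>\<partial>\<^sub>2\<close> costs one derivative, each off-diagonal block regains it only
  because the two components live in spaces one derivative apart, and the modes \<open>n\<close>
  form an infinite family. The entries do not decay, so \<open>L\<close> is no compact perturbation
  of 0. They are close to skew-adjoint entries instead. What remains after cutting off finitely many
  indices can be made small compared with \<open>Re z\<close>, but not zero; this is why the
  argument is confined to the open half-plane. For the algebraic multiplicity, the conserved energy
  \<langle>B \<omega>, \<omega>\<rangle> + \<langle>A F, F\<rangle> is useless, since it vanishes on
  unstable eigenvectors. Reversing one sign turns it into twice \<langle>B \<omega>,
  \<omega>\<rangle>, which is positive there. The operator is then symmetric for the new form, and
  real eigenvalues have no Jordan blocks. That the eigenvalues are real is known from the
  self-adjoint \<open>K\<close>. Both \<open>op_sqrt\<close> and \<open>nu\<close> are choices by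
  \<open>SOME\<close>, so nothing is known about them until existence is proved. This is the reason
  for the explicit square root and for the exact count of negative eigenvalues.\<close>

lemma homogeneous_system:
  fixes a :: "'m \<Rightarrow> 'p \<Rightarrow> 'a::field"
  assumes "finite I" "finite M" "card I < card M"
  shows "\<exists>c. (\<exists>m\<in>M. c m \<noteq> 0) \<and> (\<forall>p\<in>I. (\<Sum>m\<in>M. c m * a m p) = 0)"
  using assms
proof (induction I arbitrary: M a rule: finite_induct)
  case empty
  then have "M \<noteq> {}" by auto
  then show ?case by (intro exI[of _ "\<lambda>_. 1"]) auto
next
  case (insert p I)
  show ?case
  proof (cases "\<forall>m\<in>M. a m p = 0")
    case True
    then show ?thesis using insert.IH[of M a] insert.prems insert.hyps by auto
  next
    case False
    then obtain m0 where m0: "m0 \<in> M" "a m0 p \<noteq> 0" by auto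
    let ?M = "M - {m0}"
    have "card I < card ?M"
      using insert.prems insert.hyps m0 by (simp add: card_Diff_singleton)
    \<comment> \<open>Gaussian elimination: the equation at \<open>p\<close> is solved for the
      unknown \<open>m0\<close> and substituted into the remaining equations.\<close>
    with insert.IH[of ?M "\<lambda>m q. a m q - a m p / a m0 p * a m0 q"] insert.prems
    obtain c where c: "\<exists>m\<in>?M. c m \<noteq> 0"
      "\<And>q. q \<in> I \<Longrightarrow> (\<Sum>m\<in>?M. c m * (a m q - a m p / a m0 p * a m0 q)) = 0"
      by auto
    define s where "s = (\<Sum>m\<in>?M. c m * a m p)"
    define d where "d m = (if m = m0 then - s / a m0 p else c m)" for m
    have sum_d: "(\<Sum>m\<in>M. d m * a m q) = - s / a m0 p * a m0 q + (\<Sum>m\<in>?M. c m * a m q)" for q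
    proof -
      have "(\<Sum>m\<in>M. d m * a m q) = d m0 * a m0 q + (\<Sum>m\<in>?M. d m * a m q)"
        using insert.prems m0 by (simp add: sum.remove)
      also have "(\<Sum>m\<in>?M. d m * a m q) = (\<Sum>m\<in>?M. c m * a m q)"
        by (rule sum.cong) (auto simp: d_def)
      finally show ?thesis by (simp add: d_def)
    qed
    have "(\<Sum>m\<in>M. d m * a m q) = 0" if "q \<in> insert p I" for q
    proof (cases "q = p")
      case True
      then show ?thesis using m0 by (simp add: sum_d s_def)
    next
      case False
      then have "0 = (\<Sum>m\<in>?M. c m * (a m q - a m p / a m0 p * a m0 q))"
        using c(2) that by simp
      also have "\<dots> = (\<Sum>m\<in>?M. c m * a m q) - (\<Sum>m\<in>?M. (c m * a m p) * (a m0 q / a m0 p))"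
        by (simp add: sum_subtractf algebra_simps)
      also have "(\<Sum>m\<in>?M. (c m * a m p) * (a m0 q / a m0 p)) = s * (a m0 q / a m0 p)"
        unfolding s_def by (rule sum_distrib_right[symmetric])
      finally show ?thesis by (simp add: sum_d)
    qed
    moreover have "\<exists>m\<in>M. d m \<noteq> 0" using c(1) by (auto simp: d_def)
    ultimately show ?thesis by blast
  qed
qed

text \<open>A solution of \<open>G x = y\<close> is a fixed point of
  \<open>x - e *\<^sub>R (G x - y)\<close>, and coercivity makes this map a contraction for small
  \<open>e\<close>. Only the real inner product enters, so that for complex operators coercivity is
  a condition on the real part of the form.\<close>

lemma lax_milgram:
  fixes G :: "'a::{real_inner,complete_space} \<Rightarrow> 'a"
  assumes G: "bounded_linear G" and c: "c > 0" "\<And>x. c * (norm x)\<^sup>2 \<le> inner (G x) x"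
  shows "\<exists>R. bounded_linear R \<and> (\<forall>x. R (G x) = x) \<and> (\<forall>x. G (R x) = x)"
proof -
  interpret G: bounded_linear G by fact
  obtain K0 where K0: "K0 > 0" "\<And>x. norm (G x) \<le> norm x * K0"
    using G.pos_bounded by blast
  \<comment> \<open>The summand \<open>c\<close> ensures \<open>c \<le> K\<close>, so that the
    radicand in \<open>q\<close> is nonnegative.\<close>
  define K where "K = K0 + c"
  have K: "K > 0" "c \<le> K" "norm (G x) \<le> K * norm x" for x
  proof -
    have "norm x * K0 \<le> K * norm x" using c(1) by (simp add: K_def ring_distribs)
    then show "norm (G x) \<le> K * norm x" using K0(2)[of x] by linarith
  qed (use K0(1) c(1) in \<open>auto simp: K_def\<close>)
  have lower: "c * norm x \<le> norm (G x)" for x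
  proof (cases "x = 0")
    case False
    have "c * norm x * norm x \<le> norm (G x) * norm x"
      using c(2)[of x] norm_cauchy_schwarz[of "G x" x] by (simp add: power2_eq_square)
    then show ?thesis using False by simp
  qed simp
  \<comment> \<open>The squared contraction factor is bounded by
    \<open>1 - 2 * e * c + e\<^sup>2 * K\<^sup>2\<close>; this \<open>e\<close> minimizes the bound,
    and \<open>q\<^sup>2\<close> is the minimum.\<close>
  define e where "e = c / K\<^sup>2"
  define q where "q = sqrt (1 - c\<^sup>2 / K\<^sup>2)"
  have "0 < c\<^sup>2 / K\<^sup>2" "c\<^sup>2 / K\<^sup>2 \<le> 1"
    using K(1,2) c(1) by (simp_all add: power_mono)
  then have q: "0 \<le> q" "q < 1" "q\<^sup>2 = 1 - c\<^sup>2 / K\<^sup>2"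
    by (simp_all add: q_def)
  have contr: "norm (x - e *\<^sub>R G x) \<le> q * norm x" for x
  proof -
    have "(norm (x - e *\<^sub>R G x))\<^sup>2 = (norm x)\<^sup>2 - 2 * e * inner (G x) x + e\<^sup>2 * (norm (G x))\<^sup>2"
      unfolding power2_norm_eq_inner
      by (simp add: inner_diff_left inner_diff_right inner_commute[of x "G x"] power2_eq_square
          right_diff_distrib)
    also have "\<dots> \<le> (norm x)\<^sup>2 - 2 * e * (c * (norm x)\<^sup>2) + e\<^sup>2 * (K * norm x)\<^sup>2"
      using c K by (intro add_mono diff_mono mult_left_mono power_mono) (auto simp: e_def)
    also have "\<dots> = (1 - c\<^sup>2 / K\<^sup>2) * (norm x)\<^sup>2"
    proof -
      have e: "e * c = c\<^sup>2 / K\<^sup>2" "e\<^sup>2 * K\<^sup>2 = c\<^sup>2 / K\<^sup>2"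
        using K(1) by (simp_all add: e_def power2_eq_square)
      have "(norm x)\<^sup>2 - 2 * e * (c * (norm x)\<^sup>2) + e\<^sup>2 * (K * norm x)\<^sup>2 =
          (norm x)\<^sup>2 - 2 * (e * c) * (norm x)\<^sup>2 + (e\<^sup>2 * K\<^sup>2) * (norm x)\<^sup>2"
        by (simp add: power_mult_distrib)
      then show ?thesis unfolding e by (simp add: left_diff_distrib)
    qed
    also have "\<dots> = (q * norm x)\<^sup>2"
      by (simp only: power_mult_distrib q(3))
    finally show ?thesis
      by (rule power2_le_imp_le) (simp add: q(1))
  qed
  have surj: "\<exists>x. G x = y" for y
  proof -
    have "\<exists>!x. x - e *\<^sub>R (G x - y) = x"
    proof (rule banach_fix_type[OF q(1,2)], intro allI)
      fix x x'
      have "x - e *\<^sub>R (G x - y) - (x' - e *\<^sub>R (G x' - y)) = (x - x') - e *\<^sub>R G (x - x')"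
        by (simp add: G.diff algebra_simps)
      then show "dist (x - e *\<^sub>R (G x - y)) (x' - e *\<^sub>R (G x' - y)) \<le> q * dist x x'"
        using contr[of "x - x'"] unfolding dist_norm by (simp only:)
    qed
    then obtain x where "x - e *\<^sub>R (G x - y) = x" by blast
    then have "e *\<^sub>R (G x - y) = 0" by simp
    then show ?thesis using c(1) K(1) by (auto simp: e_def)
  qed
  then obtain R where R: "\<And>y. G (R y) = y" by metis
  have inj: "x = y" if "G x = G y" for x y
  proof -
    have "c * norm (x - y) \<le> 0" using lower[of "x - y"] that by (simp add: G.diff)
    then show ?thesis using c(1) by (simp add: mult_le_0_iff)
  qed
  have "bounded_linear R"
  proof (rule bounded_linear_intro[of _ "1 / c"])
    show "R (x + y) = R x + R y" for x y by (rule inj) (simp add: R G.add)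
    show "R (r *\<^sub>R x) = r *\<^sub>R R x" for r x by (rule inj) (simp add: R G.scaleR)
    show "norm (R x) \<le> norm x * (1 / c)" for x
      using lower[of "R x"] c(1) by (simp add: R field_simps)
  qed
  moreover have "R (G x) = x" for x by (rule inj) (simp add: R)
  ultimately show ?thesis using R by blast
qed

section \<open>Finite-rank operators and finite-rank perturbations\<close>

definition finite_rank :: "('a::real_normed_vector \<Rightarrow> 'b::real_normed_vector) \<Rightarrow> bool" where
  "finite_rank F \<longleftrightarrow> bounded_linear F \<and> (\<exists>B. finite B \<and> range F \<subseteq> span B)"

lemma finite_rank_add:
  assumes "finite_rank F" "finite_rank F'"
  shows "finite_rank (\<lambda>x. F x + F' x)"
proof -
  obtain B B' where B: "finite B" "range F \<subseteq> span B" "finite B'" "range F' \<subseteq> span B'"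
    using assms unfolding finite_rank_def by blast
  have "F x + F' x \<in> span (B \<union> B')" for x
    using B span_mono[of B "B \<union> B'"] span_mono[of B' "B \<union> B'"]
    by (intro span_add) auto
  then show ?thesis
    using assms B unfolding finite_rank_def
    by (auto intro!: bounded_linear_add exI[of _ "B \<union> B'"])
qed

lemma finite_rank_compose:
  assumes "bounded_linear S" "finite_rank F" "bounded_linear R"
  shows "finite_rank (\<lambda>x. S (F (R x)))"
proof -
  obtain B where B: "finite B" "range F \<subseteq> span B"
    using assms unfolding finite_rank_def by blast
  have "S ` span B = span (S ` B)"
    by (intro linear_span_image[symmetric] bounded_linear.linear assms(1))
  then have "range (\<lambda>x. S (F (R x))) \<subseteq> span (S ` B)" using B by blast
  then show ?thesis
    using assms B unfolding finite_rank_def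
    by (auto intro!: bounded_linear_compose[of S] bounded_linear_compose[of F])
qed

lemma finite_rank_minus:
  assumes "finite_rank F"
  shows "finite_rank (\<lambda>x. - F x)"
  using finite_rank_compose[OF bounded_linear_minus[OF bounded_linear_ident] assms
      bounded_linear_ident] .

lemma finite_rank_sum:
  assumes "finite I" "\<And>i. i \<in> I \<Longrightarrow> finite_rank (F i)"
  shows "finite_rank (\<lambda>x. \<Sum>i\<in>I. F i x)"
  using assms
proof (induction rule: finite_induct)
  case empty
  then show ?case by (auto simp: finite_rank_def intro!: exI[of _ "{}"] bounded_linear_zero)
next
  case (insert i I)
  then show ?case by (simp add: finite_rank_add)
qed

text \<open>An orthogonal spanning set yields the coordinates as inner products with its elements,
  so they inherit boundedness from \<open>F\<close>.\<close>

lemma finite_rank_coordinates: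
  fixes F :: "'a::real_normed_vector \<Rightarrow> 'b::real_inner"
  assumes "finite_rank F"
  obtains C f where "finite C" "\<And>c. c \<in> C \<Longrightarrow> bounded_linear (f c)"
    "\<And>u. F u = (\<Sum>c\<in>C. f c u *\<^sub>R c)"
proof -
  obtain B where B: "finite B" "range F \<subseteq> span B" and F: "bounded_linear F"
    using assms unfolding finite_rank_def by blast
  obtain C where C: "finite C" "span C = span B" "pairwise orthogonal C"
    using basis_orthogonal[OF B(1)] by blast
  have coord: "x = (\<Sum>c\<in>C. (inner x c / inner c c) *\<^sub>R c)" if x: "x \<in> span C" for x
  proof -
    obtain a where a: "x = (\<Sum>c\<in>C. a c *\<^sub>R c)"
      using subsetD[OF equalityD1[OF span_finite[OF C(1)]] x] by (rule rangeE)
    have "inner x c = a c * inner c c" if "c \<in> C" for c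
    proof -
      have "inner x c = (\<Sum>d\<in>C. if d = c then a c * inner c c else 0)"
        unfolding a inner_sum_left using C(3) that
        by (intro sum.cong) (auto simp: pairwise_def orthogonal_def)
      then show ?thesis using C(1) that by simp
    qed
    \<comment> \<open>The orthogonal set may contain 0; for \<open>c = 0\<close> the quotient is 0
      and both sides vanish.\<close>
    then have "a c *\<^sub>R c = (inner x c / inner c c) *\<^sub>R c" if "c \<in> C" for c
      using that by auto
    then show ?thesis using a by (metis (no_types, lifting) sum.cong)
  qed
  show thesis
  proof (rule that[of C "\<lambda>c u. inner (F u) c / inner c c"])
    show "bounded_linear (\<lambda>u. inner (F u) c / inner c c)" for c
      by (intro bounded_linear_compose[OF bounded_linear_divide]
          bounded_linear_compose[OF bounded_linear_inner_left] F)
    show "F u = (\<Sum>c\<in>C. (inner (F u) c / inner c c) *\<^sub>R c)" for u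
      using B(2) C(2) by (intro coord) auto
  qed fact
qed

text \<open>Surjectivity is a statement on the finite-dimensional range of \<open>F\<close> after multiplying
  by \<open>G\<^sup>-\<^sup>1\<close>, where it follows from injectivity; no open mapping theorem is needed.\<close>

lemma fredholm_finite_rank:
  fixes G F :: "'a::{real_inner,complete_space} \<Rightarrow> 'a"
  assumes G: "bounded_linear G" "c > 0" "\<And>x. c * (norm x)\<^sup>2 \<le> inner (G x) x"
    and F: "finite_rank F" and inj: "\<And>x. G x = F x \<Longrightarrow> x = 0"
  shows "\<exists>R. bounded_linear R \<and> (\<forall>x. R (G x - F x) = x) \<and> (\<forall>x. G (R x) - F (R x) = x)"
proof -
  obtain S where S: "bounded_linear S" "\<And>x. S (G x) = x" "\<And>x. G (S x) = x"
    using lax_milgram[OF G] by blast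
  interpret S: bounded_linear S by fact
  interpret G: bounded_linear G by fact
  have linF: "bounded_linear F" using F by (simp add: finite_rank_def)
  interpret F: bounded_linear F by fact
  have "finite_rank (\<lambda>x. S (F x))"
    using finite_rank_compose[OF S(1) F bounded_linear_ident] .
  then obtain C f where C: "finite C" "\<And>c. c \<in> C \<Longrightarrow> bounded_linear (f c)"
    and Q: "\<And>u. S (F u) = (\<Sum>c\<in>C. f c u *\<^sub>R c)"
    by (rule finite_rank_coordinates) blast
  have inj': "x = 0" if "x = S (F x)" for x
    using inj[of x] that S(3) by metis
  have "\<exists>d. d - S (F d) = p" if p: "p \<in> C" for p
  proof -
    \<comment> \<open>The columns are the coordinates of \<open>p\<close> (for \<open>None\<close>)
      and of \<open>b - S (F b)\<close> (for \<open>Some b\<close>) with respect to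
      \<open>C\<close>. There is one column more than there are rows, hence a relation
      \<open>w - S (F w) + \<alpha> None *\<^sub>R p = 0\<close>. Injectivity makes the coefficient
      of \<open>p\<close> nonzero, so that the relation can be solved for \<open>p\<close>.\<close>
    let ?x = "\<lambda>m c. case m of None \<Rightarrow> of_bool (c = p) | Some b \<Rightarrow> of_bool (b = c) - f c b"
    have "card C < card (insert None (Some ` C))"
      using C(1) by (simp add: card_image)
    then obtain \<alpha> :: "'a option \<Rightarrow> real" where \<alpha>: "\<exists>m\<in>insert None (Some ` C). \<alpha> m \<noteq> 0"
      "\<And>c. c \<in> C \<Longrightarrow> (\<Sum>m\<in>insert None (Some ` C). \<alpha> m * ?x m c) = 0"
      using homogeneous_system[of C "insert None (Some ` C)" ?x] C(1) by auto
    define w where "w = (\<Sum>b\<in>C. \<alpha> (Some b) *\<^sub>R b)"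
    have fw: "f c w = (\<Sum>b\<in>C. \<alpha> (Some b) * f c b)" if "c \<in> C" for c
    proof -
      interpret fc: bounded_linear "f c" using C(2) that by blast
      show ?thesis by (simp add: w_def fc.sum fc.scaleR)
    qed
    have eq: "\<alpha> (Some c) - f c w + \<alpha> None * of_bool (c = p) = 0" if "c \<in> C" for c
    proof -
      have "0 = \<alpha> None * of_bool (c = p) + (\<Sum>b\<in>C. \<alpha> (Some b) * (of_bool (b = c) - f c b))"
        using \<alpha>(2)[OF that] C(1) by (subst (asm) sum.insert) (auto simp: sum.reindex)
      also have "(\<Sum>b\<in>C. \<alpha> (Some b) * (of_bool (b = c) - f c b)) =
          (\<Sum>b\<in>C. if b = c then \<alpha> (Some b) else 0) - f c w"
        unfolding fw[OF that] sum_subtractf[symmetric] by (rule sum.cong) (auto simp: algebra_simps)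
      finally show ?thesis using C(1) that by simp
    qed
    have "w - S (F w) + \<alpha> None *\<^sub>R p =
        (\<Sum>c\<in>C. (\<alpha> (Some c) - f c w + \<alpha> None * of_bool (c = p)) *\<^sub>R c)"
    proof -
      have "(\<Sum>c\<in>C. (\<alpha> None * of_bool (c = p)) *\<^sub>R c) = (\<Sum>c\<in>C. if c = p then \<alpha> None *\<^sub>R p else 0)"
        by (rule sum.cong) auto
      also have "\<dots> = \<alpha> None *\<^sub>R p" using C(1) p by simp
      finally show ?thesis
        by (simp add: Q w_def[symmetric] scaleR_add_left scaleR_diff_left sum.distrib sum_subtractf)
    qed
    also have "\<dots> = 0" by (rule sum.neutral) (simp add: eq)
    finally have w: "w - S (F w) + \<alpha> None *\<^sub>R p = 0" .
    have "\<alpha> None \<noteq> 0"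
    proof
      assume 0: "\<alpha> None = 0"
      then have "w = 0" using inj'[of w] w by simp
      \<comment> \<open>The coefficients are read off from the equations \<open>eq\<close> rather
        than from \<open>w = 0\<close>, because \<open>C\<close> may be linearly dependent.\<close>
      then have "\<alpha> (Some c) = 0" if "c \<in> C" for c
        using eq[OF that] 0 bounded_linear.linear[OF C(2)[OF that]] linear_0 by force
      then show False using \<alpha>(1) 0 by auto
    qed
    moreover have "w - S (F w) = - (\<alpha> None *\<^sub>R p)" using w by (simp only: eq_neg_iff_add_eq_0)
    then have "\<beta> *\<^sub>R w - S (F (\<beta> *\<^sub>R w)) = \<beta> *\<^sub>R (- (\<alpha> None *\<^sub>R p))" for \<beta>
      by (simp only: F.scaleR S.scaleR scaleR_diff_right[symmetric])
    from this[of "- inverse (\<alpha> None)"]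
    have "- inverse (\<alpha> None) *\<^sub>R w - S (F (- inverse (\<alpha> None) *\<^sub>R w)) =
      (inverse (\<alpha> None) * \<alpha> None) *\<^sub>R p"
      by (simp only: mult_minus_left scaleR_minus_left scaleR_minus_right scaleR_scaleR minus_minus)
    ultimately show ?thesis by auto
  qed
  then obtain d where d: "\<And>p. p \<in> C \<Longrightarrow> d p - S (F (d p)) = p" by metis
  \<comment> \<open>Since \<open>u - S (F u)\<close> differs from \<open>u\<close> by the
    combination of \<open>C\<close> with coefficients \<open>f c u\<close>, adding the same
    combination of the preimages \<open>d c\<close> inverts \<open>1 - S F\<close>. Composing with
    \<open>S\<close> inverts \<open>G - F\<close>.\<close>
  define R where "R y = S y + (\<Sum>c\<in>C. f c (S y) *\<^sub>R d c)" for y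
  have "bounded_linear R"
    unfolding R_def
    by (intro bounded_linear_add S(1) bounded_linear_sum
        bounded_linear_compose[OF bounded_linear_scaleR_left] bounded_linear_compose[OF C(2) S(1)])
  moreover have right: "G (R y) - F (R y) = y" for y
  proof -
    have "R y - S (F (R y)) = S y - S (F (S y)) + (\<Sum>c\<in>C. f c (S y) *\<^sub>R (d c - S (F (d c))))"
      by (simp add: R_def F.add S.add F.sum S.sum F.scaleR S.scaleR scaleR_diff_right sum_subtractf)
    also have "\<dots> = S y" using d by (simp add: Q)
    finally have "G (R y - S (F (R y))) = y" by (simp add: S)
    then show ?thesis by (simp add: G.diff S)
  qed
  moreover have "R (G x - F x) = x" for x
  proof -
    have "G (R (G x - F x) - x) - F (R (G x - F x) - x) = 0"
      using right[of "G x - F x"] by (simp add: G.diff F.diff algebra_simps)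
    then show ?thesis using inj[of "R (G x - F x) - x"] by simp
  qed
  ultimately show ?thesis by blast
qed

text \<open>A uniform bound for the size of independent families on which \<open>F\<close> is
  injective. Eigenvectors form such families, because on them \<open>F\<close> agrees with the
  coercive part of the splitting.\<close>

lemma finite_rank_dependent:
  fixes F :: "'a::real_normed_vector \<Rightarrow> 'b::real_inner"
  assumes "finite_rank F"
  shows "\<exists>r. \<forall>B. finite B \<and> card B > r \<longrightarrow>
    (\<exists>\<alpha>. (\<exists>b\<in>B. \<alpha> b \<noteq> 0) \<and> F (\<Sum>b\<in>B. \<alpha> b *\<^sub>R b) = 0)"
proof -
  obtain C f where C: "finite C" "\<And>c. c \<in> C \<Longrightarrow> bounded_linear (f c)"
    and F: "\<And>u. F u = (\<Sum>c\<in>C. f c u *\<^sub>R c)"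
    using finite_rank_coordinates[OF assms] by blast
  show ?thesis
  proof (intro exI[of _ "card C"] allI impI, elim conjE)
    fix B :: "'a set"
    assume B: "finite B" "card C < card B"
    obtain \<alpha> where \<alpha>: "\<exists>b\<in>B. \<alpha> b \<noteq> 0" "\<And>c. c \<in> C \<Longrightarrow> (\<Sum>b\<in>B. \<alpha> b * f c b) = 0"
      using homogeneous_system[OF C(1) B, of "\<lambda>b c. f c b"] by blast
    have "f c (\<Sum>b\<in>B. \<alpha> b *\<^sub>R b) = 0" if "c \<in> C" for c
    proof -
      interpret fc: bounded_linear "f c" using C(2) that by blast
      show ?thesis using \<alpha>(2)[OF that] by (simp add: fc.sum fc.scaleR)
    qed
    then have "F (\<Sum>b\<in>B. \<alpha> b *\<^sub>R b) = 0" by (simp add: F)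
    with \<alpha>(1) show "\<exists>\<alpha>. (\<exists>b\<in>B. \<alpha> b \<noteq> 0) \<and> F (\<Sum>b\<in>B. \<alpha> b *\<^sub>R b) = 0" by blast
  qed
qed

section \<open>Complex Hilbert spaces\<close>

text \<open>The real inner product is the primitive notion, so that the results on
  \<open>inner\<close> and \<open>bounded_linear\<close> apply directly. Compatibility of the norm
  with complex scalars is enough to recover the sesquilinear product \<open>cinner\<close> by
  polarization.\<close>

class complex_hilbert = complex_vector + real_inner + complete_space +
  assumes scaleR_scaleC: "r *\<^sub>R x = complex_of_real r *\<^sub>C x"
    and norm_scaleC: "norm (c *\<^sub>C x) = cmod c * norm x"

instance prod :: (complex_hilbert, complex_hilbert) complex_hilbert
proof
  fix r :: real and c :: complex and x :: "'a \<times> 'b"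
  show "r *\<^sub>R x = complex_of_real r *\<^sub>C x"
    by (simp add: scaleC_prod_def prod_eq_iff scaleR_scaleC)
  have "sqrt ((cmod c * norm (fst x))\<^sup>2 + (cmod c * norm (snd x))\<^sup>2) =
      cmod c * sqrt ((norm (fst x))\<^sup>2 + (norm (snd x))\<^sup>2)"
    by (simp add: power_mult_distrib real_sqrt_mult flip: distrib_left)
  then show "norm (c *\<^sub>C x) = cmod c * norm x"
    by (simp add: scaleC_prod_def norm_prod_def norm_scaleC)
qed

lemma scaleC_decomp:
  fixes x :: "'a::complex_hilbert"
  shows "c *\<^sub>C x = Re c *\<^sub>R x + Im c *\<^sub>R (\<i> *\<^sub>C x)"
proof -
  have "c = complex_of_real (Re c) + complex_of_real (Im c) * \<i>" by (simp add: complex_eq_iff)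
  then have "c *\<^sub>C x = (complex_of_real (Re c) + complex_of_real (Im c) * \<i>) *\<^sub>C x" by simp
  then show ?thesis
    by (simp add: scaleR_scaleC scaleC_add_left scaleC_scaleC)
qed

lemma inner_scaleC_scaleC:
  fixes x y :: "'a::complex_hilbert"
  shows "inner (c *\<^sub>C x) (c *\<^sub>C y) = (cmod c)\<^sup>2 * inner x y"
  unfolding dot_norm by (simp add: norm_scaleC power_mult_distrib right_diff_distrib
      distrib_left flip: scaleC_add_right)

lemma bounded_linear_scaleC: "bounded_linear (\<lambda>x::'a::complex_hilbert. c *\<^sub>C x)"
  by (rule bounded_linear_intro[of _ "cmod c"])
    (simp_all add: scaleC_add_right scaleR_scaleC scaleC_scaleC mult.commute norm_scaleC)

lemma inner_i_self [simp]: "inner (\<i> *\<^sub>C x) (x::'a::complex_hilbert) = 0"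
proof -
  have "(norm (x + \<i> *\<^sub>C x))\<^sup>2 = (norm ((1 + \<i>) *\<^sub>C x))\<^sup>2"
    by (simp add: scaleC_add_left scaleC_one)
  also have "\<dots> = 2 * (norm x)\<^sup>2"
    by (simp add: norm_scaleC power_mult_distrib cmod_def)
  finally show ?thesis
    by (simp add: dot_norm norm_scaleC add.commute)
qed

lemma inner_scaleC_self: "inner (c *\<^sub>C x) (x::'a::complex_hilbert) = Re c * (norm x)\<^sup>2"
  by (subst scaleC_decomp) (simp add: inner_add_left power2_norm_eq_inner)

text \<open>For a product that is linear in its first and antilinear in its second argument, the
  imaginary part of \<langle>x, y\<rangle> is the real part of \<langle>x, \<i> y\<rangle>.\<close>

definition cinner :: "'a::complex_hilbert \<Rightarrow> 'a \<Rightarrow> complex" where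
  "cinner x y = Complex (inner x y) (inner x (\<i> *\<^sub>C y))"

lemma Re_cinner: "Re (cinner x y) = inner x y"
  by (simp add: cinner_def)

lemma inner_i_right: "inner x (\<i> *\<^sub>C y) = - inner (\<i> *\<^sub>C x) (y::'a::complex_hilbert)"
proof -
  have "inner (\<i> *\<^sub>C x) (\<i> *\<^sub>C (\<i> *\<^sub>C y)) = inner x (\<i> *\<^sub>C y)"
    by (subst inner_scaleC_scaleC) simp
  moreover have "\<i> *\<^sub>C (\<i> *\<^sub>C y) = - y"
    by (simp add: scaleC_scaleC complex_vector.scale_minus_left scaleC_one)
  ultimately show ?thesis by (metis inner_minus_right)
qed

lemma cinner_commute: "cinner y x = cnj (cinner x y)"
  using inner_commute[of y x] inner_i_right[of y x] inner_commute[of "\<i> *\<^sub>C y" x]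
  by (simp add: cinner_def complex_eq_iff)

lemma cinner_add_left: "cinner (x + y) z = cinner x z + cinner y z"
  by (simp add: cinner_def complex_eq_iff inner_add_left)

lemma cinner_scaleC_left: "cinner (c *\<^sub>C x) y = c * cinner x y"
proof -
  have "\<i> *\<^sub>C (\<i> *\<^sub>C x) = - x"
    by (simp add: scaleC_scaleC complex_vector.scale_minus_left scaleC_one)
  then show ?thesis
    by (subst scaleC_decomp)
      (simp add: cinner_def complex_eq_iff inner_add_left inner_diff_left inner_i_right scaleC_add_right
        bounded_linear.linear[OF bounded_linear_scaleC, THEN linear_scale])
qed

lemma cinner_add_right: "cinner z (x + y) = cinner z x + cinner z y"
  using cinner_commute[of z "x + y"] cinner_commute[of z] by (simp add: cinner_add_left)

lemma cinner_scaleC_right: "cinner x (c *\<^sub>C y) = cnj c * cinner x y"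
  using cinner_commute[of x "c *\<^sub>C y"] cinner_commute[of x] by (simp add: cinner_scaleC_left)

lemma cinner_self: "cinner x x = complex_of_real ((norm x)\<^sup>2)"
  by (simp add: cinner_def complex_eq_iff power2_norm_eq_inner inner_commute[of x "\<i> *\<^sub>C x"])

lemma norm_cinner_le: "cmod (cinner x y) \<le> 2 * (norm x * norm y)"
proof -
  have "\<bar>inner x y\<bar> \<le> norm x * norm y" "\<bar>inner x (\<i> *\<^sub>C y)\<bar> \<le> norm x * norm y"
    using Cauchy_Schwarz_ineq2[of x y] Cauchy_Schwarz_ineq2[of x "\<i> *\<^sub>C y"]
    by (simp_all add: norm_scaleC)
  then show ?thesis
    using cmod_le[of "cinner x y"] by (simp add: cinner_def)
qed

lemma bounded_linear_cinner_left: "bounded_linear (\<lambda>x. cinner x y)"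
proof (rule bounded_linear_intro[of _ "2 * norm y"])
  show "cinner (x + z) y = cinner x y + cinner z y" for x z by (rule cinner_add_left)
  show "cinner (r *\<^sub>R x) y = r *\<^sub>R cinner x y" for r x
    by (simp add: scaleR_scaleC cinner_scaleC_left scaleR_conv_of_real)
  show "cmod (cinner x y) \<le> norm x * (2 * norm y)" for x
    using norm_cinner_le[of x y] by (simp add: mult_ac)
qed

lemma cinner_zero_left [simp]: "cinner 0 y = 0"
  using linear_0[OF bounded_linear.linear[OF bounded_linear_cinner_left]] .

lemma cinner_zero_right [simp]: "cinner y 0 = 0"
  using cinner_commute[of 0 y] by simp

lemma cinner_minus_left [simp]: "cinner (- x) y = - cinner x y"
  using cinner_add_left[of x "- x" y] by (simp add: eq_neg_iff_add_eq_0 add.commute)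

lemma cinner_diff_left: "cinner (x - z) y = cinner x y - cinner z y"
  using cinner_add_left[of x "- z" y] by simp

lemma cinner_sum_left: "cinner (sum f I) y = (\<Sum>i\<in>I. cinner (f i) y)"
  using linear_sum[OF bounded_linear.linear[OF bounded_linear_cinner_left]] .

lemma cinner_sum_right: "cinner y (sum f I) = (\<Sum>i\<in>I. cinner y (f i))"
  by (induction I rule: infinite_finite_induct) (simp_all add: cinner_add_right)

definition bounded_clinear :: "('a::complex_hilbert \<Rightarrow> 'b::complex_hilbert) \<Rightarrow> bool" where
  "bounded_clinear T \<longleftrightarrow> bounded_linear T \<and> (\<forall>c x. T (c *\<^sub>C x) = c *\<^sub>C T x)"

lemma bounded_clinearI:
  assumes "\<And>x y. T (x + y) = T x + T y" "\<And>c x. T (c *\<^sub>C x) = c *\<^sub>C T x"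
    "\<And>x. norm (T x) \<le> B * norm x"
  shows "bounded_clinear T"
  unfolding bounded_clinear_def using assms
  by (auto intro!: bounded_linear_intro[of _ B] simp: scaleR_scaleC mult.commute)

lemma bounded_clinear_compose:
  "bounded_clinear S \<Longrightarrow> bounded_clinear T \<Longrightarrow> bounded_clinear (\<lambda>x. S (T x))"
  by (simp add: bounded_clinear_def bounded_linear_compose)

lemma bounded_clinear_add:
  "bounded_clinear S \<Longrightarrow> bounded_clinear T \<Longrightarrow> bounded_clinear (\<lambda>x. S x + T x)"
  by (simp add: bounded_clinear_def bounded_linear_add scaleC_add_right)

lemma bounded_clinear_ident: "bounded_clinear (\<lambda>x. x)"
  by (simp add: bounded_clinear_def)

lemma bounded_clinear_scaleC: "bounded_clinear (\<lambda>x. c *\<^sub>C x)"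
  by (simp add: bounded_clinear_def bounded_linear_scaleC scaleC_scaleC mult.commute)

lemma bounded_clinear_diff:
  "bounded_clinear S \<Longrightarrow> bounded_clinear T \<Longrightarrow> bounded_clinear (\<lambda>x. S x - T x)"
  by (simp add: bounded_clinear_def bounded_linear_sub complex_vector.scale_right_diff_distrib)

lemma finite_rank_functional:
  fixes f :: "'a::real_normed_vector \<Rightarrow> complex" and b :: "'b::complex_hilbert"
  assumes "bounded_linear f"
  shows "finite_rank (\<lambda>u. f u *\<^sub>C b)"
  unfolding finite_rank_def
proof (intro conjI exI)
  interpret f: bounded_linear f by fact
  obtain M where "\<And>u. cmod (f u) \<le> norm u * M" using f.bounded by blast
  then show "bounded_linear (\<lambda>u. f u *\<^sub>C b)"
    by (intro bounded_linear_intro[of _ "M * norm b"])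
      (auto simp: f.add f.scaleR scaleC_add_left scaleR_scaleC scaleC_scaleC norm_scaleC
        scaleR_conv_of_real mult.assoc[symmetric] intro: mult_right_mono)
  \<comment> \<open>Spans are taken over the reals, so a complex multiple of \<open>b\<close>
    involves two vectors.\<close>
  have "f u *\<^sub>C b \<in> span {b, \<i> *\<^sub>C b}" for u
    by (subst scaleC_decomp) (intro span_add span_scale span_base, auto)
  then show "range (\<lambda>u. f u *\<^sub>C b) \<subseteq> span {b, \<i> *\<^sub>C b}" by blast
qed simp

section \<open>Square-summable families\<close>

text \<open>A type, in contrast to the carriers of the statement: the dependence on \<open>s\<close>
  moves from the space into the matrix entries of the operator, and the class-based results on
  Hilbert spaces become available for all \<open>s\<close> at once.\<close>

typedef 'i ell2 = "{u :: 'i \<Rightarrow> complex. (\<lambda>i. (cmod (u i))\<^sup>2) summable_on UNIV}"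
  by (intro exI[of _ "\<lambda>_. 0"]) simp

setup_lifting type_definition_ell2

lemma Rep_ell2_summable: "(\<lambda>i. (cmod (Rep_ell2 u i))\<^sup>2) summable_on UNIV"
  using Rep_ell2[of u] by simp

lemma square_summable_add:
  fixes u v :: "'i \<Rightarrow> complex"
  assumes "(\<lambda>i. (cmod (u i))\<^sup>2) summable_on A" "(\<lambda>i. (cmod (v i))\<^sup>2) summable_on A"
  shows "(\<lambda>i. (cmod (u i + v i))\<^sup>2) summable_on A"
proof (rule summable_on_comparison_test)
  show "(\<lambda>i. 2 * (cmod (u i))\<^sup>2 + 2 * (cmod (v i))\<^sup>2) summable_on A"
    by (intro summable_on_add summable_on_cmult_right assms)
  show "(cmod (u i + v i))\<^sup>2 \<le> 2 * (cmod (u i))\<^sup>2 + 2 * (cmod (v i))\<^sup>2" for i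
  proof -
    have "(cmod (u i + v i))\<^sup>2 \<le> (cmod (u i) + cmod (v i))\<^sup>2"
      by (intro power_mono norm_triangle_ineq) auto
    then show ?thesis
      using sum_squares_bound[of "cmod (u i)" "cmod (v i)"] by (simp add: power2_sum)
  qed
qed simp

lemma square_summable_scale:
  fixes u :: "'i \<Rightarrow> complex"
  assumes "(\<lambda>i. (cmod (u i))\<^sup>2) summable_on A"
  shows "(\<lambda>i. (cmod (c * u i))\<^sup>2) summable_on A"
  using summable_on_cmult_right[OF assms, of "(cmod c)\<^sup>2"] by (simp add: norm_mult power_mult_distrib)

lemma abs_summable_cinner:
  fixes u v :: "'i \<Rightarrow> complex"
  assumes "(\<lambda>i. (cmod (u i))\<^sup>2) summable_on A" "(\<lambda>i. (cmod (v i))\<^sup>2) summable_on A"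
  shows "(\<lambda>i. norm (u i * cnj (v i))) summable_on A"
  using abs_summable_product[of u A "\<lambda>i. cnj (v i)"] assms
  by (simp add: norm_mult power2_eq_square)

instantiation ell2 :: (type) ab_group_add
begin
lift_definition zero_ell2 :: "'a ell2" is "\<lambda>_. 0" by simp
lift_definition plus_ell2 :: "'a ell2 \<Rightarrow> 'a ell2 \<Rightarrow> 'a ell2" is "\<lambda>u v i. u i + v i"
  by (rule square_summable_add)
lift_definition uminus_ell2 :: "'a ell2 \<Rightarrow> 'a ell2" is "\<lambda>u i. - u i" by simp
lift_definition minus_ell2 :: "'a ell2 \<Rightarrow> 'a ell2 \<Rightarrow> 'a ell2" is "\<lambda>u v i. u i - v i"
  using square_summable_add[of _ _ "\<lambda>i. - _ i"] by simp
instance by standard (transfer, simp add: fun_eq_iff)+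
end

instantiation ell2 :: (type) complex_vector
begin
lift_definition scaleC_ell2 :: "complex \<Rightarrow> 'a ell2 \<Rightarrow> 'a ell2" is "\<lambda>c u i. c * u i"
  by (rule square_summable_scale)
instance by standard (transfer, simp add: fun_eq_iff algebra_simps)+
end

instantiation ell2 :: (type) real_vector
begin
definition scaleR_ell2 :: "real \<Rightarrow> 'a ell2 \<Rightarrow> 'a ell2" where
  "scaleR_ell2 r u = complex_of_real r *\<^sub>C u"
instance
  by standard (simp_all add: scaleR_ell2_def scaleC_add_right scaleC_add_left scaleC_scaleC scaleC_one)
end

instantiation ell2 :: (type) real_inner
begin
definition inner_ell2 :: "'a ell2 \<Rightarrow> 'a ell2 \<Rightarrow> real" where
  "inner_ell2 u v = Re (\<Sum>\<^sub>\<infinity>i. Rep_ell2 u i * cnj (Rep_ell2 v i))"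
definition norm_ell2 :: "'a ell2 \<Rightarrow> real" where
  "norm_ell2 u = sqrt (\<Sum>\<^sub>\<infinity>i. (cmod (Rep_ell2 u i))\<^sup>2)"
definition sgn_ell2 :: "'a ell2 \<Rightarrow> 'a ell2" where
  "sgn_ell2 u = u /\<^sub>R norm u"
definition dist_ell2 :: "'a ell2 \<Rightarrow> 'a ell2 \<Rightarrow> real" where
  "dist_ell2 u v = norm (u - v)"
definition uniformity_ell2 :: "('a ell2 \<times> 'a ell2) filter" where
  "uniformity_ell2 = (INF e\<in>{0 <..}. principal {(x, y). dist x y < e})"
definition open_ell2 :: "'a ell2 set \<Rightarrow> bool" where
  "open_ell2 U = (\<forall>x\<in>U. \<forall>\<^sub>F (x', y) in uniformity. x' = x \<longrightarrow> y \<in> U)"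

lemma inner_ell2_eq: "inner u v = (\<Sum>\<^sub>\<infinity>i. Re (Rep_ell2 u i * cnj (Rep_ell2 v i)))"
  unfolding inner_ell2_def
  by (rule infsum_Re[symmetric, OF abs_summable_summable[OF
        abs_summable_cinner[OF Rep_ell2_summable Rep_ell2_summable]]])

lemma inner_ell2_summable: "(\<lambda>i. Re (Rep_ell2 u i * cnj (Rep_ell2 v i))) summable_on UNIV"
  by (rule summable_on_Re[OF abs_summable_summable[OF
        abs_summable_cinner[OF Rep_ell2_summable Rep_ell2_summable]]])

instance
proof
  fix x y z :: "'a ell2" and r :: real
  show "inner x y = inner y x"
    unfolding inner_ell2_eq by (rule infsum_cong) (simp add: mult.commute)
  show "inner (x + y) z = inner x z + inner y z"
    unfolding inner_ell2_eq infsum_add[OF inner_ell2_summable inner_ell2_summable, symmetric]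
    by (rule infsum_cong) (simp add: plus_ell2.rep_eq ring_distribs)
  show "inner (r *\<^sub>R x) y = r * inner x y"
    unfolding inner_ell2_eq infsum_cmult_right'[symmetric]
    by (rule infsum_cong) (simp add: scaleR_ell2_def scaleC_ell2.rep_eq algebra_simps)
  have self: "inner x x = (\<Sum>\<^sub>\<infinity>i. (cmod (Rep_ell2 x i))\<^sup>2)"
    unfolding inner_ell2_eq
    by (rule infsum_cong) (simp only: complex_norm_square[symmetric] Re_complex_of_real)
  show "0 \<le> inner x x" unfolding self by (rule infsum_nonneg) simp
  show "inner x x = 0 \<longleftrightarrow> x = 0"
  proof
    assume "inner x x = 0"
    then have "(cmod (Rep_ell2 x i))\<^sup>2 = 0" for i
      unfolding self by (intro nonneg_infsum_le_0D[OF _ Rep_ell2_summable[of x]]) auto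
    then show "x = 0" by (simp add: Rep_ell2_inject[symmetric] zero_ell2.rep_eq fun_eq_iff)
  qed (simp add: inner_ell2_def zero_ell2.rep_eq)
  show "norm x = sqrt (inner x x)" unfolding self norm_ell2_def ..
qed (simp_all add: sgn_ell2_def dist_ell2_def uniformity_ell2_def open_ell2_def)
end

lemma Abs_ell2_bound:
  assumes "B \<ge> 0" "\<And>A. finite A \<Longrightarrow> (\<Sum>i\<in>A. (cmod (u i))\<^sup>2) \<le> B\<^sup>2"
  shows "(\<lambda>i. (cmod (u i))\<^sup>2) summable_on UNIV" "norm (Abs_ell2 u) \<le> B"
proof -
  show *: "(\<lambda>i. (cmod (u i))\<^sup>2) summable_on UNIV"
    using assms by (intro nonneg_bdd_above_summable_on) (auto intro!: bdd_aboveI[of _ "B\<^sup>2"])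
  have "(\<Sum>\<^sub>\<infinity>i. (cmod (u i))\<^sup>2) \<le> B\<^sup>2"
    by (rule infsum_le_finite_sums[OF *]) (use assms in auto)
  then show "norm (Abs_ell2 u) \<le> B"
    using * assms(1) by (simp add: norm_ell2_def Abs_ell2_inverse real_le_lsqrt)
qed

lemma sum_Rep_ell2_le:
  assumes "finite A"
  shows "(\<Sum>i\<in>A. (cmod (Rep_ell2 u i))\<^sup>2) \<le> (norm u)\<^sup>2"
proof -
  have "(\<Sum>i\<in>A. (cmod (Rep_ell2 u i))\<^sup>2) \<le> (\<Sum>\<^sub>\<infinity>i. (cmod (Rep_ell2 u i))\<^sup>2)"
    by (rule finite_sum_le_infsum) (use assms Rep_ell2_summable in auto)
  also have "\<dots> = (norm u)\<^sup>2"
    by (simp add: norm_ell2_def infsum_nonneg)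
  finally show ?thesis .
qed

lemma norm_Rep_ell2_le: "cmod (Rep_ell2 u i) \<le> norm u"
  using sum_Rep_ell2_le[of "{i}" u] by (simp add: power_mono_iff)

instance ell2 :: (type) complex_hilbert
proof
  fix X :: "nat \<Rightarrow> 'a ell2"
  assume X: "Cauchy X"
  have "\<exists>x. (\<lambda>n. Rep_ell2 (X n) i) \<longlonglongrightarrow> x" for i
  proof (rule convergent_eq_Cauchy[THEN iffD2], rule metric_CauchyI)
    fix e :: real assume "e > 0"
    then obtain M where "\<forall>m\<ge>M. \<forall>n\<ge>M. dist (X m) (X n) < e"
      using X metric_CauchyD by blast
    then show "\<exists>M. \<forall>m\<ge>M. \<forall>n\<ge>M. dist (Rep_ell2 (X m) i) (Rep_ell2 (X n) i) < e"
      using norm_Rep_ell2_le[of "X _ - X _" i]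
      by (metis dist_norm le_less_trans minus_ell2.rep_eq)
  qed
  then obtain x where x: "\<And>i. (\<lambda>n. Rep_ell2 (X n) i) \<longlonglongrightarrow> x i" by metis
  \<comment> \<open>The Cauchy bound is passed to the coordinatewise limit in finite sums, uniformly
    in the finite set. This gives at once that the difference to the limit is square-summable and
    that it is small.\<close>
  have tail: "\<exists>M. \<forall>n\<ge>M. (\<lambda>i. (cmod (Rep_ell2 (X n) i - x i))\<^sup>2) summable_on UNIV \<and>
      norm (Abs_ell2 (\<lambda>i. Rep_ell2 (X n) i - x i)) \<le> e" if e: "e > 0" for e
  proof -
    obtain M where M: "\<And>m n. m \<ge> M \<Longrightarrow> n \<ge> M \<Longrightarrow> dist (X m) (X n) < e"
      using X metric_CauchyD e by blast
    have "(\<Sum>i\<in>A. (cmod (Rep_ell2 (X n) i - x i))\<^sup>2) \<le> e\<^sup>2" if A: "finite A" and n: "n \<ge> M" for A n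
    proof (rule tendsto_upperbound)
      show "(\<lambda>m. \<Sum>i\<in>A. (cmod (Rep_ell2 (X n) i - Rep_ell2 (X m) i))\<^sup>2)
          \<longlonglongrightarrow> (\<Sum>i\<in>A. (cmod (Rep_ell2 (X n) i - x i))\<^sup>2)"
        by (intro tendsto_intros x)
      have "(\<Sum>i\<in>A. (cmod (Rep_ell2 (X n) i - Rep_ell2 (X m) i))\<^sup>2) \<le> e\<^sup>2" if "m \<ge> M" for m
      proof -
        have "(\<Sum>i\<in>A. (cmod (Rep_ell2 (X n - X m) i))\<^sup>2) \<le> (norm (X n - X m))\<^sup>2"
          by (rule sum_Rep_ell2_le[OF A])
        also have "\<dots> \<le> e\<^sup>2"
          using M[OF n that] by (intro power_mono) (auto simp: dist_norm)
        finally show ?thesis by (simp add: minus_ell2.rep_eq)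
      qed
      then show "\<forall>\<^sub>F m in sequentially. (\<Sum>i\<in>A. (cmod (Rep_ell2 (X n) i - Rep_ell2 (X m) i))\<^sup>2) \<le> e\<^sup>2"
        by (auto simp: eventually_sequentially)
    qed simp
    note bound = this
    show ?thesis
    proof (intro exI[of _ M] allI impI conjI)
      fix n assume n: "M \<le> n"
      show "(\<lambda>i. (cmod (Rep_ell2 (X n) i - x i))\<^sup>2) summable_on UNIV"
        "norm (Abs_ell2 (\<lambda>i. Rep_ell2 (X n) i - x i)) \<le> e"
        by (rule Abs_ell2_bound[OF less_imp_le[OF e] bound[OF _ n]]; assumption)+
    qed
  qed
  have "(\<lambda>i. (cmod (x i))\<^sup>2) summable_on UNIV"
  proof -
    obtain n where "(\<lambda>i. (cmod (Rep_ell2 (X n) i - x i))\<^sup>2) summable_on UNIV"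
      using tail[OF zero_less_one] by blast
    then have "(\<lambda>i. (cmod (- 1 * (Rep_ell2 (X n) i - x i)))\<^sup>2) summable_on UNIV"
      by (rule square_summable_scale)
    from square_summable_add[OF Rep_ell2_summable[of "X n"] this]
    show ?thesis by simp
  qed
  then have Rep_x: "Rep_ell2 (Abs_ell2 x) = x" by (simp add: Abs_ell2_inverse)
  have diff: "X n - Abs_ell2 x = Abs_ell2 (\<lambda>i. Rep_ell2 (X n) i - x i)" for n
  proof -
    have "Abs_ell2 (Rep_ell2 (X n - Abs_ell2 x)) = Abs_ell2 (\<lambda>i. Rep_ell2 (X n) i - x i)"
      by (simp only: minus_ell2.rep_eq Rep_x)
    then show ?thesis by (simp only: Rep_ell2_inverse)
  qed
  have "X \<longlonglongrightarrow> Abs_ell2 x"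
  proof (rule metric_LIMSEQ_I)
    fix e :: real assume "e > 0"
    then obtain M where "\<forall>n\<ge>M. norm (X n - Abs_ell2 x) \<le> e / 2"
      using tail[of "e / 2"] unfolding diff by auto
    with \<open>e > 0\<close> show "\<exists>M. \<forall>n\<ge>M. dist (X n) (Abs_ell2 x) < e"
      by (intro exI[of _ M]) (force simp: dist_norm)
  qed
  then show "convergent X" by (rule convergentI)
next
  fix r :: real and c :: complex and x :: "'a ell2"
  show "r *\<^sub>R x = complex_of_real r *\<^sub>C x" by (rule scaleR_ell2_def)
  have "(\<Sum>\<^sub>\<infinity>i. (cmod (c * Rep_ell2 x i))\<^sup>2) = (cmod c)\<^sup>2 * (\<Sum>\<^sub>\<infinity>i. (cmod (Rep_ell2 x i))\<^sup>2)"
    by (simp add: norm_mult power_mult_distrib infsum_cmult_right')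
  then show "norm (c *\<^sub>C x) = cmod c * norm x"
    by (simp add: norm_ell2_def scaleC_ell2.rep_eq real_sqrt_mult)
qed

lemma cinner_ell2: "cinner u v = (\<Sum>\<^sub>\<infinity>i. Rep_ell2 u i * cnj (Rep_ell2 v i))"
proof -
  have "inner u (\<i> *\<^sub>C v) = Re (\<Sum>\<^sub>\<infinity>i. - \<i> * (Rep_ell2 u i * cnj (Rep_ell2 v i)))"
    unfolding inner_ell2_def by (simp add: scaleC_ell2.rep_eq mult_ac)
  also have "\<dots> = Im (\<Sum>\<^sub>\<infinity>i. Rep_ell2 u i * cnj (Rep_ell2 v i))"
    unfolding infsum_cmult_right' by simp
  finally show ?thesis by (simp add: cinner_def complex_eq_iff inner_ell2_def)
qed

text \<open>Weighted composition operators comprise Fourier multipliers and shifts.\<close>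

definition wcomp :: "('i \<Rightarrow> complex) \<Rightarrow> ('i \<Rightarrow> 'i) \<Rightarrow> 'i ell2 \<Rightarrow> 'i ell2" where
  "wcomp c \<pi> u = Abs_ell2 (\<lambda>i. c i * Rep_ell2 u (\<pi> i))"

lemma wcomp:
  assumes "inj \<pi>" "\<And>i. cmod (c i) \<le> B"
  shows Rep_wcomp: "Rep_ell2 (wcomp c \<pi> u) i = c i * Rep_ell2 u (\<pi> i)"
    and norm_wcomp_le: "norm (wcomp c \<pi> u) \<le> B * norm u"
    and bounded_clinear_wcomp: "bounded_clinear (wcomp c \<pi>)"
proof -
  have B: "B \<ge> 0" using assms(2)[of undefined] norm_ge_zero[of "c undefined"] by linarith
  have bound: "(\<Sum>i\<in>A. (cmod (c i * Rep_ell2 u (\<pi> i)))\<^sup>2) \<le> (B * norm u)\<^sup>2" if "finite A" for A u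
  proof -
    have "(\<Sum>i\<in>A. (cmod (c i * Rep_ell2 u (\<pi> i)))\<^sup>2) \<le> (\<Sum>i\<in>A. B\<^sup>2 * (cmod (Rep_ell2 u (\<pi> i)))\<^sup>2)"
      using assms(2) B
      by (intro sum_mono) (auto simp: norm_mult power_mult_distrib intro!: mult_right_mono power_mono)
    also have "\<dots> = B\<^sup>2 * (\<Sum>i\<in>\<pi> ` A. (cmod (Rep_ell2 u i))\<^sup>2)"
      using assms(1) by (subst sum.reindex) (auto simp: sum_distrib_left inj_on_def)
    also have "\<dots> \<le> B\<^sup>2 * (norm u)\<^sup>2"
      using that by (intro mult_left_mono sum_Rep_ell2_le) auto
    finally show ?thesis by (simp add: power_mult_distrib)
  qed
  have Rep: "Rep_ell2 (wcomp c \<pi> u) = (\<lambda>i. c i * Rep_ell2 u (\<pi> i))" for u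
    unfolding wcomp_def using Abs_ell2_bound(1)[OF _ bound] B by (simp add: Abs_ell2_inverse)
  then show "Rep_ell2 (wcomp c \<pi> u) i = c i * Rep_ell2 u (\<pi> i)" by simp
  have norm: "norm (wcomp c \<pi> u) \<le> B * norm u" for u
    unfolding wcomp_def by (rule Abs_ell2_bound(2)[OF _ bound]) (use B in auto)
  then show "norm (wcomp c \<pi> u) \<le> B * norm u" .
  show "bounded_clinear (wcomp c \<pi>)"
    by (rule bounded_clinearI[OF _ _ norm])
      (simp_all add: Rep_ell2_inject[symmetric] Rep plus_ell2.rep_eq scaleC_ell2.rep_eq
        fun_eq_iff algebra_simps)
qed

lemma cinner_wcomp:
  assumes "\<And>i. \<pi> (\<pi>' i) = i" "\<And>i. \<pi>' (\<pi> i) = i" "\<And>i. cmod (c i) \<le> B"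
  shows "cinner (wcomp c \<pi> u) v = cinner u (wcomp (\<lambda>i. cnj (c (\<pi>' i))) \<pi>' v)"
proof -
  have inj: "inj \<pi>" "inj \<pi>'" and bij: "bij \<pi>"
    using assms(1,2) by (metis injI, metis injI, metis o_bij fun_eq_iff comp_apply id_apply)
  have B: "cmod (cnj (c (\<pi>' i))) \<le> B" for i using assms(3) by simp
  have "cinner u (wcomp (\<lambda>i. cnj (c (\<pi>' i))) \<pi>' v) =
      (\<Sum>\<^sub>\<infinity>i. Rep_ell2 u i * cnj (cnj (c (\<pi>' i)) * Rep_ell2 v (\<pi>' i)))"
    by (simp only: cinner_ell2 Rep_wcomp[where B = B, OF inj(2) B])
  also have "\<dots> = (\<Sum>\<^sub>\<infinity>i. Rep_ell2 u (\<pi> i) * cnj (cnj (c (\<pi>' (\<pi> i))) * Rep_ell2 v (\<pi>' (\<pi> i))))"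
    by (rule infsum_reindex_bij_betw[OF bij, symmetric])
  also have "\<dots> = cinner (wcomp c \<pi> u) v"
    by (simp only: cinner_ell2 Rep_wcomp[where B = B, OF inj(1) assms(3)] assms(2))
      (simp add: mult_ac)
  finally show ?thesis by simp
qed

definition unit_ell2 :: "'i \<Rightarrow> 'i ell2" where
  "unit_ell2 i = Abs_ell2 (\<lambda>j. of_bool (j = i))"

lemma Rep_unit_ell2: "Rep_ell2 (unit_ell2 i) j = of_bool (j = i)"
proof -
  have "(\<Sum>j\<in>A. (cmod (of_bool (j = i) :: complex))\<^sup>2) \<le> 1\<^sup>2" if "finite A" for A
  proof -
    have "(\<Sum>j\<in>A. (cmod (of_bool (j = i) :: complex))\<^sup>2) = (\<Sum>j\<in>A. if j = i then 1 else 0)"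
      by (rule sum.cong) auto
    then show ?thesis using that by simp
  qed
  then show ?thesis
    unfolding unit_ell2_def using Abs_ell2_bound(1)[of 1 "\<lambda>j. of_bool (j = i)"]
    by (simp add: Abs_ell2_inverse)
qed

lemma Rep_ell2_sum: "Rep_ell2 (sum f A) j = (\<Sum>i\<in>A. Rep_ell2 (f i) j)"
  by (induction A rule: infinite_finite_induct) (simp_all add: zero_ell2.rep_eq plus_ell2.rep_eq)

lemma finite_rank_wcomp:
  assumes "inj \<pi>" "finite {i. c i \<noteq> 0}"
  shows "finite_rank (wcomp c \<pi>)"
proof -
  define I where "I = {i. c i \<noteq> 0}"
  have "cmod (c i) \<le> (\<Sum>i\<in>I. cmod (c i))" for i
  proof (cases "i \<in> I")
    case True
    then show ?thesis using assms(2) by (intro member_le_sum) (auto simp: I_def)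
  qed (auto simp: I_def sum_nonneg)
  note wc = wcomp[where c = c, OF assms(1) this]
  have eq: "wcomp c \<pi> u = (\<Sum>i\<in>I. (c i * Rep_ell2 u (\<pi> i)) *\<^sub>C unit_ell2 i)" for u
  proof (subst Rep_ell2_inject[symmetric], rule ext)
    fix j
    have "(\<Sum>i\<in>I. c i * Rep_ell2 u (\<pi> i) * of_bool (j = i)) =
        (\<Sum>i\<in>I. if i = j then c j * Rep_ell2 u (\<pi> j) else 0)"
      by (rule sum.cong) auto
    then show "Rep_ell2 (wcomp c \<pi> u) j =
        Rep_ell2 (\<Sum>i\<in>I. (c i * Rep_ell2 u (\<pi> i)) *\<^sub>C unit_ell2 i) j"
      using assms(2) by (simp add: wc Rep_ell2_sum scaleC_ell2.rep_eq Rep_unit_ell2) (simp add: I_def)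
  qed
  let ?B = "unit_ell2 ` I \<union> (\<lambda>i. \<i> *\<^sub>C unit_ell2 i) ` I"
  have "wcomp c \<pi> u \<in> span ?B" for u
    unfolding eq
  proof (intro span_sum)
    fix i assume "i \<in> I"
    then show "(c i * Rep_ell2 u (\<pi> i)) *\<^sub>C unit_ell2 i \<in> span ?B"
      by (subst scaleC_decomp) (intro span_add span_scale span_base, auto)
  qed
  moreover have "finite ?B" using assms(2) by (simp add: I_def)
  ultimately show ?thesis
    using wc(3) unfolding finite_rank_def bounded_clinear_def by blast
qed

section \<open>Spectrum in a half-plane\<close>

text \<open>The operators \<open>H w\<close> are only assumed bounded one by one. The resolvent
  identity \<open>res\<close> bounds them uniformly near a point \<open>v\<close>, then gives weak
  continuity and finally the derivative. Holomorphy after applying a functional is all that the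
  weakly defined Riesz integral requires.\<close>

lemma holomorphic_inverse_family:
  fixes A :: "'a::complex_hilbert \<Rightarrow> 'a"
  assumes "open U"
    and H: "\<And>w. w \<in> U \<Longrightarrow> bounded_linear (H w)"
    and left: "\<And>w x. w \<in> U \<Longrightarrow> H w (w *\<^sub>C x - A x) = x"
    and right: "\<And>w x. w \<in> U \<Longrightarrow> w *\<^sub>C H w x - A (H w x) = x"
    and A: "bounded_clinear A"
    and l: "bounded_linear l" "\<And>c x. l (c *\<^sub>C x) = c * (l x :: complex)"
  shows "(\<lambda>w. l (H w y)) holomorphic_on U"
proof -
  have A_scale: "A (c *\<^sub>C x) = c *\<^sub>C A x" for c x using A by (simp add: bounded_clinear_def)
  have A_diff: "A (x - y) = A x - A y" for x y
    using A by (simp add: bounded_clinear_def linear_diff bounded_linear.linear)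
  have H_scale: "H w (c *\<^sub>C x) = c *\<^sub>C H w x" if "w \<in> U" for w c x
  proof -
    have "w *\<^sub>C (c *\<^sub>C H w x) - A (c *\<^sub>C H w x) = c *\<^sub>C (w *\<^sub>C H w x - A (H w x))"
      by (simp add: A_scale complex_vector.scale_right_diff_distrib scaleC_scaleC mult.commute)
    then show ?thesis using left[OF that, of "c *\<^sub>C H w x"] by (simp add: right[OF that])
  qed
  have res: "H w x = H v x + (v - w) *\<^sub>C H v (H w x)" if "w \<in> U" "v \<in> U" for w v x
  proof -
    have "H v (v *\<^sub>C H w x - A (H w x)) = H v (x + (v - w) *\<^sub>C H w x)"
      using right[OF that(1), of x] by (simp add: complex_vector.scale_left_diff_distrib algebra_simps)
    then show ?thesis
      using that left[of v] H_scale[of v]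
      by (simp add: bounded_linear.linear[OF H] linear_add)
  qed
  have "((\<lambda>w. l (H w y)) has_field_derivative - l (H v (H v y))) (at v)" if v: "v \<in> U" for v
  proof -
    interpret Hv: bounded_linear "H v" using H v .
    interpret l: bounded_linear l by fact
    obtain K where K: "K > 0" "\<And>x. norm (H v x) \<le> norm x * K" using Hv.pos_bounded by blast
    obtain M where M: "M > 0" "\<And>x. cmod (l x) \<le> norm x * M" using l.pos_bounded by blast
    obtain e where e: "e > 0" "ball v e \<subseteq> U" using assms(1) v open_contains_ball by blast
    \<comment> \<open>For \<open>cmod (v - w) \<le> 1 / (2 * K)\<close> the second term of the
      resolvent identity is at most half of \<open>norm (H w x)\<close> and can be absorbed.\<close>
    define d where "d = min e (1 / (2 * K))"
    have d: "d > 0" using e K by (simp add: d_def)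
    have near: "w \<in> U" "norm (H w x) \<le> 2 * K * norm x" if w: "dist w v < d" for w x
    proof -
      show wU: "w \<in> U" using w e by (auto simp: d_def dist_commute)
      have "norm (H w x) \<le> norm (H v x) + cmod (v - w) * norm (H v (H w x))"
        by (subst res[OF wU v]) (metis norm_triangle_ineq norm_scaleC)
      also have "\<dots> \<le> norm x * K + cmod (v - w) * (norm (H w x) * K)"
        by (intro add_mono mult_left_mono K) auto
      also have "\<dots> \<le> norm x * K + 1 / (2 * K) * (norm (H w x) * K)"
        using w K(1)
        by (intro add_mono mult_right_mono) (auto simp: d_def dist_norm norm_minus_commute)
      finally show "norm (H w x) \<le> 2 * K * norm x" using K(1) by (simp add: mult_ac)
    qed
    have "((\<lambda>w. l (H w x)) \<longlongrightarrow> l (H v x)) (at v)" for x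
    proof (rule LIM_zero_cancel, rule Lim_null_comparison)
      show "\<forall>\<^sub>F w in at v. norm (l (H w x) - l (H v x)) \<le> dist w v * (K * (2 * K * norm x) * M)"
        unfolding eventually_at
      proof (intro exI[of _ d] conjI d ballI impI, elim conjE)
        fix w assume w: "dist w v < d"
        have "norm (l (H w x) - l (H v x)) = cmod (v - w) * cmod (l (H v (H w x)))"
          by (subst res[OF near(1)[OF w] v]) (simp add: l.add l(2) norm_mult)
        also have "\<dots> \<le> cmod (v - w) * (norm (H v (H w x)) * M)"
          by (intro mult_left_mono M) auto
        also have "\<dots> \<le> cmod (v - w) * (2 * K * norm x * K * M)"
        proof (intro mult_left_mono mult_right_mono)
          show "norm (H v (H w x)) \<le> 2 * K * norm x * K"
            using K(2)[of "H w x"] mult_right_mono[OF near(2)[OF w, of x], of K] K(1) by linarith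
        qed (use M in auto)
        finally show "norm (l (H w x) - l (H v x)) \<le> dist w v * (K * (2 * K * norm x) * M)"
          by (simp add: dist_norm norm_minus_commute mult_ac)
      qed
      show "((\<lambda>w. dist w v * (K * (2 * K * norm x) * M)) \<longlongrightarrow> 0) (at v)"
        by (auto intro!: tendsto_eq_intros)
    qed
    note cont = this
    have "((\<lambda>w. (l (H w y) - l (H v y)) / (w - v)) \<longlongrightarrow> - l (H v (H v y))) (at v)"
    proof (rule Lim_transform_eventually[OF tendsto_minus[OF cont]])
      show "\<forall>\<^sub>F w in at v. - l (H w (H v y)) = (l (H w y) - l (H v y)) / (w - v)"
        unfolding eventually_at
      proof (intro exI[of _ d] conjI d ballI impI, elim conjE)
        fix w assume w: "w \<noteq> v" "dist w v < d"
        \<comment> \<open>With \<open>v\<close> and \<open>w\<close> exchanged in the resolvent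
          identity, the moving operator \<open>H w\<close> acts on the fixed vector
          \<open>H v y\<close>, so that \<open>cont\<close> applies to the difference
          quotient.\<close>
        have "H v y = H w y + (w - v) *\<^sub>C H w (H v y)" by (rule res[OF v near(1)[OF w(2)]])
        then have "l (H v y) = l (H w y) + (w - v) * l (H w (H v y))" by (metis l.add l(2))
        then show "- l (H w (H v y)) = (l (H w y) - l (H v y)) / (w - v)"
          using w by (simp add: field_simps)
      qed
    qed
    then show ?thesis by (simp add: has_field_derivative_iff)
  qed
  then show ?thesis
    using holomorphic_on_def field_differentiable_def has_field_derivative_at_within by blast
qed

text \<open>Only \<open>\<Psi> \<circ> \<Phi>\<close> is the identity: the Hilbert space of \<open>T\<close> may be larger than \<open>V\<close>, and then \<open>T\<close>
  vanishes on the additional summand, so that the mean-zero condition can be ignored there.\<close>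

locale half_plane_operator =
  fixes V :: "'v::complex_vector set" and N :: "'v \<Rightarrow> real" and L :: "'v \<Rightarrow> 'v"
    and \<Phi> :: "'v \<Rightarrow> 'h::complex_hilbert" and \<Psi> :: "'h \<Rightarrow> 'v" and \<kappa> :: real
    and T :: "'h \<Rightarrow> 'h"
  assumes \<Phi>_add: "\<And>x y. x \<in> V \<Longrightarrow> y \<in> V \<Longrightarrow> \<Phi> (x + y) = \<Phi> x + \<Phi> y"
    and \<Phi>_scale: "\<And>c x. x \<in> V \<Longrightarrow> \<Phi> (c *\<^sub>C x) = c *\<^sub>C \<Phi> x"
    and \<Phi>_bound: "\<And>x. x \<in> V \<Longrightarrow> norm (\<Phi> x) \<le> \<kappa> * N x"
    and \<Psi>_V: "\<And>h. \<Psi> h \<in> V"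
    and \<Psi>_add: "\<And>g h. \<Psi> (g + h) = \<Psi> g + \<Psi> h"
    and \<Psi>_scale: "\<And>c h. \<Psi> (c *\<^sub>C h) = c *\<^sub>C \<Psi> h"
    and \<Psi>_bound: "\<And>h. N (\<Psi> h) \<le> \<kappa> * norm h"
    and \<Psi>_\<Phi>: "\<And>x. x \<in> V \<Longrightarrow> \<Psi> (\<Phi> x) = x"
    and L_V: "\<And>x. x \<in> V \<Longrightarrow> L x \<in> V"
    and T_eq: "\<And>h. T h = \<Phi> (L (\<Psi> h))"
    and T: "bounded_clinear T"
    and \<kappa>: "\<kappa> \<ge> 0" and N_nonneg: "\<And>x. x \<in> V \<Longrightarrow> N x \<ge> 0"
    and splitting: "\<And>z. Re z > 0 \<Longrightarrow> \<exists>G F c. c > 0 \<and> bounded_linear G \<and> finite_rank F \<and>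
      (\<forall>x. c * (norm x)\<^sup>2 \<le> inner (G x) x) \<and> (\<forall>x. z *\<^sub>C x - T x = G x - F x)"
begin

lemma L_\<Psi>: "L (\<Psi> h) = \<Psi> (T h)"
  by (simp add: T_eq \<Psi>_\<Phi> L_V \<Psi>_V)

lemma T_\<Phi>: "x \<in> V \<Longrightarrow> T (\<Phi> x) = \<Phi> (L x)"
  by (simp add: T_eq \<Psi>_\<Phi>)

lemma \<Psi>_0: "\<Psi> 0 = 0"
  using \<Psi>_add[of 0 0] by simp

lemma \<Psi>_diff: "\<Psi> (g - h) = \<Psi> g - \<Psi> h"
  using \<Psi>_add[of "g - h" h] by (simp add: eq_diff_eq)

lemma V_closed:
  assumes "x \<in> V"
  shows "c *\<^sub>C x \<in> V" "y \<in> V \<Longrightarrow> x + y \<in> V" "y \<in> V \<Longrightarrow> x - y \<in> V"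
proof -
  show "c *\<^sub>C x \<in> V" using \<Psi>_V[of "c *\<^sub>C \<Phi> x"] assms by (simp add: \<Psi>_scale \<Psi>_\<Phi>)
  show "x + y \<in> V" if "y \<in> V" using \<Psi>_V[of "\<Phi> x + \<Phi> y"] assms that by (simp add: \<Psi>_add \<Psi>_\<Phi>)
  show "x - y \<in> V" if "y \<in> V" using \<Psi>_V[of "\<Phi> x - \<Phi> y"] assms that by (simp add: \<Psi>_diff \<Psi>_\<Phi>)
qed

lemma \<Phi>_diff: "x \<in> V \<Longrightarrow> y \<in> V \<Longrightarrow> \<Phi> (x - y) = \<Phi> x - \<Phi> y"
  using \<Phi>_add[of "x - y" y] V_closed(3)[of x y] by (simp add: eq_diff_eq)

lemma T_linear: "linear T" "T (c *\<^sub>C x) = c *\<^sub>C T x"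
  using T by (auto simp: bounded_clinear_def bounded_linear.linear)

text \<open>The kernel of \<Psi> is annihilated by \<open>T\<close>, so an eigenvector of
  \<open>T\<close> for a nonzero eigenvalue survives under \<Psi>.\<close>

lemma eigenvalueI:
  assumes "T h = z *\<^sub>C h" "h \<noteq> 0" "z \<noteq> 0"
  shows "eigenvalue V L z"
proof -
  have "\<Psi> h \<noteq> 0"
  proof
    assume 0: "\<Psi> h = 0"
    then have "T h = T 0" by (simp add: T_eq \<Psi>_0)
    also have "\<dots> = 0" by (simp add: linear_0 T_linear)
    finally show False
      using assms complex_vector.scale_eq_0_iff by metis
  qed
  moreover have "\<Psi> h \<in> eigenspace V L z"
    by (simp add: eigenspace_def \<Psi>_V L_\<Psi> assms(1) \<Psi>_scale)
  ultimately show ?thesis unfolding eigenvalue_def by blast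
qed

lemma compressed_bounded_linear:
  assumes "bounded_linear R" "\<And>c x. R (c *\<^sub>C x) = c *\<^sub>C R x"
  shows "bounded_linear_between V N V N (\<lambda>x. \<Psi> (R (\<Phi> x)))"
proof -
  interpret R: bounded_linear R by fact
  obtain K where K: "K > 0" "\<And>x. norm (R x) \<le> norm x * K" using R.pos_bounded by blast
  have "N (\<Psi> (R (\<Phi> x))) \<le> \<kappa> * (\<kappa> * K) * N x" if "x \<in> V" for x
  proof -
    have "N (\<Psi> (R (\<Phi> x))) \<le> \<kappa> * norm (R (\<Phi> x))" by (rule \<Psi>_bound)
    also have "\<dots> \<le> \<kappa> * (norm (\<Phi> x) * K)" by (intro mult_left_mono K \<kappa>)
    also have "\<dots> \<le> \<kappa> * ((\<kappa> * N x) * K)"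
      using \<Phi>_bound[OF that] K(1) \<kappa> by (intro mult_left_mono mult_right_mono) auto
    finally show ?thesis by (simp add: mult_ac)
  qed
  then show ?thesis
    unfolding bounded_linear_between_def
    by (auto simp: \<Psi>_V \<Phi>_add \<Phi>_scale R.add assms(2) \<Psi>_add \<Psi>_scale)
qed

text \<open>The additional term \<open>P\<close> is 0 for the resolvent itself, and it is the
  projection onto the eigenspace for the regularized family near an eigenvalue.\<close>

lemma inverse_exists:
  assumes "Re z > 0" "finite_rank P" "\<And>h. z *\<^sub>C h - T h + P h = 0 \<Longrightarrow> h = 0"
  shows "\<exists>R. bounded_linear R \<and> (\<forall>h. R (z *\<^sub>C h - T h + P h) = h) \<and>
    (\<forall>h. z *\<^sub>C R h - T (R h) + P (R h) = h)"
proof -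
  obtain G F c where GF: "c > 0" "bounded_linear G" "finite_rank F"
    "\<And>x. c * (norm x)\<^sup>2 \<le> inner (G x) x" "\<And>x. z *\<^sub>C x - T x = G x - F x"
    using splitting[OF assms(1)] by blast
  have eq: "z *\<^sub>C x - T x + P x = G x - (F x + - P x)" for x by (simp add: GF(5))
  have "finite_rank (\<lambda>x. F x + - P x)" by (intro finite_rank_add GF finite_rank_minus assms)
  then show ?thesis
    unfolding eq
    by (rule fredholm_finite_rank[OF GF(2,1,4)]) (use assms(3) in \<open>simp add: eq\<close>)
qed

lemma not_eigenvalue_resolvent:
  assumes "Re z > 0" "\<not> eigenvalue V L z"
  shows "z \<notin> spectrum V N L"
proof -
  have "finite_rank (\<lambda>x::'h. 0::'h)" using finite_rank_sum[of "{}"] by simp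
  moreover have "h = 0" if "z *\<^sub>C h - T h + 0 = 0" for h
  proof -
    have "z \<noteq> 0" using assms(1) by auto
    then show ?thesis using eigenvalueI[of h z] that assms(2) by auto
  qed
  ultimately obtain R where R: "bounded_linear R" "\<And>h. R (z *\<^sub>C h - T h) = h"
    "\<And>h. z *\<^sub>C R h - T (R h) = h"
    using inverse_exists[OF assms(1), of "\<lambda>_. 0"] by auto
  \<comment> \<open>The inverse comes from a theorem over the reals; complex linearity follows from
    its uniqueness.\<close>
  have R_scale: "R (c *\<^sub>C x) = c *\<^sub>C R x" for c x
  proof -
    have "z *\<^sub>C (c *\<^sub>C R x) - T (c *\<^sub>C R x) = c *\<^sub>C (z *\<^sub>C R x - T (R x))"
      by (simp add: T_linear complex_vector.scale_right_diff_distrib scaleC_scaleC mult.commute)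
    then show ?thesis using R(2)[of "c *\<^sub>C R x"] by (simp add: R(3))
  qed
  have "is_resolvent V N L z (\<lambda>x. \<Psi> (R (\<Phi> x)))"
    unfolding is_resolvent_def
  proof (intro conjI ballI)
    show "bounded_linear_between V N V N (\<lambda>x. \<Psi> (R (\<Phi> x)))"
      by (rule compressed_bounded_linear[OF R(1) R_scale])
    fix x assume x: "x \<in> V"
    have "\<Phi> (z *\<^sub>C x - L x) = z *\<^sub>C \<Phi> x - T (\<Phi> x)"
      using x by (simp add: \<Phi>_diff V_closed L_V \<Phi>_scale T_\<Phi>)
    then show "\<Psi> (R (\<Phi> (z *\<^sub>C x - L x))) = x" using x by (simp add: R \<Psi>_\<Phi>)
    have "z *\<^sub>C \<Psi> (R (\<Phi> x)) - L (\<Psi> (R (\<Phi> x))) = \<Psi> (z *\<^sub>C R (\<Phi> x) - T (R (\<Phi> x)))"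
      by (simp add: \<Psi>_diff \<Psi>_scale L_\<Psi>)
    then show "z *\<^sub>C \<Psi> (R (\<Phi> x)) - L (\<Psi> (R (\<Phi> x))) = x" using x by (simp add: R \<Psi>_\<Phi>)
  qed
  then show ?thesis by (auto simp: spectrum_def)
qed

lemma eigenvalue_in_spectrum:
  assumes "eigenvalue V L z"
  shows "z \<in> spectrum V N L"
proof -
  obtain x where x: "x \<in> V" "L x = z *\<^sub>C x" "x \<noteq> 0"
    using assms by (auto simp: eigenvalue_def eigenspace_def)
  have False if R: "is_resolvent V N L z R" for R
  proof -
    have "R (0 *\<^sub>C x) = 0 *\<^sub>C R x"
      using R x(1) unfolding is_resolvent_def bounded_linear_between_def by blast
    then have "R (z *\<^sub>C x - L x) = 0" by (simp add: x)
    then show False using R x unfolding is_resolvent_def by metis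
  qed
  then show ?thesis by (auto simp: spectrum_def)
qed

lemma spectrum_half_plane:
  "spectrum V N L \<inter> {z. Re z > 0} = {z. Re z > 0 \<and> eigenvalue V L z}"
  using not_eigenvalue_resolvent eigenvalue_in_spectrum by auto

text \<open>The eigenvectors of \<open>T\<close> at \<open>z0\<close> carry a form for which they are left eigenvectors as
  well; the projection along this form splits off the singular part of the resolvent.\<close>

lemma finite_algebraic_multiplicityI:
  assumes z0: "Re z0 > 0" "eigenvalue V L z0"
    and isolated: "z0 isolated_in spectrum V N L"
    and q: "\<And>v. bounded_linear (\<lambda>u. q u v)" "\<And>c u v. q (c *\<^sub>C u) v = c * (q u v :: complex)"
    and q_sym: "\<And>u v. q u v = cnj (q v u)"
    and q_pos: "\<And>u. T u = z0 *\<^sub>C u \<Longrightarrow> u \<noteq> 0 \<Longrightarrow> Re (q u u) > 0"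
    and q_T: "\<And>u v. T v = z0 *\<^sub>C v \<Longrightarrow> q (T u) v = z0 * q u v"
  shows "finite_algebraic_multiplicity V N L z0"
proof -
  define E where "E = {u. T u = z0 *\<^sub>C u}"
  have E: "0 \<in> E" "u \<in> E \<Longrightarrow> v \<in> E \<Longrightarrow> u + v \<in> E" "u \<in> E \<Longrightarrow> v \<in> E \<Longrightarrow> u - v \<in> E" "u \<in> E \<Longrightarrow> c *\<^sub>C u \<in> E"
    for u v c
    by (auto simp: E_def linear_0 linear_add linear_diff T_linear scaleC_add_right
        complex_vector.scale_right_diff_distrib scaleC_scaleC mult.commute)
  have E_sum: "sum f I \<in> E" if "\<And>i. i \<in> I \<Longrightarrow> f i \<in> E" for f and I :: "'h set"
    using that by (induction I rule: infinite_finite_induct) (auto intro: E)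
  have qlin: "linear (\<lambda>u. q u v)" for v using q(1) by (rule bounded_linear.linear)
  \<comment> \<open>The form \<open>q\<close> is known to be positive only on \<open>E\<close>, so
    the orthonormal systems stay inside \<open>E\<close>.\<close>
  define orth where "orth B \<longleftrightarrow> finite B \<and> B \<subseteq> E \<and> (\<forall>u\<in>B. \<forall>v\<in>B. q u v = of_bool (u = v))" for B
  have coord: "q (\<Sum>v\<in>B. a v *\<^sub>C v) u = a u" if "orth B" "u \<in> B" for B a u
  proof -
    have "q (\<Sum>v\<in>B. a v *\<^sub>C v) u = (\<Sum>v\<in>B. a v * q v u)"
      by (simp add: linear_sum[OF qlin] q(2))
    also have "\<dots> = (\<Sum>v\<in>B. if v = u then a u else 0)"
      using that by (intro sum.cong) (auto simp: orth_def)
    finally show ?thesis using that by (simp add: orth_def)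
  qed
  obtain G F c where GF: "c > 0" "finite_rank F"
    "\<And>x. c * (norm x)\<^sup>2 \<le> inner (G x) x" "\<And>x. z0 *\<^sub>C x - T x = G x - F x"
    using splitting[OF z0(1)] by blast
  obtain r where r: "\<And>B. finite B \<Longrightarrow> card B > r \<Longrightarrow>
      \<exists>\<alpha>. (\<exists>b\<in>B. \<alpha> b \<noteq> 0) \<and> F (\<Sum>b\<in>B. \<alpha> b *\<^sub>R b) = 0"
    using finite_rank_dependent[OF GF(2)] by blast
  \<comment> \<open>On \<open>E\<close> the operators \<open>F\<close> and \<open>G\<close> agree,
    and \<open>G\<close> is injective by coercivity; the finite rank of \<open>F\<close> therefore
    bounds the size of such a system.\<close>
  have card_le: "card B \<le> r" if B: "orth B" for B
  proof (rule ccontr)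
    assume "\<not> card B \<le> r"
    then obtain \<alpha> where \<alpha>: "\<exists>b\<in>B. \<alpha> b \<noteq> 0" "F (\<Sum>b\<in>B. \<alpha> b *\<^sub>R b) = 0"
      using r[of B] B by (auto simp: orth_def)
    define w where "w = (\<Sum>b\<in>B. complex_of_real (\<alpha> b) *\<^sub>C b)"
    have "w \<in> E" unfolding w_def using B by (intro E_sum E) (auto simp: orth_def)
    moreover have "F w = 0" using \<alpha>(2) by (simp add: w_def scaleR_scaleC)
    ultimately have "G w = 0" using GF(4)[of w] by (simp add: E_def)
    then have "w = 0" using GF(1) GF(3)[of w] by (simp add: mult_le_0_iff)
    then have "complex_of_real (\<alpha> b) = 0" if "b \<in> B" for b
      using coord[OF B that, of "\<lambda>b. complex_of_real (\<alpha> b)"] linear_0[OF qlin] by (simp add: w_def)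
    then show False using \<alpha>(1) by auto
  qed
  have "orth {}" by (simp add: orth_def)
  then obtain B where B: "orth B" and maxB: "\<And>C. orth C \<Longrightarrow> card C \<le> card B"
    using ex_has_greatest_nat[of orth "{}" card "Suc r"] card_le by (metis less_Suc_eq_le)
  \<comment> \<open>A maximal system turns out to be a basis of \<open>E\<close> (see
    \<open>P_id\<close>), so this is the projection onto \<open>E\<close> along its
    \<open>q\<close>-orthogonal complement.\<close>
  define P where "P u = (\<Sum>b\<in>B. q u b *\<^sub>C b)" for u
  have P_E: "P u \<in> E" for u
    unfolding P_def using B by (intro E_sum E) (auto simp: orth_def)
  have q_P: "q (P u) b = q u b" if "b \<in> B" for u b
    unfolding P_def using coord[OF B that] .
  have P_id: "P u = u" if u: "u \<in> E" for u
  proof (rule ccontr)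
    assume "P u \<noteq> u"
    define d where "d = u - P u"
    have d: "d \<in> E" "d \<noteq> 0" using u P_E \<open>P u \<noteq> u\<close> by (auto simp: d_def E)
    have qd: "q d b = 0" if "b \<in> B" for b
      using that by (simp add: d_def linear_diff[OF qlin] q_P)
    have pos: "Re (q d d) > 0" using d by (intro q_pos) (auto simp: E_def)
    have real: "q d d = complex_of_real (Re (q d d))"
      using q_sym[of d d] by (simp add: complex_eq_iff)
    define e where "e = complex_of_real (1 / sqrt (Re (q d d))) *\<^sub>C d"
    have right: "q v e = complex_of_real (1 / sqrt (Re (q d d))) * q v d" for v
      by (subst q_sym) (simp add: e_def q(2) q_sym[of v d])
    have qee: "q e e = 1"
    proof -
      have "q e e = complex_of_real (1 / sqrt (Re (q d d))) *
          (complex_of_real (1 / sqrt (Re (q d d))) * q d d)"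
        unfolding right by (simp only: e_def q(2))
      also have "\<dots> = complex_of_real (1 / sqrt (Re (q d d)) * (1 / sqrt (Re (q d d))) * Re (q d d))"
        by (subst real) (simp only: of_real_mult mult.assoc)
      also have "1 / sqrt (Re (q d d)) * (1 / sqrt (Re (q d d))) * Re (q d d) = 1"
        using pos by (simp add: field_simps flip: power2_eq_square)
      finally show ?thesis by simp
    qed
    have qeb: "q e b = 0" "q b e = 0" if "b \<in> B" for b
    proof -
      show "q e b = 0" using qd[OF that] by (simp add: e_def q(2))
      then show "q b e = 0" by (subst q_sym) simp
    qed
    have "e \<notin> B" using qee qeb by auto
    moreover have "orth (insert e B)"
      using B qee qeb d unfolding orth_def e_def[symmetric] by (auto simp: e_def intro: E)
    ultimately show False using maxB[of "insert e B"] B by (simp add: orth_def)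
  qed
  have P_scale: "P (c *\<^sub>C u) = c *\<^sub>C P u" for c u
    by (simp add: P_def q(2) complex_vector.scale_sum_right scaleC_scaleC)
  have "finite_rank P"
    unfolding P_def using B
    by (intro finite_rank_sum finite_rank_functional q) (simp add: orth_def)
  then have "bounded_linear P" by (simp add: finite_rank_def)
  then have P: "bounded_clinear P" by (simp add: bounded_clinear_def P_scale)
  obtain e0 where e0: "e0 > 0" "\<And>w. w \<in> ball z0 e0 \<Longrightarrow> w \<in> spectrum V N L \<Longrightarrow> w = z0"
    using isolated unfolding isolated_in_dist_Ex_iff by (force simp: dist_commute)
  \<comment> \<open>The bound \<open>e0\<close> excludes the rest of the spectrum,
    \<open>Re z0\<close> keeps the ball in the half-plane, and 1 keeps \<open>w - z0 + 1\<close>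
    away from 0. The latter is the factor by which \<open>w - T + P\<close> acts on
    \<open>E\<close>.\<close>
  define \<rho> where "\<rho> = Min {e0, 1, Re z0}"
  have \<rho>: "\<rho> > 0" "\<rho> \<le> e0" "\<rho> \<le> 1" "\<rho> \<le> Re z0" using e0(1) z0(1) by (auto simp: \<rho>_def)
  have ball: "Re w > 0" "w - z0 + 1 \<noteq> 0" "w \<in> spectrum V N L \<Longrightarrow> w = z0" if w: "w \<in> ball z0 \<rho>" for w
  proof -
    have "\<bar>Re (z0 - w)\<bar> < Re z0" using w \<rho>(4) abs_Re_le_cmod[of "z0 - w"] by (simp add: dist_norm)
    then show "Re w > 0" by simp
    show "w - z0 + 1 \<noteq> 0"
    proof
      assume "w - z0 + 1 = 0"
      then have "w = z0 - 1" by (simp add: algebra_simps)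
      then show False using w \<rho>(3) by (simp add: dist_norm)
    qed
    show "w \<in> spectrum V N L \<Longrightarrow> w = z0" using e0(2)[of w] w \<rho>(2) by auto
  qed
  \<comment> \<open>The elements of \<open>B\<close> are left eigenvectors by \<open>q_T\<close>, so
    testing \<open>w - T + P\<close> against \<open>b\<close> gives multiplication of
    \<open>q h b\<close> by \<open>w - z0 + 1\<close>.\<close>
  have P_zero: "P h = 0" if "w \<in> ball z0 \<rho>" "\<And>b. b \<in> B \<Longrightarrow> q (w *\<^sub>C h - T h + P h) b = 0" for w h
  proof -
    have "q h b = 0" if b: "b \<in> B" for b
    proof -
      have "T b = z0 *\<^sub>C b" using B b by (auto simp: orth_def E_def)
      then have "(w - z0 + 1) * q h b = q (w *\<^sub>C h - T h + P h) b"
        by (simp add: linear_add[OF qlin] linear_diff[OF qlin] q(2) q_T q_P[OF b] algebra_simps)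
      then show ?thesis using that(1) ball(2) \<open>\<And>b. b \<in> B \<Longrightarrow> q (w *\<^sub>C h - T h + P h) b = 0\<close>[OF b] \<open>w \<in> ball z0 \<rho>\<close> by simp
    qed
    then show ?thesis by (simp add: P_def)
  qed
  \<comment> \<open>The kernel of \<open>z0 - T\<close> is \<open>E\<close>, on which
    \<open>P\<close> is the identity. Adding \<open>P\<close> thus removes the kernel, and the
    family \<open>H\<close> is regular also at the centre.\<close>
  have "\<exists>R. bounded_linear R \<and> (\<forall>h. R (w *\<^sub>C h - T h + P h) = h) \<and>
    (\<forall>h. w *\<^sub>C R h - T (R h) + P (R h) = h)" if w: "w \<in> ball z0 \<rho>" for w
  proof (rule inverse_exists[OF ball(1)[OF w] \<open>finite_rank P\<close>])
    fix h assume h: "w *\<^sub>C h - T h + P h = 0"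
    then have Ph: "P h = 0" using P_zero[OF w] linear_0[OF qlin] by simp
    then have Th: "T h = w *\<^sub>C h" using h by simp
    show "h = 0"
    proof (rule ccontr)
      assume "h \<noteq> 0"
      then have "w \<in> spectrum V N L"
        using Th ball(1)[OF w] by (intro eigenvalue_in_spectrum eigenvalueI) auto
      then have "h \<in> E" using ball(3)[OF w] Th by (simp add: E_def)
      then show False using P_id[of h] Ph \<open>h \<noteq> 0\<close> by simp
    qed
  qed
  then obtain H where H: "\<And>w. w \<in> ball z0 \<rho> \<Longrightarrow> bounded_linear (H w)"
    "\<And>w h. w \<in> ball z0 \<rho> \<Longrightarrow> H w (w *\<^sub>C h - T h + P h) = h"
    "\<And>w h. w \<in> ball z0 \<rho> \<Longrightarrow> w *\<^sub>C H w h - T (H w h) + P (H w h) = h"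
    by metis
  \<comment> \<open>On the kernel of \<open>P\<close> the operators \<open>w - T\<close> and
    \<open>w - T + P\<close> agree, and \<open>H w\<close> preserves this kernel by
    \<open>P_zero\<close>. On \<open>E\<close>, the operator \<open>w - T\<close> is multiplication
    by \<open>w - z0\<close>.\<close>
  have resolvent_eq: "resolvent V N L w x =
      \<Psi> (H w (\<Phi> x - P (\<Phi> x)) + inverse (w - z0) *\<^sub>C P (\<Phi> x))"
    if w: "w \<in> ball z0 \<rho>" "w \<noteq> z0" and x: "x \<in> V" for w x
  proof -
    have "\<exists>R. is_resolvent V N L w R" using ball(3) w by (auto simp: spectrum_def)
    then have R: "is_resolvent V N L w (resolvent V N L w)"
      unfolding resolvent_def by (rule someI_ex)
    define v where "v = H w (\<Phi> x - P (\<Phi> x))"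
    have v: "w *\<^sub>C v - T v + P v = \<Phi> x - P (\<Phi> x)" unfolding v_def by (rule H(3)[OF w(1)])
    have "P v = 0" by (rule P_zero[OF w(1)]) (simp add: v linear_diff[OF qlin] q_P)
    then have v': "w *\<^sub>C v - T v = \<Phi> x - P (\<Phi> x)" using v by simp
    define y where "y = v + inverse (w - z0) *\<^sub>C P (\<Phi> x)"
    have TP: "T (P (\<Phi> x)) = z0 *\<^sub>C P (\<Phi> x)" using P_E[of "\<Phi> x"] by (simp add: E_def)
    have "w *\<^sub>C y - T y = (w *\<^sub>C v - T v) + inverse (w - z0) *\<^sub>C (w *\<^sub>C P (\<Phi> x) - T (P (\<Phi> x)))"
      by (simp add: y_def linear_add T_linear scaleC_add_right scaleC_scaleC mult.commute
          complex_vector.scale_right_diff_distrib)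
    also have "w *\<^sub>C P (\<Phi> x) - T (P (\<Phi> x)) = (w - z0) *\<^sub>C P (\<Phi> x)"
      by (simp add: TP complex_vector.scale_left_diff_distrib)
    also have "inverse (w - z0) *\<^sub>C (w - z0) *\<^sub>C P (\<Phi> x) = P (\<Phi> x)"
      using w by (simp add: scaleC_scaleC scaleC_one)
    finally have "w *\<^sub>C y - T y = \<Phi> x" by (simp add: v')
    then have "w *\<^sub>C \<Psi> y - L (\<Psi> y) = x"
      using x by (metis L_\<Psi> \<Psi>_\<Phi> \<Psi>_diff \<Psi>_scale)
    then show ?thesis
      using R \<Psi>_V[of y] unfolding is_resolvent_def y_def[symmetric] v_def[symmetric] by metis
  qed
  define r where "r = \<rho> / 2"
  have r: "r > 0" "cball z0 r \<subseteq> ball z0 \<rho>" using \<rho> by (auto simp: r_def)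
  define Q where "Q x = \<Psi> (P (\<Phi> x))" for x
  have "is_riesz_projection V N L z0 r Q"
    unfolding is_riesz_projection_def
  proof (intro conjI allI impI ballI)
    show "bounded_linear_between V N V N Q"
      unfolding Q_def by (rule compressed_bounded_linear[OF \<open>bounded_linear P\<close> P_scale])
    fix l x assume l: "bounded_linear_between V N UNIV cmod l" and x: "x \<in> V"
    define m where "m h = l (\<Psi> h)" for h
    have m_scale: "m (c *\<^sub>C h) = c * m h" and m_add: "m (g + h) = m g + m h" for c g h
      using l \<Psi>_V unfolding bounded_linear_between_def m_def
      by (simp_all add: \<Psi>_scale \<Psi>_add scaleC_complex_def)
    obtain K where K: "\<And>x. x \<in> V \<Longrightarrow> cmod (l x) \<le> K * N x"
      using l unfolding bounded_linear_between_def by blast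
    have m: "bounded_linear m"
    proof (rule bounded_linear_intro[of _ "\<bar>K\<bar> * \<kappa>"])
      show "cmod (m h) \<le> norm h * (\<bar>K\<bar> * \<kappa>)" for h
      proof -
        have "cmod (m h) \<le> K * N (\<Psi> h)" unfolding m_def by (rule K[OF \<Psi>_V])
        also have "\<dots> \<le> \<bar>K\<bar> * (\<kappa> * norm h)"
          using \<Psi>_bound[of h] N_nonneg[OF \<Psi>_V, of h] by (intro mult_mono) auto
        finally show ?thesis by (simp add: mult_ac)
      qed
    qed (simp_all add: m_add m_scale scaleR_scaleC scaleR_conv_of_real)
    define k where "k = \<Phi> x - P (\<Phi> x)"
    have "(\<lambda>w. m (H w k)) holomorphic_on ball z0 \<rho>"
    proof (rule holomorphic_inverse_family[where A = "\<lambda>h. T h - P h"])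
      show "bounded_clinear (\<lambda>h. T h - P h)" by (intro bounded_clinear_diff T P)
      show "H w (w *\<^sub>C h - (T h - P h)) = h" if "w \<in> ball z0 \<rho>" for w h
        using H(2)[OF that] by (simp add: algebra_simps)
      show "w *\<^sub>C H w h - (T (H w h) - P (H w h)) = h" if "w \<in> ball z0 \<rho>" for w h
        using H(3)[OF that] by (simp add: algebra_simps)
    qed (use H(1) m m_scale in auto)
    \<comment> \<open>After multiplication by \<open>w - z0\<close> the resolvent extends
      holomorphically to the centre, and Cauchy's formula returns its value
      \<open>m (P (\<Phi> x))\<close> there.\<close>
    then have "(\<lambda>w. m (P (\<Phi> x)) + (w - z0) * m (H w k)) holomorphic_on cball z0 r"
      using r by (intro holomorphic_intros) (auto intro: holomorphic_on_subset)
    then have "((\<lambda>w. (m (P (\<Phi> x)) + (w - z0) * m (H w k)) / (w - z0)) has_contour_integral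
        2 * of_real pi * \<i> * (m (P (\<Phi> x)) + (z0 - z0) * m (H z0 k))) (circlepath z0 r)"
      using r by (intro Cauchy_integral_circlepath_simple) auto
    then have "((\<lambda>w. l (resolvent V N L w x)) has_contour_integral
        2 * of_real pi * \<i> * (m (P (\<Phi> x)) + (z0 - z0) * m (H z0 k))) (circlepath z0 r)"
    proof (rule has_contour_integral_eq)
      fix w assume "w \<in> path_image (circlepath z0 r)"
      then have "w \<in> sphere z0 r" using r by simp
      then have w: "w \<in> ball z0 \<rho>" "w \<noteq> z0" using r by auto
      have "l (resolvent V N L w x) = m (H w k) + inverse (w - z0) * m (P (\<Phi> x))"
        unfolding resolvent_eq[OF w x] k_def[symmetric] m_add[symmetric] m_scale[symmetric]
        by (simp add: m_def)
      then show "(m (P (\<Phi> x)) + (w - z0) * m (H w k)) / (w - z0) = l (resolvent V N L w x)"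
        using w by (simp add: field_simps)
    qed
    then show "((\<lambda>w. l (resolvent V N L w x)) has_contour_integral 2 * pi * \<i> * l (Q x))
        (circlepath z0 r)"
      by (simp add: Q_def m_def)
  qed
  moreover have "finite_dimensional (Q ` V)"
  proof -
    have "Q x \<in> complex_vector.span (\<Psi> ` B)" for x
    proof -
      have "\<Psi> (sum f A) = (\<Sum>a\<in>A. \<Psi> (f a))" for f and A :: "'h set"
        by (induction A rule: infinite_finite_induct) (simp_all add: \<Psi>_0 \<Psi>_add)
      then have "Q x = (\<Sum>b\<in>B. q (\<Phi> x) b *\<^sub>C \<Psi> b)"
        by (simp add: Q_def P_def \<Psi>_scale)
      then show ?thesis
        by (simp only:) (rule complex_vector.span_sum, rule complex_vector.span_scale,
            rule complex_vector.span_base, rule imageI)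
    qed
    then show ?thesis
      using B unfolding finite_dimensional_def orth_def by blast
  qed
  moreover have "spectrum V N L \<inter> cball z0 r = {z0}"
    using eigenvalue_in_spectrum[OF z0(2)] r ball(3) by auto
  ultimately show ?thesis
    unfolding finite_algebraic_multiplicity_def using r(1) by blast
qed

end

section \<open>The linearized operator as an operator on a Hilbert space\<close>

text \<open>The symbol of \<open>1 - \<Delta>\<close>.\<close>

definition rho :: "int \<times> int \<Rightarrow> real" where
  "rho p = 1 + (of_int (fst p))\<^sup>2 + (of_int (snd p))\<^sup>2"

lemma rho_ge_1: "rho p \<ge> 1" by (simp add: rho_def)

lemma rho_pos [simp]: "rho p > 0" using rho_ge_1[of p] by linarith

lemma rho_nz [simp]: "rho p \<noteq> 0" using rho_pos[of p] by linarith

lemma scaleC_fun_apply: "(c *\<^sub>C f) x = c * f x" for f :: "'a \<Rightarrow> complex"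
  by (simp add: scaleC_fun_def scaleC_complex_def)

lemma sobolev_weight_rho: "sobolev_weight s p = rho p powr s"
  by (cases p) (simp add: sobolev_weight_def rho_def)

section \<open>Sobolev spaces as weighted copies of the square-summable families\<close>

definition sobolev_embed :: "real \<Rightarrow> (int \<times> int \<Rightarrow> complex) \<Rightarrow> (int \<times> int) ell2" where
  "sobolev_embed t u = Abs_ell2 (\<lambda>p. of_real (rho p powr (t / 2)) * u p)"

definition sobolev_unembed :: "real \<Rightarrow> (int \<times> int) ell2 \<Rightarrow> int \<times> int \<Rightarrow> complex" where
  "sobolev_unembed t h = (\<lambda>p. of_real (rho p powr (- t / 2)) * Rep_ell2 h p)"

lemma weighted_square: "(cmod (of_real (rho p powr (t / 2)) * z))\<^sup>2 = sobolev_weight t p * (cmod z)\<^sup>2"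
  by (simp add: norm_mult power_mult_distrib sobolev_weight_rho flip: powr_power)
    (simp add: powr_power)

lemma Rep_sobolev_embed:
  "u \<in> sobolev t \<Longrightarrow> Rep_ell2 (sobolev_embed t u) p = of_real (rho p powr (t / 2)) * u p"
  by (simp add: sobolev_embed_def sobolev_def Abs_ell2_inverse weighted_square)

lemma norm_sobolev_embed: "u \<in> sobolev t \<Longrightarrow> norm (sobolev_embed t u) = sobolev_norm t u"
  by (simp only: norm_ell2_def Rep_sobolev_embed weighted_square sobolev_norm_def)

lemma rho_powr_cancel: "rho p powr a * rho p powr (- a) = 1"
  by (simp flip: powr_add)

lemma sobolev_unembed_mem: "sobolev_unembed t h \<in> sobolev t"
  and sobolev_embed_unembed: "sobolev_embed t (sobolev_unembed t h) = h"
proof -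
  have "of_real (rho p powr (t / 2)) * (of_real (rho p powr (- t / 2)) * z) = z" for p and z :: complex
    using rho_powr_cancel[of p "t / 2"]
    by (simp flip: of_real_mult mult.assoc)
  note cancel = this
  have eq: "(\<lambda>p. of_real (rho p powr (t / 2)) * sobolev_unembed t h p) = Rep_ell2 h"
    unfolding sobolev_unembed_def by (rule ext) (rule cancel)
  have "(\<lambda>p. sobolev_weight t p * (cmod (sobolev_unembed t h p))\<^sup>2) = (\<lambda>p. (cmod (Rep_ell2 h p))\<^sup>2)"
    by (simp only: weighted_square[symmetric] eq[THEN fun_cong])
  then show "sobolev_unembed t h \<in> sobolev t"
    using Rep_ell2_summable[of h] by (simp add: sobolev_def)
  show "sobolev_embed t (sobolev_unembed t h) = h"
    by (simp add: sobolev_embed_def eq Rep_ell2_inverse)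
qed

lemma sobolev_unembed_embed: "u \<in> sobolev t \<Longrightarrow> sobolev_unembed t (sobolev_embed t u) = u"
  using rho_powr_cancel[of _ "t / 2"]
  by (simp add: sobolev_unembed_def Rep_sobolev_embed fun_eq_iff mult_ac flip: of_real_mult)

lemma norm_sobolev_unembed: "sobolev_norm t (sobolev_unembed t h) = norm h"
  using norm_sobolev_embed[OF sobolev_unembed_mem[of t h]] by (simp add: sobolev_embed_unembed)

lemma sobolev_add: "u \<in> sobolev t \<Longrightarrow> v \<in> sobolev t \<Longrightarrow> u + v \<in> sobolev t"
  using square_summable_add[of "\<lambda>p. of_real (rho p powr (t / 2)) * u p" UNIV
      "\<lambda>p. of_real (rho p powr (t / 2)) * v p"]
  by (simp add: sobolev_def weighted_square flip: distrib_left)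

lemma sobolev_scaleC: "u \<in> sobolev t \<Longrightarrow> c *\<^sub>C u \<in> sobolev t"
  using square_summable_scale[of "\<lambda>p. of_real (rho p powr (t / 2)) * u p" UNIV c]
  by (simp add: sobolev_def weighted_square scaleC_fun_def scaleC_complex_def mult.left_commute[of c])

lemma sobolev_embed_add:
  "u \<in> sobolev t \<Longrightarrow> v \<in> sobolev t \<Longrightarrow> sobolev_embed t (u + v) = sobolev_embed t u + sobolev_embed t v"
  by (simp add: Rep_ell2_inject[symmetric] fun_eq_iff Rep_sobolev_embed sobolev_add
      plus_ell2.rep_eq distrib_left)

lemma sobolev_embed_scaleC:
  "u \<in> sobolev t \<Longrightarrow> sobolev_embed t (c *\<^sub>C u) = c *\<^sub>C sobolev_embed t u"
  by (simp add: Rep_ell2_inject[symmetric] fun_eq_iff Rep_sobolev_embed sobolev_scaleC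
      scaleC_ell2.rep_eq scaleC_fun_apply del: split_paired_All)

lemma sobolev_unembed_add: "sobolev_unembed t (g + h) = sobolev_unembed t g + sobolev_unembed t h"
  by (simp add: sobolev_unembed_def fun_eq_iff plus_ell2.rep_eq distrib_left)

lemma sobolev_unembed_scaleC: "sobolev_unembed t (c *\<^sub>C h) = c *\<^sub>C sobolev_unembed t h"
  by (simp add: sobolev_unembed_def fun_eq_iff scaleC_ell2.rep_eq scaleC_fun_def scaleC_complex_def)

text \<open>Limits along \<open>cofinite\<close> on the index pairs let \<open>m\<close> and
  \<open>n\<close> go to infinity in any direction. This is how all transverse modes are handled by
  one limit.\<close>

lemma filterlim_rho: "filterlim rho at_top cofinite"
proof (rule filterlim_at_top[THEN iffD2], rule allI)
  fix Z :: real
  define M where "M = \<lceil>max Z 0\<rceil>"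
  have "{p. \<not> Z \<le> rho p} \<subseteq> {-M..M} \<times> {-M..M}"
  proof (rule subsetI)
    fix p assume "p \<in> {p. \<not> Z \<le> rho p}"
    then obtain m n where p: "p = (m, n)" and "\<not> Z \<le> rho (m, n)" by (cases p) auto
    then have "1 + (of_int m)\<^sup>2 + (of_int n)\<^sup>2 < (of_int M :: real)"
      using le_of_int_ceiling[of "max Z 0"] max.cobounded1[of Z 0]
      unfolding rho_def M_def fst_conv snd_conv by linarith
    then have "real_of_int (1 + m\<^sup>2 + n\<^sup>2) < of_int M" by simp
    then have *: "1 + m\<^sup>2 + n\<^sup>2 < M" by (simp only: of_int_less_iff)
    have j: "- (j\<^sup>2) \<le> j" "j \<le> j\<^sup>2" for j :: int
    proof -
      have "0 \<le> j * (j - 1)" by (cases "j \<le> 0") (auto intro: mult_nonpos_nonpos)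
      then show "j \<le> j\<^sup>2" by (simp add: power2_eq_square algebra_simps)
      have "0 \<le> j * (j + 1)" by (cases "j \<ge> 0") (auto intro: mult_nonpos_nonpos)
      then show "- (j\<^sup>2) \<le> j" by (simp add: power2_eq_square algebra_simps)
    qed
    show "p \<in> {-M..M} \<times> {-M..M}"
      unfolding p using j[of m] j[of n] * zero_le_power2[of m] zero_le_power2[of n]
      by (simp add: mem_Times_iff)
  qed
  then show "eventually (\<lambda>p. Z \<le> rho p) cofinite"
    unfolding eventually_cofinite by (rule finite_subset) simp
qed

section \<open>Asymptotics of the weights under shifts\<close>

definition shift1 :: "int \<Rightarrow> int \<times> int \<Rightarrow> int \<times> int" where
  "shift1 j p = (fst p + j, snd p)"

lemma shift1_shift1 [simp]: "shift1 i (shift1 j p) = shift1 (i + j) p"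
  by (simp add: shift1_def)

lemma shift1_0 [simp]: "shift1 0 p = p" by (simp add: shift1_def)

lemma inj_shift1: "inj (shift1 j)"
  by (rule injI) (simp add: shift1_def prod_eq_iff)

lemma snd_shift1 [simp]: "snd (shift1 j p) = snd p" by (simp add: shift1_def)

lemma abs_fst_le_sqrt_rho: "\<bar>of_int (fst p)\<bar> \<le> sqrt (rho p)"
  and abs_snd_le_sqrt_rho: "\<bar>of_int (snd p)\<bar> \<le> sqrt (rho p)"
  by (rule real_le_rsqrt; simp add: rho_def)+

text \<open>The difference \<open>2 * j * fst p + j\<^sup>2\<close> of the two weights is only of
  the order of \<open>sqrt (rho p)\<close>. To leading order, weights at shifted indices are
  therefore interchangeable.\<close>

lemma tendsto_rho_ratio: "((\<lambda>p. rho (shift1 j p) / rho p) \<longlongrightarrow> 1) cofinite"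
proof (rule LIM_zero_cancel, rule Lim_null_comparison, rule always_eventually, rule allI)
  fix p
  have r: "sqrt (rho p) / rho p = 1 / sqrt (rho p)"
    by (simp add: sqrt_divide_self_eq less_imp_le inverse_eq_divide)
  have "rho (shift1 j p) / rho p - 1 = (2 * j * fst p + j\<^sup>2) / rho p"
  proof -
    have "rho (shift1 j p) - rho p = 2 * j * fst p + j\<^sup>2"
      by (simp add: rho_def shift1_def power2_sum)
    then show ?thesis by (metis diff_divide_distrib divide_self rho_nz)
  qed
  also have "norm \<dots> \<le> (2 * \<bar>j\<bar> * sqrt (rho p) + j\<^sup>2) / rho p"
  proof -
    have "\<bar>2 * j * fst p + j\<^sup>2\<bar> \<le> 2 * \<bar>real_of_int j\<bar> * \<bar>real_of_int (fst p)\<bar> + (real_of_int j)\<^sup>2"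
      using abs_triangle_ineq[of "2 * real_of_int j * fst p" "(real_of_int j)\<^sup>2"] by (simp add: abs_mult)
    also have "\<dots> \<le> 2 * \<bar>real_of_int j\<bar> * sqrt (rho p) + (real_of_int j)\<^sup>2"
      by (intro add_mono mult_left_mono abs_fst_le_sqrt_rho) auto
    finally show ?thesis
      using abs_of_pos[OF rho_pos[of p]] by (simp add: divide_right_mono less_imp_le)
  qed
  also have "\<dots> = 2 * \<bar>j\<bar> / sqrt (rho p) + j\<^sup>2 / rho p"
    by (subst add_divide_distrib, subst times_divide_eq_right[symmetric], subst r) simp
  finally show "norm (rho (shift1 j p) / rho p - 1) \<le> 2 * \<bar>j\<bar> / sqrt (rho p) + j\<^sup>2 / rho p" .
next
  show "((\<lambda>p. 2 * \<bar>j\<bar> / sqrt (rho p) + j\<^sup>2 / rho p) \<longlongrightarrow> 0) cofinite"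
    by (rule tendsto_add_zero)
      (intro tendsto_divide_0[OF tendsto_const] filterlim_compose[OF filterlim_at_top_imp_at_infinity]
        filterlim_compose[OF sqrt_at_top] filterlim_rho filterlim_at_top_imp_at_infinity)+
qed

lemma tendsto_rho_ratio_powr: "((\<lambda>p. (rho p / rho (shift1 j p)) powr a) \<longlongrightarrow> 1) cofinite"
proof -
  have "((\<lambda>p. (inverse (rho (shift1 j p) / rho p)) powr a) \<longlongrightarrow> (inverse 1) powr a) cofinite"
    by (intro tendsto_intros tendsto_rho_ratio) auto
  then show ?thesis by simp
qed

lemma filterlim_shift1: "filterlim (shift1 j) cofinite cofinite"
  unfolding filterlim_def le_filter_def eventually_filtermap eventually_cofinite
proof (intro allI impI)
  fix P :: "int \<times> int \<Rightarrow> bool" assume "finite {x. \<not> P x}"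
  then have "finite (shift1 j -` {x. \<not> P x})" by (rule finite_vimageI[OF _ inj_shift1])
  then show "finite {x. \<not> P (shift1 j x)}" by (simp add: vimage_def)
qed

lemma bounded_of_tendsto_cofinite:
  fixes f :: "'i \<Rightarrow> 'a::real_normed_vector"
  assumes "(f \<longlongrightarrow> l) cofinite"
  obtains B where "\<And>p. norm (f p) \<le> B"
proof -
  have "eventually (\<lambda>p. dist (f p) l < 1) cofinite" using assms by (rule tendstoD) simp
  then have fin: "finite {p. \<not> dist (f p) l < 1}" by (simp add: eventually_cofinite)
  define B where "B = norm l + 1 + (\<Sum>p | \<not> dist (f p) l < 1. norm (f p))"
  have "norm (f p) \<le> B" for p
  proof (cases "dist (f p) l < 1")
    case True
    then have "norm (f p) \<le> norm l + 1"
      using norm_triangle_sub[of "f p" l] by (simp add: dist_norm)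
    then show ?thesis using sum_nonneg[of "{p. \<not> dist (f p) l < 1}" "\<lambda>p. norm (f p)"]
      by (simp add: B_def)
  next
    case False
    then have "norm (f p) \<le> (\<Sum>p | \<not> dist (f p) l < 1. norm (f p))"
      using fin by (intro member_le_sum) auto
    then show ?thesis by (simp add: B_def add_increasing)
  qed
  then show thesis by (rule that)
qed

text \<open>Compactness in the quantitative form that is used: only finitely many weights have
  modulus at least \<epsilon>, and these form the finite-rank part.\<close>

lemma wcomp_small_plus_finite_rank:
  assumes "inj \<pi>" "(c \<longlongrightarrow> 0) cofinite" "\<epsilon> > 0"
  obtains S F where "bounded_linear S" "\<And>u. norm (S u) \<le> \<epsilon> * norm u" "finite_rank F"
    "\<And>u. wcomp c \<pi> u = S u + F u"
proof -
  define Q where "Q = {p. \<not> cmod (c p) < \<epsilon>}"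
  have Q: "finite Q"
    using tendstoD[OF assms(2,3)] by (simp add: eventually_cofinite Q_def)
  obtain B where B: "\<And>p. cmod (c p) \<le> B" by (rule bounded_of_tendsto_cofinite[OF assms(2)]) blast
  define c1 where "c1 p = (if p \<in> Q then 0 else c p)" for p
  define c2 where "c2 p = (if p \<in> Q then c p else 0)" for p
  have B0: "0 \<le> B" using B[of undefined] norm_ge_zero order_trans by blast
  have c1: "cmod (c1 p) \<le> \<epsilon>" and c2: "cmod (c2 p) \<le> B" for p
    using assms(3) B B0 by (auto simp: c1_def c2_def Q_def)
  show thesis
  proof (rule that)
    show "bounded_linear (wcomp c1 \<pi>)"
      using bounded_clinear_wcomp[where c = c1, OF assms(1) c1] by (simp add: bounded_clinear_def)
    show "norm (wcomp c1 \<pi> u) \<le> \<epsilon> * norm u" for u by (rule norm_wcomp_le[where c = c1, OF assms(1) c1])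
    show "finite_rank (wcomp c2 \<pi>)"
      by (rule finite_rank_wcomp[OF assms(1)]) (rule finite_subset[OF _ Q], auto simp: c2_def)
    show "wcomp c \<pi> u = wcomp c1 \<pi> u + wcomp c2 \<pi> u" for u
      by (simp add: Rep_ell2_inject[symmetric] fun_eq_iff plus_ell2.rep_eq
          Rep_wcomp[where c = c, OF assms(1) B] Rep_wcomp[where c = c1, OF assms(1) c1]
          Rep_wcomp[where c = c2, OF assms(1) c2]) (simp add: c1_def c2_def)
  qed
qed

text \<open>At the origin, where \<open>rho = 1\<close>, the value of \<open>symB\<close> is \<open>0\<close>, in agreement with the convention
  for the inverse Laplacian.\<close>

definition symA :: "int \<Rightarrow> int \<times> int \<Rightarrow> real" where
  "symA k p = 1 - (1 + (of_int k)\<^sup>2) / rho p"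

definition symB :: "int \<Rightarrow> int \<times> int \<Rightarrow> real" where
  "symB k p = (1 + (of_int k)\<^sup>2) / (rho p - 1)"

lemma laplace_symbol_rho: "laplace_symbol p = of_real (1 - rho p)"
  by (cases p) (simp add: laplace_symbol_def rho_def)

lemma opA_eq: "opA k F p = of_real (symA k p) * F p"
  by (simp add: opA_def symA_def scaleC_fun_def scaleC_complex_def fourier_multiplier_def
      laplace_symbol_rho algebra_simps divide_inverse)

lemma opB_eq: "opB k w p = of_real (symB k p) * w p"
proof -
  have "inverse (1 - rho p) = - inverse (rho p - 1)"
    by (metis inverse_minus_eq minus_diff_eq)
  then have "inverse (complex_of_real (1 - rho p)) = - complex_of_real (inverse (rho p - 1))"
    by (metis of_real_inverse of_real_minus)
  then show ?thesis
    by (simp add: opB_def symB_def scaleC_fun_def scaleC_complex_def fourier_multiplier_def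
      laplace_symbol_rho algebra_simps divide_inverse del: of_real_diff of_real_1)
qed

lemma opL_eq:
  "fst (opL k (w, F)) p = - (\<i> * of_int k * of_int (snd p) / 2) *
     (of_real (symA k (shift1 (- k) p)) * F (shift1 (- k) p) +
      of_real (symA k (shift1 k p)) * F (shift1 k p))"
  "snd (opL k (w, F)) p = - (\<i> * of_int k * of_int (snd p) / 2) *
     (of_real (symB k (shift1 (- k) p)) * w (shift1 (- k) p) +
      of_real (symB k (shift1 k p)) * w (shift1 k p))"
  by (cases p; simp add: opL_def scaleC_fun_def scaleC_complex_def cos_mult2_eq partial2_def
      fourier_multiplier_def opA_eq opB_eq shift1_def field_simps)+

lemma tendsto_symA: "(symA k \<longlongrightarrow> 1) cofinite"
proof -
  have "((\<lambda>p. 1 - (1 + (of_int k)\<^sup>2) / rho p) \<longlongrightarrow> 1 - 0) cofinite"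
    by (intro tendsto_diff tendsto_const tendsto_divide_0[OF tendsto_const]
        filterlim_at_top_imp_at_infinity filterlim_rho)
  then show ?thesis by (simp add: symA_def[abs_def])
qed

lemma tendsto_symB: "((\<lambda>p. symB k p * rho p / (1 + (of_int k)\<^sup>2)) \<longlongrightarrow> 1) cofinite"
proof -
  have k: "1 + (real_of_int k)\<^sup>2 \<noteq> 0" by (smt (verit) zero_le_power2)
  have "((\<lambda>p. inverse (1 - 1 / rho p)) \<longlongrightarrow> inverse (1 - 0)) cofinite"
    by (intro tendsto_inverse tendsto_diff tendsto_const tendsto_divide_0[OF tendsto_const]
        filterlim_at_top_imp_at_infinity filterlim_rho) simp
  moreover have "inverse (1 - 1 / rho p) = symB k p * rho p / (1 + (of_int k)\<^sup>2)" for p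
  proof -
    have "1 - 1 / rho p = (rho p - 1) / rho p" by (simp add: diff_divide_distrib)
    then show ?thesis using k by (simp add: symB_def)
  qed
  ultimately show ?thesis by simp
qed

section \<open>Embedding of the state space\<close>

definition kap :: "int \<Rightarrow> real" where
  "kap k = sqrt (1 + (of_int k)\<^sup>2)"

lemma kap_ge_1: "kap k \<ge> 1" and kap_square: "(kap k)\<^sup>2 = 1 + (of_int k)\<^sup>2"
  by (simp_all add: kap_def)

lemma kap_nz [simp]: "kap k \<noteq> 0" using kap_ge_1[of k] by linarith

text \<open>The weights make the Hilbert space norm equivalent to the norm of \<open>X\<^sup>s\<close>; the
  factor \<open>kap k\<close> makes the two off-diagonal blocks of the operator agree to leading order.\<close>

definition state_embed :: "int \<Rightarrow> real \<Rightarrow> state \<Rightarrow> (int \<times> int) ell2 \<times> (int \<times> int) ell2" where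
  "state_embed k s x = (kap k *\<^sub>R sobolev_embed (s - 1) (fst x), sobolev_embed s (snd x))"

definition mean_free :: "(int \<times> int) ell2 \<Rightarrow> (int \<times> int) ell2" where
  "mean_free = wcomp (\<lambda>p. of_bool (p \<noteq> (0, 0))) id"

definition state_unembed :: "int \<Rightarrow> real \<Rightarrow> (int \<times> int) ell2 \<times> (int \<times> int) ell2 \<Rightarrow> state" where
  "state_unembed k s h =
     (sobolev_unembed (s - 1) (inverse (kap k) *\<^sub>R mean_free (fst h)), sobolev_unembed s (snd h))"

lemma mean_free:
  "Rep_ell2 (mean_free u) p = of_bool (p \<noteq> (0, 0)) * Rep_ell2 u p"
  "norm (mean_free u) \<le> norm u" "bounded_clinear mean_free"
proof -
  have 1: "cmod (of_bool (p \<noteq> (0, 0))) \<le> 1" for p :: "int \<times> int" by simp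
  show "Rep_ell2 (mean_free u) p = of_bool (p \<noteq> (0, 0)) * Rep_ell2 u p"
    unfolding mean_free_def by (simp only: Rep_wcomp[OF inj_on_id 1] id_apply)
  show "norm (mean_free u) \<le> norm u"
    using norm_wcomp_le[OF inj_on_id 1] unfolding mean_free_def by simp
  show "bounded_clinear mean_free"
    unfolding mean_free_def by (rule bounded_clinear_wcomp[OF inj_on_id 1])
qed

lemma mean_free_add: "mean_free (u + v) = mean_free u + mean_free v"
  and mean_free_scaleC: "mean_free (c *\<^sub>C u) = c *\<^sub>C mean_free u"
  using mean_free(3) by (auto simp: bounded_clinear_def linear_add bounded_linear.linear)

lemma state_unembed_Xspace: "state_unembed k s h \<in> Xspace s"
  by (simp add: state_unembed_def Xspace_def sobolev_mean_zero_def sobolev_unembed_mem)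
    (simp add: sobolev_unembed_def scaleR_scaleC scaleC_ell2.rep_eq mean_free)

lemma Rep_state_unembed:
  "fst (state_unembed k s h) p = of_real (rho p powr ((1 - s) / 2) / kap k) *
     (of_bool (p \<noteq> (0, 0)) * Rep_ell2 (fst h) p)"
  "snd (state_unembed k s h) p = of_real (rho p powr (- s / 2)) * Rep_ell2 (snd h) p"
proof -
  have "- (s - 1) / 2 = (1 - s) / 2" by simp
  then show "fst (state_unembed k s h) p = of_real (rho p powr ((1 - s) / 2) / kap k) *
      (of_bool (p \<noteq> (0, 0)) * Rep_ell2 (fst h) p)"
    unfolding state_unembed_def sobolev_unembed_def scaleR_scaleC scaleC_ell2.rep_eq mean_free(1)
      fst_conv by (simp only: divide_inverse[of _ "kap k"] of_real_mult mult.assoc)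
qed (simp add: state_unembed_def sobolev_unembed_def)

lemma state_unembed_embed:
  assumes "x \<in> Xspace s"
  shows "state_unembed k s (state_embed k s x) = x"
proof -
  have x: "fst x \<in> sobolev (s - 1)" "fst x (0, 0) = 0" "snd x \<in> sobolev s"
    using assms by (auto simp: Xspace_def sobolev_mean_zero_def)
  have "mean_free (kap k *\<^sub>R sobolev_embed (s - 1) (fst x)) = kap k *\<^sub>R sobolev_embed (s - 1) (fst x)"
  proof (rule Rep_ell2_inject[THEN iffD1], rule ext)
    fix p show "Rep_ell2 (mean_free (kap k *\<^sub>R sobolev_embed (s - 1) (fst x))) p =
        Rep_ell2 (kap k *\<^sub>R sobolev_embed (s - 1) (fst x)) p"
      unfolding mean_free(1) scaleR_scaleC scaleC_ell2.rep_eq Rep_sobolev_embed[OF x(1)]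
      using x(2) by (cases "p = (0, 0)") auto
  qed
  then show ?thesis
    by (simp add: state_unembed_def state_embed_def prod_eq_iff sobolev_unembed_embed x)
qed

text \<open>The coefficient with which the value at \<open>shift1 j p\<close> enters the value at
  \<open>p\<close> after conjugation: the factor of \<open>opL\<close> with the Sobolev weight of
  the target index, the inverse weight of the source index, and the balancing factor
  \<open>kap k\<close>.\<close>

definition entry_A :: "int \<Rightarrow> real \<Rightarrow> int \<Rightarrow> int \<times> int \<Rightarrow> complex" where
  "entry_A k s j p = - (\<i> * of_real (of_int k * of_int (snd p) / 2 *
     (kap k * rho p powr ((s - 1) / 2) * symA k (shift1 j p) * rho (shift1 j p) powr (- s / 2))))"

definition entry_B :: "int \<Rightarrow> real \<Rightarrow> int \<Rightarrow> int \<times> int \<Rightarrow> complex" where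
  "entry_B k s j p = - (\<i> * of_real (of_int k * of_int (snd p) / 2 *
     (rho p powr (s / 2) * symB k (shift1 j p) * rho (shift1 j p) powr ((1 - s) / 2) / kap k)))"

text \<open>The common leading part of \<open>entry_A\<close> and \<open>entry_B\<close>, with the
  weight divided evenly between \<open>p\<close> and its shift. Exchanging the two indices leaves
  the value unchanged, and the value is purely imaginary; together this makes the shifts by
  \<open>j\<close> and \<open>- j\<close> negative adjoints of each other.\<close>

definition entry_skew :: "int \<Rightarrow> int \<Rightarrow> int \<times> int \<Rightarrow> complex" where
  "entry_skew k j p = - (\<i> * of_real (of_int k * of_int (snd p) / 2 *
     (kap k * (rho p * rho (shift1 j p)) powr (- 1 / 4))))"

text \<open>Bounded because \<open>\<bar>snd p\<bar> \<le> sqrt (rho p)\<close>, but in general not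
  decaying. Differences of entries are therefore controlled through the ratios in
  \<open>entry_factorization\<close>, all of which tend to 1.\<close>

definition entry_leading :: "int \<Rightarrow> int \<times> int \<Rightarrow> complex" where
  "entry_leading k p = - (\<i> * of_real (of_int k / 2 * kap k * (of_int (snd p) * rho p powr (- 1 / 2))))"

lemma rho_ratio_powr: "(rho p / rho q) powr a = rho p powr a * rho q powr (- a)"
  unfolding powr_divide powr_minus by (rule divide_inverse)

lemma entry_factorization:
  "entry_A k s j p = entry_leading k p * of_real (symA k (shift1 j p) * (rho p / rho (shift1 j p)) powr (s / 2))"
  "entry_B k s j p = entry_leading k p * of_real (symB k (shift1 j p) * rho (shift1 j p) / (1 + (of_int k)\<^sup>2) *
     (rho p / rho (shift1 j p)) powr ((s + 1) / 2))"
  "entry_skew k j p = entry_leading k p * of_real ((rho p / rho (shift1 j p)) powr (1 / 4))"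
proof -
  let ?q = "shift1 j p"
  have add: "rho x powr a = rho x powr (- 1 / 2) * rho x powr b" if "a = - 1 / 2 + b" for x a b
    unfolding that powr_add ..
  have "rho p powr ((s - 1) / 2) = rho p powr (- 1 / 2) * rho p powr (s / 2)"
    by (rule add) (simp add: field_simps)
  then show "entry_A k s j p = entry_leading k p * of_real (symA k ?q * (rho p / rho ?q) powr (s / 2))"
    unfolding entry_A_def entry_leading_def rho_ratio_powr by simp
  have b1: "rho p powr (s / 2) = rho p powr (- 1 / 2) * rho p powr ((s + 1) / 2)"
    by (rule add) (simp add: field_simps)
  have "rho ?q powr ((1 - s) / 2) = rho ?q powr (1 + - ((s + 1) / 2))"
    by (rule arg_cong[of _ _ "\<lambda>a. rho ?q powr a"]) (simp add: field_simps)
  then have b2: "rho ?q powr ((1 - s) / 2) = rho ?q * rho ?q powr (- ((s + 1) / 2))"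
    by (simp only: powr_add powr_one[OF less_imp_le[OF rho_pos]])
  have "x / kap k = kap k * (x / (1 + (of_int k)\<^sup>2))" for x
    unfolding kap_square[symmetric] by (simp add: power2_eq_square)
  then show "entry_B k s j p = entry_leading k p * of_real (symB k ?q * rho ?q / (1 + (of_int k)\<^sup>2) *
     (rho p / rho ?q) powr ((s + 1) / 2))"
    unfolding entry_B_def entry_leading_def rho_ratio_powr b1 b2 by simp
  have "rho p powr (- 1 / 4) = rho p powr (- 1 / 2) * rho p powr (1 / 4)"
    by (rule add) simp
  then show "entry_skew k j p = entry_leading k p * of_real ((rho p / rho ?q) powr (1 / 4))"
    unfolding entry_skew_def entry_leading_def rho_ratio_powr powr_mult by simp
qed

lemma bounded_entry_leading: "cmod (entry_leading k p) \<le> \<bar>of_int k / 2\<bar> * kap k"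
proof -
  have "\<bar>of_int (snd p) * rho p powr (- 1 / 2)\<bar> \<le> sqrt (rho p) * rho p powr (- 1 / 2)"
    using abs_snd_le_sqrt_rho[of p] by (simp add: abs_mult mult_right_mono)
  also have "\<dots> = 1"
    using rho_powr_cancel[of p "1 / 2"] by (simp add: powr_half_sqrt less_imp_le)
  finally have "\<bar>of_int k / 2\<bar> * kap k * \<bar>of_int (snd p) * rho p powr (- 1 / 2)\<bar> \<le>
      \<bar>of_int k / 2\<bar> * kap k * 1"
    using kap_ge_1[of k] by (intro mult_left_mono) auto
  then show ?thesis
    using kap_ge_1[of k] by (simp add: entry_leading_def norm_mult abs_mult)
qed

lemma tendsto_entry_leading_mult:
  assumes "(f \<longlongrightarrow> 0) cofinite"
  shows "((\<lambda>p. entry_leading k p * of_real (f p)) \<longlongrightarrow> 0) cofinite"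
proof (rule Lim_null_comparison, rule always_eventually, rule allI)
  show "norm (entry_leading k p * of_real (f p)) \<le> \<bar>of_int k / 2\<bar> * kap k * \<bar>f p\<bar>" for p
    unfolding norm_mult norm_of_real by (rule mult_right_mono[OF bounded_entry_leading]) simp
  show "((\<lambda>p. \<bar>of_int k / 2\<bar> * kap k * \<bar>f p\<bar>) \<longlongrightarrow> 0) cofinite"
    by (intro tendsto_mult_right_zero tendsto_rabs_zero assms)
qed

lemma tendsto_symbols:
  "((\<lambda>p. symA k (shift1 j p) * (rho p / rho (shift1 j p)) powr (s / 2)) \<longlongrightarrow> 1) cofinite"
  "((\<lambda>p. symB k (shift1 j p) * rho (shift1 j p) / (1 + (of_int k)\<^sup>2) *
     (rho p / rho (shift1 j p)) powr ((s + 1) / 2)) \<longlongrightarrow> 1) cofinite"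
  "((\<lambda>p. (rho p / rho (shift1 j p)) powr (1 / 4)) \<longlongrightarrow> 1) cofinite"
  using tendsto_mult[OF filterlim_compose[OF tendsto_symA filterlim_shift1] tendsto_rho_ratio_powr]
    tendsto_mult[OF filterlim_compose[OF tendsto_symB filterlim_shift1] tendsto_rho_ratio_powr]
    tendsto_rho_ratio_powr
  by auto

lemma tendsto_difference:
  "((\<lambda>p. entry_A k s j p - entry_skew k j p) \<longlongrightarrow> 0) cofinite"
  "((\<lambda>p. entry_B k s j p - entry_skew k j p) \<longlongrightarrow> 0) cofinite"
  using tendsto_entry_leading_mult[OF tendsto_diff[OF tendsto_symbols(1) tendsto_symbols(3), simplified]]
    tendsto_entry_leading_mult[OF tendsto_diff[OF tendsto_symbols(2) tendsto_symbols(3), simplified]]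
  unfolding entry_factorization of_real_diff right_diff_distrib by auto

lemma bounded_entry_leading_mult:
  assumes "(f \<longlongrightarrow> l) cofinite"
  obtains B where "\<And>p. cmod (entry_leading k p * of_real (f p)) \<le> B"
proof -
  obtain B where B: "\<And>p. \<bar>f p\<bar> \<le> B"
    using bounded_of_tendsto_cofinite[OF assms] unfolding real_norm_def by blast
  show thesis
    by (rule that[of "(\<bar>of_int k / 2\<bar> * kap k) * B"], unfold norm_mult norm_of_real,
        rule mult_mono[OF bounded_entry_leading B]) (use kap_ge_1[of k] in auto)
qed

lemma bounded_entry_A: "\<exists>B. \<forall>p. cmod (entry_A k s j p) \<le> B"
  and bounded_entry_B: "\<exists>B. \<forall>p. cmod (entry_B k s j p) \<le> B"
  and bounded_entry_skew: "\<exists>B. \<forall>p. cmod (entry_skew k j p) \<le> B"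
  unfolding entry_factorization
  by (rule bounded_entry_leading_mult[OF tendsto_symbols(1)], blast)
    (rule bounded_entry_leading_mult[OF tendsto_symbols(2)], blast,
     rule bounded_entry_leading_mult[OF tendsto_symbols(3)], blast)

section \<open>The conjugated operator and its splitting\<close>

definition opT :: "int \<Rightarrow> real \<Rightarrow> (int \<times> int) ell2 \<times> (int \<times> int) ell2 \<Rightarrow>
    (int \<times> int) ell2 \<times> (int \<times> int) ell2" where
  "opT k s h =
     (wcomp (entry_A k s (- k)) (shift1 (- k)) (snd h) + wcomp (entry_A k s k) (shift1 k) (snd h),
      wcomp (entry_B k s (- k)) (shift1 (- k)) (fst h) + wcomp (entry_B k s k) (shift1 k) (fst h))"

lemma Rep_wcomp_entry_A: "Rep_ell2 (wcomp (entry_A k s j) (shift1 j) u) p = entry_A k s j p * Rep_ell2 u (shift1 j p)"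
  and Rep_wcomp_entry_B: "Rep_ell2 (wcomp (entry_B k s j) (shift1 j) u) p = entry_B k s j p * Rep_ell2 u (shift1 j p)"
  and bounded_clinear_entry_A: "bounded_clinear (wcomp (entry_A k s j) (shift1 j))"
  and bounded_clinear_entry_B: "bounded_clinear (wcomp (entry_B k s j) (shift1 j))"
  and bounded_clinear_entry_skew: "bounded_clinear (wcomp (entry_skew k j) (shift1 j))"
  and Rep_wcomp_entry_skew: "Rep_ell2 (wcomp (entry_skew k j) (shift1 j) u) p = entry_skew k j p * Rep_ell2 u (shift1 j p)"
proof -
  obtain B B' B'' where B: "\<And>p. cmod (entry_A k s j p) \<le> B" "\<And>p. cmod (entry_B k s j p) \<le> B'"
    "\<And>p. cmod (entry_skew k j p) \<le> B''"
    using bounded_entry_A bounded_entry_B bounded_entry_skew by meson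
  show "Rep_ell2 (wcomp (entry_A k s j) (shift1 j) u) p = entry_A k s j p * Rep_ell2 u (shift1 j p)"
    "bounded_clinear (wcomp (entry_A k s j) (shift1 j))"
    using wcomp(1,3)[where c = "entry_A k s j", OF inj_shift1 B(1)] by blast+
  show "Rep_ell2 (wcomp (entry_B k s j) (shift1 j) u) p = entry_B k s j p * Rep_ell2 u (shift1 j p)"
    "bounded_clinear (wcomp (entry_B k s j) (shift1 j))"
    using wcomp(1,3)[where c = "entry_B k s j", OF inj_shift1 B(2)] by blast+
  show "bounded_clinear (wcomp (entry_skew k j) (shift1 j))"
    "Rep_ell2 (wcomp (entry_skew k j) (shift1 j) u) p = entry_skew k j p * Rep_ell2 u (shift1 j p)"
    using wcomp(1,3)[where c = "entry_skew k j", OF inj_shift1 B(3)] by blast+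
qed

lemma bounded_clinear_pair_swap:
  assumes "bounded_clinear S" "bounded_clinear R"
  shows "bounded_clinear (\<lambda>h. (S (snd h), R (fst h)))"
  using assms unfolding bounded_clinear_def
  by (auto intro!: bounded_linear_Pair bounded_linear_compose[of S] bounded_linear_compose[of R]
      bounded_linear_fst bounded_linear_snd simp: scaleC_prod_def)

lemma bounded_clinear_opT: "bounded_clinear (opT k s)"
proof -
  have "opT k s = (\<lambda>h. ((\<lambda>v. wcomp (entry_A k s (- k)) (shift1 (- k)) v + wcomp (entry_A k s k) (shift1 k) v) (snd h),
      (\<lambda>v. wcomp (entry_B k s (- k)) (shift1 (- k)) v + wcomp (entry_B k s k) (shift1 k) v) (fst h)))"
    by (simp add: fun_eq_iff opT_def)
  then show ?thesis
    by (simp only:) (intro bounded_clinear_pair_swap bounded_clinear_add bounded_clinear_entry_A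
        bounded_clinear_entry_B)
qed

lemma symB_0 [simp]: "symB k (0, 0) = 0" by (simp add: symB_def rho_def)

lemma opL_unembed:
  "fst (opL k (state_unembed k s h)) p = of_real (rho p powr ((1 - s) / 2) / kap k) * Rep_ell2 (fst (opT k s h)) p"
  "snd (opL k (state_unembed k s h)) p = of_real (rho p powr (- s / 2)) * Rep_ell2 (snd (opT k s h)) p"
proof -
  have st: "state_unembed k s h = (fst (state_unembed k s h), snd (state_unembed k s h))" by simp
  have c: "rho p powr ((1 - s) / 2) * rho p powr ((s - 1) / 2) = 1"
    "rho p powr (- s / 2) * rho p powr (s / 2) = 1"
    by (simp_all add: powr_add[symmetric] add_divide_distrib[symmetric])
  have a: "of_real (rho p powr ((1 - s) / 2) / kap k) * entry_A k s j p =
      - (\<i> * of_int k * of_int (snd p) / 2) *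
      (of_real (symA k (shift1 j p)) * of_real (rho (shift1 j p) powr (- s / 2)))" for j
  proof -
    have "rho p powr ((1 - s) / 2) / kap k * (of_int k * of_int (snd p) / 2 *
      (kap k * rho p powr ((s - 1) / 2) * symA k (shift1 j p) * rho (shift1 j p) powr (- s / 2)))
      = (rho p powr ((1 - s) / 2) * rho p powr ((s - 1) / 2)) *
        (of_int k * of_int (snd p) / 2 * (symA k (shift1 j p) * rho (shift1 j p) powr (- s / 2)))"
      by simp
    from arg_cong[OF this, of complex_of_real] show ?thesis
      unfolding c by (simp add: entry_A_def mult_ac)
  qed
  have b: "of_real (rho p powr (- s / 2)) * entry_B k s j p =
      - (\<i> * of_int k * of_int (snd p) / 2) *
      (of_real (symB k (shift1 j p)) * of_real (rho (shift1 j p) powr ((1 - s) / 2) / kap k))" for j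
  proof -
    have "rho p powr (- s / 2) * (of_int k * of_int (snd p) / 2 *
      (rho p powr (s / 2) * symB k (shift1 j p) * rho (shift1 j p) powr ((1 - s) / 2) / kap k))
      = (rho p powr (- s / 2) * rho p powr (s / 2)) *
        (of_int k * of_int (snd p) / 2 * (symB k (shift1 j p) * (rho (shift1 j p) powr ((1 - s) / 2) / kap k)))"
      by simp
    from arg_cong[OF this, of complex_of_real] show ?thesis
      unfolding c by (simp add: entry_B_def mult_ac)
  qed
  \<comment> \<open>The indicator coming from \<open>mean_free\<close> is evaluated at the source
    index, and there \<open>symB\<close> already vanishes at the origin.\<close>
  have sb: "w * of_real (symB k p) * z * of_bool (p \<noteq> (0, 0)) = w * of_real (symB k p) * z"
    for p and z w :: complex
    by (cases "p = (0, 0)") auto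
  show "fst (opL k (state_unembed k s h)) p =
      of_real (rho p powr ((1 - s) / 2) / kap k) * Rep_ell2 (fst (opT k s h)) p"
    by (subst st) (simp only: opL_eq Rep_state_unembed opT_def fst_conv snd_conv plus_ell2.rep_eq
        Rep_wcomp_entry_A distrib_left mult.assoc[symmetric] a)
  show "snd (opL k (state_unembed k s h)) p =
      of_real (rho p powr (- s / 2)) * Rep_ell2 (snd (opT k s h)) p"
    by (subst st) (simp only: opL_eq Rep_state_unembed sb opT_def fst_conv snd_conv plus_ell2.rep_eq
        Rep_wcomp_entry_B distrib_left mult.assoc[symmetric] b)
qed

lemma opL_unembed_eq: "opL k (state_unembed k s h) = state_unembed k s (opT k s h)"
proof -
  \<comment> \<open>The entries at \<open>p\<close> carry the factor \<open>snd p\<close>, so the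
    image has mean zero and \<open>mean_free\<close> acts trivially on it.\<close>
  have 0: "Rep_ell2 (fst (opT k s h)) (0, 0) = 0"
    by (simp add: opT_def plus_ell2.rep_eq Rep_wcomp_entry_A entry_A_def)
  have "of_bool (p \<noteq> (0, 0)) * Rep_ell2 (fst (opT k s h)) p = Rep_ell2 (fst (opT k s h)) p" for p
    using 0 by (cases "p = (0, 0)") auto
  then show ?thesis
    by (intro prod_eqI ext) (simp_all only: opL_unembed Rep_state_unembed)
qed

lemma embed_unembed_opT: "state_embed k s (state_unembed k s (opT k s h)) = opT k s h"
proof -
  have 0: "Rep_ell2 (fst (opT k s h)) (0, 0) = 0"
    by (simp add: opT_def plus_ell2.rep_eq Rep_wcomp_entry_A entry_A_def)
  have "mean_free (fst (opT k s h)) = fst (opT k s h)"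
    using 0 by (auto simp: Rep_ell2_inject[symmetric] fun_eq_iff mean_free)
  then show ?thesis
    by (simp add: state_embed_def state_unembed_def sobolev_embed_unembed prod_eq_iff)
qed

lemma inner_wcomp_entry_skew:
  "inner (wcomp (entry_skew k j) (shift1 j) u) v = - inner u (wcomp (entry_skew k (- j)) (shift1 (- j)) v)"
proof -
  obtain B where B: "\<And>p. cmod (entry_skew k j p) \<le> B" using bounded_entry_skew by meson
  have "(\<lambda>p. cnj (entry_skew k j (shift1 (- j) p))) = (\<lambda>p. - entry_skew k (- j) p)"
    by (rule ext) (simp add: entry_skew_def mult.commute[of "rho (shift1 (- j) _)"])
  moreover have "wcomp (\<lambda>p. - entry_skew k (- j) p) (shift1 (- j)) v = - wcomp (entry_skew k (- j)) (shift1 (- j)) v"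
  proof (rule Rep_ell2_inject[THEN iffD1], rule ext)
    obtain B' where "\<And>p. cmod (entry_skew k (- j) p) \<le> B'" using bounded_entry_skew by meson
    then show "Rep_ell2 (wcomp (\<lambda>p. - entry_skew k (- j) p) (shift1 (- j)) v) p =
        Rep_ell2 (- wcomp (entry_skew k (- j)) (shift1 (- j)) v) p" for p
      by (subst Rep_wcomp[where B = B', OF inj_shift1])
        (simp_all add: uminus_ell2.rep_eq Rep_wcomp_entry_skew)
  qed
  ultimately have "cinner (wcomp (entry_skew k j) (shift1 j) u) v =
      cinner u (- wcomp (entry_skew k (- j)) (shift1 (- j)) v)"
    by (subst cinner_wcomp[where \<pi>' = "shift1 (- j)", OF _ _ B]) simp_all
  then show ?thesis by (metis Re_cinner inner_minus_right)
qed

lemma wcomp_near_skew: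
  assumes lim: "((\<lambda>p. c p - entry_skew k j p) \<longlongrightarrow> 0) cofinite"
    and Rep: "\<And>u p. Rep_ell2 (wcomp c (shift1 j) u) p = c p * Rep_ell2 u (shift1 j p)"
    and "\<epsilon> > 0"
  shows "\<exists>S F. bounded_linear S \<and> (\<forall>u. norm (S u) \<le> \<epsilon> * norm u) \<and> finite_rank F \<and>
    (\<forall>u. wcomp c (shift1 j) u = wcomp (entry_skew k j) (shift1 j) u + S u + F u)"
proof -
  obtain S F where SF: "bounded_linear S" "\<And>u. norm (S u) \<le> \<epsilon> * norm u" "finite_rank F"
    "\<And>u. wcomp (\<lambda>p. c p - entry_skew k j p) (shift1 j) u = S u + F u"
    using wcomp_small_plus_finite_rank[OF inj_shift1 lim \<open>\<epsilon> > 0\<close>] by blast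
  obtain B where B: "\<And>p. cmod (c p - entry_skew k j p) \<le> B"
    using bounded_of_tendsto_cofinite[OF lim] by blast
  have "wcomp c (shift1 j) u = wcomp (entry_skew k j) (shift1 j) u + S u + F u" for u
    unfolding add.assoc SF(4)[symmetric]
    by (simp only: Rep_ell2_inject[symmetric] fun_eq_iff plus_ell2.rep_eq Rep
        Rep_wcomp_entry_skew Rep_wcomp[where c = "\<lambda>p. c p - entry_skew k j p", OF inj_shift1 B])
      (simp add: algebra_simps)
  then show ?thesis using SF by blast
qed

lemma half_plane_splitting:
  assumes "Re z > 0"
  shows "\<exists>G F c. c > 0 \<and> bounded_linear G \<and> finite_rank F \<and>
      (\<forall>x. c * (norm x)\<^sup>2 \<le> inner (G x) x) \<and> (\<forall>x. z *\<^sub>C x - opT k s x = G x - F x)"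
proof -
  \<comment> \<open>Two shifts contribute to each component, so the small part has norm at most
    \<open>2 * \<epsilon> = Re z / 2\<close>, and half of the coercivity \<open>Re z\<close>
    survives.\<close>
  define \<epsilon> where "\<epsilon> = Re z / 4"
  have \<epsilon>: "\<epsilon> > 0" using assms by (simp add: \<epsilon>_def)
  obtain S1 F1 where 1: "\<And>j. bounded_linear (S1 j)" "\<And>j u. norm (S1 j u) \<le> \<epsilon> * norm u"
    "\<And>j. finite_rank (F1 j)"
    "\<And>j u. wcomp (entry_A k s j) (shift1 j) u = wcomp (entry_skew k j) (shift1 j) u + S1 j u + F1 j u"
    using wcomp_near_skew[OF tendsto_difference(1) Rep_wcomp_entry_A \<epsilon>] by metis
  obtain S2 F2 where 2: "\<And>j. bounded_linear (S2 j)" "\<And>j u. norm (S2 j u) \<le> \<epsilon> * norm u"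
    "\<And>j. finite_rank (F2 j)"
    "\<And>j u. wcomp (entry_B k s j) (shift1 j) u = wcomp (entry_skew k j) (shift1 j) u + S2 j u + F2 j u"
    using wcomp_near_skew[OF tendsto_difference(2) Rep_wcomp_entry_B \<epsilon>] by metis
  define \<Gamma> where "\<Gamma> v = wcomp (entry_skew k (- k)) (shift1 (- k)) v + wcomp (entry_skew k k) (shift1 k) v" for v
  define J where "J h = (\<Gamma> (snd h), \<Gamma> (fst h))" for h
  define S where "S h = (S1 (- k) (snd h) + S1 k (snd h), S2 (- k) (fst h) + S2 k (fst h))" for h
  define F where "F h = (F1 (- k) (snd h) + F1 k (snd h), F2 (- k) (fst h) + F2 k (fst h))" for h
  have opT: "opT k s h = J h + S h + F h" for h
    by (simp add: opT_def 1(4) 2(4) J_def S_def F_def \<Gamma>_def algebra_simps)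
  have "inner (\<Gamma> v) u = - inner v (\<Gamma> u)" for u v
    using inner_wcomp_entry_skew[of k k v u] inner_wcomp_entry_skew[of k "- k" v u]
    by (simp add: \<Gamma>_def inner_add_left inner_add_right)
  \<comment> \<open>The same skew-adjoint block \<Gamma> stands in both off-diagonal places, which
    makes the whole matrix skew-adjoint. This equality of the blocks is what the factor
    \<open>kap k\<close> in the embedding achieves.\<close>
  then have J: "inner (J h) h = 0" for h
    by (simp add: J_def inner_prod_def inner_commute[of "fst h"])
  have norm_S: "norm (S h) \<le> 2 * \<epsilon> * norm h" for h
  proof -
    have "norm (S1 (- k) (snd h) + S1 k (snd h)) \<le> 2 * \<epsilon> * norm (snd h)"
      using norm_triangle_ineq[of "S1 (- k) (snd h)" "S1 k (snd h)"] 1(2)[of "- k" "snd h"]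
        1(2)[of k "snd h"] by simp
    moreover have "norm (S2 (- k) (fst h) + S2 k (fst h)) \<le> 2 * \<epsilon> * norm (fst h)"
      using norm_triangle_ineq[of "S2 (- k) (fst h)" "S2 k (fst h)"] 2(2)[of "- k" "fst h"]
        2(2)[of k "fst h"] by simp
    ultimately have "norm (S h) \<le> sqrt ((2 * \<epsilon> * norm (snd h))\<^sup>2 + (2 * \<epsilon> * norm (fst h))\<^sup>2)"
      unfolding S_def norm_Pair by (intro real_sqrt_le_mono add_mono power_mono) auto
    also have "(2 * \<epsilon> * norm (snd h))\<^sup>2 + (2 * \<epsilon> * norm (fst h))\<^sup>2 = (2 * \<epsilon> * norm h)\<^sup>2"
      by (simp add: power_mult_distrib norm_prod_def distrib_left)
    finally show ?thesis using \<epsilon> by simp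
  qed
  have lin\<Gamma>: "bounded_linear \<Gamma>"
    unfolding \<Gamma>_def using bounded_clinear_entry_skew
    by (intro bounded_linear_add) (simp_all add: bounded_clinear_def)
  have linS: "bounded_linear S"
    unfolding S_def
    by (intro bounded_linear_Pair bounded_linear_add bounded_linear_compose[OF 1(1)]
        bounded_linear_compose[OF 2(1)] bounded_linear_fst bounded_linear_snd)
  have linJ: "bounded_linear J"
    unfolding J_def
    by (intro bounded_linear_Pair bounded_linear_compose[OF lin\<Gamma>] bounded_linear_fst bounded_linear_snd)
  have fr: "finite_rank (\<lambda>h. F1 (- k) (snd h) + F1 k (snd h))" "finite_rank (\<lambda>h. F2 (- k) (fst h) + F2 k (fst h))"
    by (intro finite_rank_add finite_rank_compose[OF bounded_linear_ident 1(3) bounded_linear_snd]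
        finite_rank_compose[OF bounded_linear_ident 2(3) bounded_linear_fst])+
  have F: "finite_rank F"
    using finite_rank_add[OF
        finite_rank_compose[OF bounded_linear_Pair[OF bounded_linear_ident bounded_linear_zero]
          fr(1) bounded_linear_ident]
        finite_rank_compose[OF bounded_linear_Pair[OF bounded_linear_zero bounded_linear_ident]
          fr(2) bounded_linear_ident]]
    by (simp add: F_def[abs_def])
  define G where "G x = z *\<^sub>C x - J x - S x" for x
  have "Re z / 2 * (norm x)\<^sup>2 \<le> inner (G x) x" for x
  proof -
    have "inner (S x) x \<le> norm (S x) * norm x" by (rule norm_cauchy_schwarz)
    also have "\<dots> \<le> 2 * \<epsilon> * norm x * norm x" by (intro mult_right_mono norm_S) auto
    also have "\<dots> = Re z / 2 * (norm x)\<^sup>2" by (simp add: \<epsilon>_def power2_eq_square)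
    finally have "inner (S x) x \<le> Re z / 2 * (norm x)\<^sup>2" .
    then show ?thesis by (simp add: G_def inner_diff_left J inner_scaleC_self)
  qed
  moreover have "bounded_linear G"
    unfolding G_def by (intro bounded_linear_sub bounded_linear_scaleC linJ linS)
  moreover have "z *\<^sub>C x - opT k s x = G x - F x" for x by (simp add: G_def opT)
  moreover have "Re z / 2 > 0" using assms by simp
  ultimately show ?thesis using F by blast
qed

interpretation opL: half_plane_operator "Xspace s" "Xnorm s" "opL k" "state_embed k s"
  "state_unembed k s" "kap k" "opT k s" for k :: int and s :: real
proof
  fix x y :: state and c :: complex and g h :: "(int \<times> int) ell2 \<times> (int \<times> int) ell2"
  have X: "fst x \<in> sobolev (s - 1)" "snd x \<in> sobolev s" if "x \<in> Xspace s" for x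
    using that by (auto simp: Xspace_def sobolev_mean_zero_def)
  show "state_embed k s (x + y) = state_embed k s x + state_embed k s y"
    if "x \<in> Xspace s" "y \<in> Xspace s"
    using that[THEN X(1)] that[THEN X(2)]
    by (simp add: state_embed_def sobolev_embed_add scaleR_add_right)
  show "state_embed k s (c *\<^sub>C x) = c *\<^sub>C state_embed k s x" if "x \<in> Xspace s"
    using that[THEN X(1)] that[THEN X(2)]
    by (simp add: state_embed_def sobolev_embed_scaleC scaleC_prod_def scaleR_scaleC scaleC_scaleC
        mult.commute)
  show "norm (state_embed k s x) \<le> kap k * Xnorm s x" if "x \<in> Xspace s"
  proof -
    have "(kap k * sobolev_norm (s - 1) (fst x))\<^sup>2 + (sobolev_norm s (snd x))\<^sup>2 \<le>
        (kap k)\<^sup>2 * ((sobolev_norm (s - 1) (fst x))\<^sup>2 + (sobolev_norm s (snd x))\<^sup>2)"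
      using mult_right_mono[OF one_le_power[OF kap_ge_1[of k], of 2], of "(sobolev_norm s (snd x))\<^sup>2"]
      by (simp add: power_mult_distrib distrib_left)
    from real_sqrt_le_mono[OF this] show ?thesis
      using kap_ge_1[of k] X[OF that]
      by (simp add: state_embed_def norm_Pair norm_sobolev_embed Xnorm_def case_prod_unfold real_sqrt_mult)
  qed
  show "state_unembed k s h \<in> Xspace s" by (rule state_unembed_Xspace)
  show "state_unembed k s (g + h) = state_unembed k s g + state_unembed k s h"
    by (simp add: state_unembed_def sobolev_unembed_add mean_free_add scaleR_add_right)
  show "state_unembed k s (c *\<^sub>C h) = c *\<^sub>C state_unembed k s h"
    by (simp add: state_unembed_def sobolev_unembed_scaleC mean_free_scaleC scaleC_prod_def
        scaleR_scaleC scaleC_scaleC mult.commute flip: sobolev_unembed_scaleC)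
  show "Xnorm s (state_unembed k s h) \<le> kap k * norm h"
  proof -
    have "norm (inverse (kap k) *\<^sub>R mean_free (fst h)) \<le> 1 * norm (fst h)"
      unfolding norm_scaleR using kap_ge_1[of k] mean_free(2)[of "fst h"]
      by (intro mult_mono) (auto simp: inverse_le_1_iff)
    then have "Xnorm s (state_unembed k s h) \<le> norm h"
      unfolding state_unembed_def Xnorm_def norm_prod_def
      by (auto simp: norm_sobolev_unembed intro!: power_mono)
    also have "\<dots> \<le> kap k * norm h" using mult_right_mono[OF kap_ge_1[of k], of "norm h"] by simp
    finally show ?thesis .
  qed
  show "state_unembed k s (state_embed k s x) = x" if "x \<in> Xspace s"
    by (rule state_unembed_embed[OF that])
  show "opL k x \<in> Xspace s" if "x \<in> Xspace s"
    using opL_unembed_eq[of k s "state_embed k s x"] state_unembed_Xspace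
    by (metis state_unembed_embed[OF that])
  show "opT k s h = state_embed k s (opL k (state_unembed k s h))"
    by (simp add: opL_unembed_eq embed_unembed_opT)
  show "bounded_clinear (opT k s)" by (rule bounded_clinear_opT)
  show "kap k \<ge> 0" using kap_ge_1[of k] by simp
  show "Xnorm s x \<ge> 0" by (simp add: Xnorm_def case_prod_unfold)
qed (rule half_plane_splitting)

text \<open>In terms of states, this is \<open>\<langle>B \<omega>, \<omega>'\<rangle> - \<langle>A F, F'\<rangle>\<close>: the conserved energy form, with the sign of
  its second summand reversed.\<close>

definition weightB :: "int \<Rightarrow> real \<Rightarrow> int \<times> int \<Rightarrow> real" where
  "weightB k s p = symB k p * rho p powr (1 - s) / (kap k)\<^sup>2"

definition weightA :: "int \<Rightarrow> real \<Rightarrow> int \<times> int \<Rightarrow> real" where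
  "weightA k s p = symA k p * rho p powr (- s)"

definition multB where "multB k s = wcomp (\<lambda>p. complex_of_real (weightB k s p)) id"
definition multA where "multA k s = wcomp (\<lambda>p. complex_of_real (weightA k s p)) id"

definition formQ :: "int \<Rightarrow> real \<Rightarrow> (int \<times> int) ell2 \<times> (int \<times> int) ell2 \<Rightarrow>
    (int \<times> int) ell2 \<times> (int \<times> int) ell2 \<Rightarrow> complex" where
  "formQ k s g h = cinner (multB k s (fst g)) (fst h) - cinner (multA k s (snd g)) (snd h)"

section \<open>The sign-reversed energy form and algebraic multiplicity\<close>

context
  fixes k :: int and s :: real
  assumes s: "s \<ge> 0"
begin

text \<open>The product of \<open>symB\<close> and \<open>rho\<close> is bounded, and
  \<open>s \<ge> 0\<close> makes the remaining power \<open>rho p powr (- s)\<close> at most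
  1.\<close>

lemma bounded_weightB: "\<exists>B. \<forall>p. \<bar>weightB k s p\<bar> \<le> B"
proof -
  obtain B where B: "\<And>p. \<bar>symB k p * rho p / (1 + (of_int k)\<^sup>2)\<bar> \<le> B"
    using bounded_of_tendsto_cofinite[OF tendsto_symB[of k]] unfolding real_norm_def by blast
  have "\<bar>weightB k s p\<bar> \<le> B * 1" for p
  proof -
    have "rho p powr (1 - s) = rho p * rho p powr (- s)"
      using powr_add[of "rho p" 1 "- s"] by (simp add: less_imp_le)
    then have "weightB k s p = symB k p * rho p / (1 + (of_int k)\<^sup>2) * rho p powr (- s)"
      by (simp add: weightB_def kap_square)
    moreover have "rho p powr (- s) \<le> 1"
      using powr_mono[of "- s" 0 "rho p"] s rho_ge_1[of p] by simp
    ultimately show ?thesis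
      using B[of p] order_trans[OF abs_ge_zero B[of p]]
      by (simp only: abs_mult) (intro mult_mono, auto)
  qed
  then show ?thesis by blast
qed

lemma bounded_weightA: "\<exists>B. \<forall>p. \<bar>weightA k s p\<bar> \<le> B"
proof -
  obtain B where B: "\<And>p. \<bar>symA k p\<bar> \<le> B"
    using bounded_of_tendsto_cofinite[OF tendsto_symA[of k]] unfolding real_norm_def by blast
  have "\<bar>weightA k s p\<bar> \<le> B * 1" for p
  proof -
    have "rho p powr (- s) \<le> 1"
      using powr_mono[of "- s" 0 "rho p"] s rho_ge_1[of p] by simp
    then show ?thesis
      using B[of p] order_trans[OF abs_ge_zero B[of p]]
      by (simp only: abs_mult weightA_def) (intro mult_mono, auto)
  qed
  then show ?thesis by blast
qed

lemma multB: "Rep_ell2 (multB k s u) p = of_real (weightB k s p) * Rep_ell2 u p"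
    "bounded_clinear (multB k s)" "cinner (multB k s u) v = cinner u (multB k s v)"
  and multA: "Rep_ell2 (multA k s u) p = of_real (weightA k s p) * Rep_ell2 u p"
    "bounded_clinear (multA k s)" "cinner (multA k s u) v = cinner u (multA k s v)"
proof -
  obtain B B' where B: "\<And>p. cmod (complex_of_real (weightB k s p)) \<le> B"
    "\<And>p. cmod (complex_of_real (weightA k s p)) \<le> B'"
    using bounded_weightB bounded_weightA unfolding norm_of_real by meson
  show "Rep_ell2 (multB k s u) p = of_real (weightB k s p) * Rep_ell2 u p"
    "bounded_clinear (multB k s)" "cinner (multB k s u) v = cinner u (multB k s v)"
    unfolding multB_def
    using wcomp(1,3)[where c = "\<lambda>p. of_real (weightB k s p)", OF inj_on_id B(1)]
      cinner_wcomp[where \<pi> = id and \<pi>' = id and c = "\<lambda>p. of_real (weightB k s p)", OF _ _ B(1)]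
    by simp_all
  show "Rep_ell2 (multA k s u) p = of_real (weightA k s p) * Rep_ell2 u p"
    "bounded_clinear (multA k s)" "cinner (multA k s u) v = cinner u (multA k s v)"
    unfolding multA_def
    using wcomp(1,3)[where c = "\<lambda>p. of_real (weightA k s p)", OF inj_on_id B(2)]
      cinner_wcomp[where \<pi> = id and \<pi>' = id and c = "\<lambda>p. of_real (weightA k s p)", OF _ _ B(2)]
    by simp_all
qed

text \<open>Both sides contain \<open>symA\<close> at \<open>p\<close> and \<open>symB\<close> at
  the shifted index. The symbol that belongs to the form on one side belongs to the operator on the
  other, and the Sobolev weights match.\<close>

lemma weight_entry_A_B:
  "weightB k s (shift1 (- j) p) * entry_A k s j (shift1 (- j) p) = weightA k s p * entry_B k s (- j) p"
proof -
  let ?q = "shift1 (- j) p"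
  have "rho ?q powr (1 - s) * rho ?q powr ((s - 1) / 2) = rho ?q powr ((1 - s) / 2)"
    by (simp add: powr_add[symmetric] field_simps)
  then have B: "weightB k s ?q * (kap k * rho ?q powr ((s - 1) / 2)) = symB k ?q * rho ?q powr ((1 - s) / 2) / kap k"
    by (simp add: weightB_def power2_eq_square)
  have "rho p powr (- s) * rho p powr (s / 2) = rho p powr (- s / 2)"
    by (simp add: powr_add[symmetric] field_simps)
  then have A: "weightA k s p * rho p powr (s / 2) = symA k p * rho p powr (- s / 2)"
    by (simp add: weightA_def)
  have "weightB k s ?q * (of_int k * of_int (snd p) / 2 *
     (kap k * rho ?q powr ((s - 1) / 2) * symA k p * rho p powr (- s / 2))) =
     of_int k * of_int (snd p) / 2 * (symA k p * rho p powr (- s / 2)) *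
     (weightB k s ?q * (kap k * rho ?q powr ((s - 1) / 2)))"
    by (simp only: mult_ac)
  also have "\<dots> = weightA k s p * (of_int k * of_int (snd p) / 2 *
     (rho p powr (s / 2) * symB k ?q * rho ?q powr ((1 - s) / 2) / kap k))"
    unfolding A[symmetric] B by simp
  finally have "complex_of_real (weightB k s ?q * (of_int k * of_int (snd p) / 2 *
     (kap k * rho ?q powr ((s - 1) / 2) * symA k p * rho p powr (- s / 2)))) =
     of_real (weightA k s p * (of_int k * of_int (snd p) / 2 *
     (rho p powr (s / 2) * symB k ?q * rho ?q powr ((1 - s) / 2) / kap k)))"
    by (rule arg_cong)
  then show ?thesis
    unfolding entry_A_def entry_B_def of_real_mult[of "weightB k s ?q"] of_real_mult[of "weightA k s p"]
    by (simp only: shift1_shift1 snd_shift1 add.right_inverse shift1_0 mult_minus_right mult.left_commute[of _ \<i>])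
qed

lemma cinner_entry_A_B:
  "cinner (multB k s (wcomp (entry_A k s j) (shift1 j) v)) u =
    - cinner (multA k s v) (wcomp (entry_B k s (- j)) (shift1 (- j)) u)"
proof -
  obtain B where B: "\<And>p. cmod (entry_A k s j p) \<le> B" using bounded_entry_A by meson
  have cnj: "cnj (entry_A k s j p) = - entry_A k s j p" for p by (simp add: entry_A_def)
  have "cinner (multB k s (wcomp (entry_A k s j) (shift1 j) v)) u =
      cinner v (wcomp (\<lambda>p. cnj (entry_A k s j (shift1 (- j) p))) (shift1 (- j)) (multB k s u))"
    unfolding multB(3) by (rule cinner_wcomp[OF _ _ B]) simp_all
  also have "wcomp (\<lambda>p. cnj (entry_A k s j (shift1 (- j) p))) (shift1 (- j)) (multB k s u) =
      - multA k s (wcomp (entry_B k s (- j)) (shift1 (- j)) u)"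
  proof (rule Rep_ell2_inject[THEN iffD1], rule ext)
    fix p
    have "Rep_ell2 (wcomp (\<lambda>p. cnj (entry_A k s j (shift1 (- j) p))) (shift1 (- j)) (multB k s u)) p =
       cnj (entry_A k s j (shift1 (- j) p)) * (of_real (weightB k s (shift1 (- j) p)) * Rep_ell2 u (shift1 (- j) p))"
      using B by (subst Rep_wcomp[where B = B, OF inj_shift1]) (simp_all add: multB)
    also have "\<dots> = - (of_real (weightB k s (shift1 (- j) p)) * entry_A k s j (shift1 (- j) p)) * Rep_ell2 u (shift1 (- j) p)"
      by (simp add: cnj)
    also have "\<dots> = - (of_real (weightA k s p) * (entry_B k s (- j) p * Rep_ell2 u (shift1 (- j) p)))"
      by (simp add: weight_entry_A_B)
    finally show "Rep_ell2 (wcomp (\<lambda>p. cnj (entry_A k s j (shift1 (- j) p))) (shift1 (- j)) (multB k s u)) p =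
        Rep_ell2 (- multA k s (wcomp (entry_B k s (- j)) (shift1 (- j)) u)) p"
      by (simp add: uminus_ell2.rep_eq multA Rep_wcomp_entry_B)
  qed
  also have "cinner v (- multA k s (wcomp (entry_B k s (- j)) (shift1 (- j)) u)) =
      - cinner (multA k s v) (wcomp (entry_B k s (- j)) (shift1 (- j)) u)"
    using cinner_commute[of v "- multA k s (wcomp (entry_B k s (- j)) (shift1 (- j)) u)"]
      cinner_commute[of v "multA k s (wcomp (entry_B k s (- j)) (shift1 (- j)) u)"]
    by (simp add: multA(3))
  finally show ?thesis .
qed

lemma mult_add: "multB k s (u + v) = multB k s u + multB k s v" "multA k s (u + v) = multA k s u + multA k s v"
  and mult_scaleC: "multB k s (c *\<^sub>C u) = c *\<^sub>C multB k s u" "multA k s (c *\<^sub>C u) = c *\<^sub>C multA k s u"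
  using multB(2) multA(2) by (auto simp: bounded_clinear_def bounded_linear.linear linear_add)

text \<open>Moving the operator to the other argument exchanges the two summands of the form at the
  cost of a sign. The minus sign in \<open>formQ\<close> compensates for it, so that together with
  \<open>formQ_opT_2\<close> the operator is symmetric for \<open>formQ\<close>.\<close>

lemma formQ_opT_1:
  "cinner (multB k s (fst (opT k s g))) (fst h) = - cinner (multA k s (snd g)) (snd (opT k s h))"
  using cinner_entry_A_B[of k "snd g" "fst h"] cinner_entry_A_B[of "- k" "snd g" "fst h"]
  by (simp add: opT_def mult_add cinner_add_left cinner_add_right)

lemma formQ_opT_2:
  "cinner (multA k s (snd (opT k s g))) (snd h) = - cinner (multB k s (fst g)) (fst (opT k s h))"
proof -
  have "cinner (multA k s (snd (opT k s g))) (snd h) = cnj (cinner (multA k s (snd h)) (snd (opT k s g)))"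
    by (subst multA(3)) (rule cinner_commute)
  also have "\<dots> = - cnj (cinner (multB k s (fst (opT k s h))) (fst g))"
    by (simp add: formQ_opT_1)
  also have "\<dots> = - cinner (multB k s (fst g)) (fst (opT k s h))"
    using cinner_commute[of "multB k s (fst g)" "fst (opT k s h)"] by (simp add: multB(3))
  finally show ?thesis .
qed

lemma finite_algebraic_multiplicity_opL:
  assumes z0: "z0 > 0" "eigenvalue (Xspace s) (opL k) (complex_of_real z0)"
    and isolated: "complex_of_real z0 isolated_in spectrum (Xspace s) (Xnorm s) (opL k)"
  shows "finite_algebraic_multiplicity (Xspace s) (Xnorm s) (opL k) (complex_of_real z0)"
proof (rule opL.finite_algebraic_multiplicityI[where q = "formQ k s"])
  fix u v h :: "(int \<times> int) ell2 \<times> (int \<times> int) ell2" and c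
  have "bounded_linear (multB k s)" "bounded_linear (multA k s)"
    using multB(2) multA(2) by (simp_all add: bounded_clinear_def)
  then show "bounded_linear (\<lambda>u. formQ k s u v)"
    unfolding formQ_def
    using bounded_linear_compose[OF bounded_linear_cinner_left bounded_linear_compose[OF _ bounded_linear_fst]]
      bounded_linear_compose[OF bounded_linear_cinner_left bounded_linear_compose[OF _ bounded_linear_snd]]
    by (intro bounded_linear_sub) blast+
  show "formQ k s (c *\<^sub>C u) v = c * formQ k s u v"
    by (simp add: formQ_def scaleC_prod_def mult_scaleC cinner_scaleC_left right_diff_distrib)
  show "formQ k s u v = cnj (formQ k s v u)"
    unfolding formQ_def complex_cnj_diff cinner_commute[symmetric] multB(3) multA(3) ..
  {
    assume v: "opT k s v = complex_of_real z0 *\<^sub>C v"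
    \<comment> \<open>Symmetry moves the operator onto \<open>v\<close>, and \<open>z0\<close> comes
      out of the antilinear argument without conjugation because it is real.\<close>
    show "formQ k s (opT k s u) v = complex_of_real z0 * formQ k s u v"
      unfolding formQ_def formQ_opT_1 formQ_opT_2 v
      by (simp add: scaleC_prod_def cinner_scaleC_right right_diff_distrib)
  }
  assume u: "opT k s u = complex_of_real z0 *\<^sub>C u" "u \<noteq> 0"
  \<comment> \<open>The conserved energy vanishes on eigenvectors with nonzero real eigenvalue: the
    two summands of \<open>formQ\<close> are equal, so that the form is twice its nonnegative first
    summand.\<close>
  have "of_real z0 * cinner (multB k s (fst u)) (fst u) = of_real z0 * - cinner (multA k s (snd u)) (snd u)"
    using formQ_opT_1[of u u] unfolding u
    by (simp add: scaleC_prod_def mult_scaleC cinner_scaleC_left cinner_scaleC_right)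
  then have "cinner (multB k s (fst u)) (fst u) = - cinner (multA k s (snd u)) (snd u)"
    using z0(1) by (subst (asm) mult_cancel_left) simp
  then have form: "formQ k s u u = 2 * cinner (multB k s (fst u)) (fst u)"
    by (simp add: formQ_def)
  \<comment> \<open>The weight of the first summand vanishes at the origin, so strict positivity
    requires a nonzero coefficient at another index.\<close>
  have "Rep_ell2 (fst (opT k s u)) (0, 0) = 0"
    by (simp add: opT_def plus_ell2.rep_eq Rep_wcomp_entry_A entry_A_def)
  then have u00: "Rep_ell2 (fst u) (0, 0) = 0"
    using u(1) z0(1) by (simp add: scaleC_prod_def scaleC_ell2.rep_eq)
  have "fst u \<noteq> 0"
  proof
    assume 0: "fst u = 0"
    have "snd (opT k s u) = 0"
      by (simp add: opT_def 0 bounded_clinear_entry_B[unfolded bounded_clinear_def] linear_0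
          bounded_linear.linear)
    then have "complex_of_real z0 *\<^sub>C snd u = 0" using u(1) by (simp add: scaleC_prod_def)
    then have "snd u = 0" using z0(1) by (simp add: complex_vector.scale_eq_0_iff)
    then show False using 0 u(2) by (simp add: prod_eq_iff)
  qed
  then obtain p where p: "Rep_ell2 (fst u) p \<noteq> 0"
    by (auto simp: Rep_ell2_inject[symmetric] fun_eq_iff zero_ell2.rep_eq)
  have wB: "weightB k s p > 0" if "p \<noteq> (0, 0)" for p
  proof -
    have "rho p - 1 > 0"
      using that by (cases p) (auto simp: rho_def add_pos_nonneg add_nonneg_pos)
    then show ?thesis
      using kap_ge_1[of k] unfolding weightB_def symB_def
      by (intro divide_pos_pos mult_pos_pos) (auto simp: add_pos_nonneg)
  qed
  have wB0: "weightB k s p \<ge> 0" for p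
    using wB[of p] by (cases "p = (0, 0)") (auto simp: weightB_def)
  have "Re (cinner (multB k s (fst u)) (fst u)) =
      (\<Sum>\<^sub>\<infinity>p. Re (Rep_ell2 (multB k s (fst u)) p * cnj (Rep_ell2 (fst u) p)))"
    unfolding Re_cinner by (rule inner_ell2_eq)
  also have "(\<lambda>p. Re (Rep_ell2 (multB k s (fst u)) p * cnj (Rep_ell2 (fst u) p))) =
      (\<lambda>p. weightB k s p * (cmod (Rep_ell2 (fst u) p))\<^sup>2)"
    by (rule ext) (simp only: multB mult.assoc complex_norm_square[symmetric] of_real_mult[symmetric]
        Re_complex_of_real)
  finally have Re: "Re (cinner (multB k s (fst u)) (fst u)) =
    (\<Sum>\<^sub>\<infinity>p. weightB k s p * (cmod (Rep_ell2 (fst u) p))\<^sup>2)" .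
  have "(\<lambda>p. weightB k s p * (cmod (Rep_ell2 (fst u) p))\<^sup>2) summable_on UNIV"
    using inner_ell2_summable[of "multB k s (fst u)" "fst u"]
    by (simp only: multB mult.assoc complex_norm_square[symmetric] of_real_mult[symmetric]
        Re_complex_of_real)
  then have "(\<Sum>p\<in>{p}. weightB k s p * (cmod (Rep_ell2 (fst u) p))\<^sup>2) \<le>
      (\<Sum>\<^sub>\<infinity>p. weightB k s p * (cmod (Rep_ell2 (fst u) p))\<^sup>2)"
    by (rule finite_sum_le_infsum) (auto simp: wB0)
  moreover have "p \<noteq> (0, 0)" using p u00 by auto
  then have "0 < weightB k s p * (cmod (Rep_ell2 (fst u) p))\<^sup>2" using p wB by simp
  ultimately show "0 < Re (formQ k s u u)" by (simp add: form Re)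
qed (use z0 isolated in auto)

end

section \<open>Square roots and the number of negative eigenvalues\<close>

text \<open>With \<open>Z = (T + Z\<^sup>2) / 2\<close>, the operator \<open>1 - Z\<close> is a square root of \<open>1 - T\<close>. The fixed point
  iteration for \<open>Z\<close> converges in norm since it is dominated by the scalar iteration for \<open>T = 1\<close>,
  which increases to \<open>1\<close>.\<close>

primrec sqrt_iter :: "('a \<Rightarrow> 'a) \<Rightarrow> nat \<Rightarrow> 'a \<Rightarrow> 'a::real_vector" where
  "sqrt_iter T 0 = (\<lambda>u. 0)"
| "sqrt_iter T (Suc n) = (\<lambda>u. (1 / 2) *\<^sub>R (T u + sqrt_iter T n (sqrt_iter T n u)))"

primrec sqrt_iter_bound :: "nat \<Rightarrow> real" where
  "sqrt_iter_bound 0 = 0"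
| "sqrt_iter_bound (Suc n) = (1 + (sqrt_iter_bound n)\<^sup>2) / 2"

lemma sqrt_iter_bound: "0 \<le> sqrt_iter_bound n" "sqrt_iter_bound n \<le> 1"
  by (induction n) (auto simp: power_le_one)

lemma incseq_sqrt_iter_bound: "incseq sqrt_iter_bound"
proof (rule incseq_SucI)
  fix n
  have "0 \<le> (1 - sqrt_iter_bound n)\<^sup>2" by simp
  then show "sqrt_iter_bound n \<le> sqrt_iter_bound (Suc n)" by (simp add: power2_diff)
qed

text \<open>Applied to \<open>T\<close>, to the iterates themselves and to complex scalars, which
  gives commuting iterates and a complex-linear limit.\<close>

lemma sqrt_iter_commute:
  assumes "linear A" "\<And>u. A (T u) = T (A u)"
  shows "A (sqrt_iter T n u) = sqrt_iter T n (A u)"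
  by (induction n arbitrary: u)
    (simp_all add: linear_0 linear_add linear_scale assms)

lemma exists_sqrt:
  fixes T :: "'a::complex_hilbert \<Rightarrow> 'a"
  assumes T: "bounded_clinear T" "\<And>u. norm (T u) \<le> norm u"
    and sa: "\<And>u v. inner (T u) v = inner u (T v)"
  shows "\<exists>S. bounded_clinear S \<and> (\<forall>u. S (S u) = u - T u) \<and>
    (\<forall>u v. inner (S u) v = inner u (S v)) \<and> (\<forall>u. inner (S u) u \<ge> 0)"
proof -
  let ?Y = "sqrt_iter T" and ?y = sqrt_iter_bound
  have linT: "linear T" using T(1) by (simp add: bounded_clinear_def bounded_linear.linear)
  have lin: "linear (?Y n)" for n
  proof (induction n)
    case (Suc n)
    show ?case
      by (rule linearI) (simp_all add: linear_add[OF Suc] linear_add[OF linT] linear_scale[OF Suc]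
          linear_scale[OF linT] scaleR_add_right)
  qed (simp add: linear_zero)
  have comm: "?Y m (?Y n u) = ?Y n (?Y m u)" for m n u
    by (rule sqrt_iter_commute[OF lin]) (rule sqrt_iter_commute[OF linT, symmetric], simp)
  have bound: "norm (?Y n u) \<le> ?y n * norm u" for n u
  proof (induction n arbitrary: u)
    case (Suc n)
    have "norm (?Y n (?Y n u)) \<le> ?y n * (?y n * norm u)"
      using Suc[of "?Y n u"] Suc[of u] sqrt_iter_bound(1)[of n] by (meson mult_left_mono order_trans)
    then show ?case
      using norm_triangle_ineq[of "T u" "?Y n (?Y n u)"] T(2)[of u]
      by (simp add: power2_eq_square distrib_right mult.assoc del: scaleR_add_right)
  qed simp
  have step: "norm (?Y (Suc n) u - ?Y n u) \<le> (?y (Suc n) - ?y n) * norm u" for n u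
  proof (induction n arbitrary: u)
    case 0
    then show ?case using T(2)[of u] by simp
  next
    case (Suc n)
    let ?d = "?Y (Suc n) u - ?Y n u"
    have "?Y (Suc (Suc n)) u - ?Y (Suc n) u = (1 / 2) *\<^sub>R (?Y (Suc n) (?Y (Suc n) u) - ?Y n (?Y n u))"
    proof -
      have "?Y (Suc m) v = (1 / 2) *\<^sub>R (T v + ?Y m (?Y m v))" for m v by simp
      from arg_cong2[of _ _ _ _ minus, OF this[of "Suc n" u] this[of n u]] show ?thesis
        by (simp only: scaleR_diff_right[symmetric] add_diff_cancel_left)
    qed
    \<comment> \<open>Since the iterates commute, the difference of their squares factors as for
      numbers. The increments then obey the recursion of the scalar increments.\<close>
    also have "?Y (Suc n) (?Y (Suc n) u) - ?Y n (?Y n u) = ?Y (Suc n) ?d + ?Y n ?d"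
      using comm[of "Suc n" n u] by (simp add: linear_diff[OF lin] del: sqrt_iter.simps)
    finally have "norm (?Y (Suc (Suc n)) u - ?Y (Suc n) u) \<le> (norm (?Y (Suc n) ?d) + norm (?Y n ?d)) / 2"
      using norm_triangle_ineq[of "?Y (Suc n) ?d" "?Y n ?d"] by simp
    also have "\<dots> \<le> (?y (Suc n) * norm ?d + ?y n * norm ?d) / 2"
      using bound[of "Suc n" ?d] bound[of n ?d] by simp
    also have "\<dots> = (?y (Suc n) + ?y n) / 2 * norm ?d" by (simp add: algebra_simps)
    also have "\<dots> \<le> (?y (Suc n) + ?y n) / 2 * ((?y (Suc n) - ?y n) * norm u)"
      using sqrt_iter_bound(1)[of n] sqrt_iter_bound(1)[of "Suc n"] Suc
      by (intro mult_left_mono) auto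
    also have "\<dots> = (?y (Suc (Suc n)) - ?y (Suc n)) * norm u"
      by (simp only: sqrt_iter_bound.simps(2)[of "Suc n"] sqrt_iter_bound.simps(2)[of n])
        (simp add: field_simps power2_eq_square)
    finally show ?case .
  qed
  have diff: "norm (?Y (m + d) u - ?Y m u) \<le> (?y (m + d) - ?y m) * norm u" for m d u
  proof (induction d)
    case (Suc d)
    have "norm (?Y (m + Suc d) u - ?Y m u) \<le>
        norm (?Y (Suc (m + d)) u - ?Y (m + d) u) + norm (?Y (m + d) u - ?Y m u)"
      by (rule order_trans[OF _ norm_triangle_ineq]) (simp del: sqrt_iter.simps)
    also have "\<dots> \<le> (?y (Suc (m + d)) - ?y (m + d)) * norm u + (?y (m + d) - ?y m) * norm u"
      by (intro add_mono step Suc)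
    finally show ?case by (simp add: algebra_simps del: sqrt_iter.simps sqrt_iter_bound.simps)
  qed simp
  obtain l where l: "?y \<longlonglongrightarrow> l" "\<And>n. ?y n \<le> l"
    using incseq_convergent[OF incseq_sqrt_iter_bound, of 1] sqrt_iter_bound(2) by blast
  have l1: "l \<le> 1" using LIMSEQ_le_const2[OF l(1)] sqrt_iter_bound(2) by blast
  have "\<exists>z. (\<lambda>n. ?Y n u) \<longlonglongrightarrow> z" for u
  proof (rule convergent_eq_Cauchy[THEN iffD2], rule metric_CauchyI)
    fix e :: real assume "e > 0"
    have "(\<lambda>n. (l - ?y n) * norm u) \<longlonglongrightarrow> (l - l) * norm u" by (intro tendsto_intros l)
    then have "eventually (\<lambda>n. (l - ?y n) * norm u < e / 2) sequentially"
      using \<open>e > 0\<close> by (intro order_tendstoD(2)) auto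
    then obtain M where M: "(l - ?y M) * norm u < e / 2" by (auto simp: eventually_sequentially)
    have near: "dist (?Y n u) (?Y M u) < e / 2" if "n \<ge> M" for n
    proof -
      have "dist (?Y n u) (?Y M u) \<le> (?y n - ?y M) * norm u"
        using diff[of M "n - M" u] that by (simp add: dist_norm)
      also have "\<dots> \<le> (l - ?y M) * norm u" using l(2)[of n] by (intro mult_right_mono) auto
      finally show ?thesis using M by simp
    qed
    show "\<exists>M. \<forall>m\<ge>M. \<forall>n\<ge>M. dist (?Y m u) (?Y n u) < e"
      using near dist_triangle_half_l by blast
  qed
  then obtain Z where Z: "\<And>u. (\<lambda>n. ?Y n u) \<longlonglongrightarrow> Z u" by metis
  have Z_diff: "norm (Z u - ?Y m u) \<le> (l - ?y m) * norm u" for u m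
  proof (rule tendsto_le[OF trivial_limit_sequentially])
    show "(\<lambda>n. norm (?Y (n + m) u - ?Y m u)) \<longlonglongrightarrow> norm (Z u - ?Y m u)"
      by (intro tendsto_intros LIMSEQ_ignore_initial_segment Z)
    show "(\<lambda>n. (?y (n + m) - ?y m) * norm u) \<longlonglongrightarrow> (l - ?y m) * norm u"
      by (intro tendsto_intros LIMSEQ_ignore_initial_segment l)
    show "eventually (\<lambda>n. norm (?Y (n + m) u - ?Y m u) \<le> (?y (n + m) - ?y m) * norm u) sequentially"
      using diff[of m] by (simp add: add.commute[of _ m])
  qed
  have Z_norm: "norm (Z u) \<le> norm u" for u
    using Z_diff[of u 0] mult_right_mono[OF l1, of "norm u"] by simp
  have Z_add: "Z (u + v) = Z u + Z v" for u v
    by (rule LIMSEQ_unique[OF Z]) (simp only: linear_add[OF lin], intro tendsto_add Z)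
  have Z_scale: "Z (c *\<^sub>C u) = c *\<^sub>C Z u" for c u
  proof (rule LIMSEQ_unique[OF Z])
    have "?Y n (c *\<^sub>C u) = c *\<^sub>C ?Y n u" for n
      using T(1) by (intro sqrt_iter_commute[symmetric] bounded_linear.linear bounded_linear_scaleC)
        (simp add: bounded_clinear_def)
    then show "(\<lambda>n. ?Y n (c *\<^sub>C u)) \<longlonglongrightarrow> c *\<^sub>C Z u"
      by (simp only:) (rule bounded_linear.tendsto[OF bounded_linear_scaleC Z])
  qed
  have Z: "bounded_clinear Z" "(\<lambda>n. ?Y n u) \<longlonglongrightarrow> Z u" for u
    by (rule bounded_clinearI[of _ 1]) (simp_all add: Z_add Z_scale Z_norm Z)
  have linZ: "linear Z" using Z(1) by (simp add: bounded_clinear_def bounded_linear.linear)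
  have ZZ: "(\<lambda>n. ?Y n (?Y n u)) \<longlonglongrightarrow> Z (Z u)" for u
  proof (rule LIM_zero_cancel, rule Lim_null_comparison, rule always_eventually, rule allI)
    fix n
    have "?Y n (?Y n u) - Z (Z u) = - (Z (Z u - ?Y n u)) - (Z (?Y n u) - ?Y n (?Y n u))"
      by (simp add: linear_diff[OF linZ])
    then have "norm (?Y n (?Y n u) - Z (Z u)) \<le> norm (Z (Z u - ?Y n u)) + norm (Z (?Y n u) - ?Y n (?Y n u))"
      by (metis norm_minus_cancel norm_triangle_ineq4)
    also have "\<dots> \<le> (l - ?y n) * norm u + (l - ?y n) * (1 * norm u)"
    proof (intro add_mono)
      show "norm (Z (Z u - ?Y n u)) \<le> (l - ?y n) * norm u"
        using Z_norm Z_diff order_trans by blast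
      have "norm (?Y n u) \<le> 1 * norm u"
        using bound[of n u] mult_right_mono[OF sqrt_iter_bound(2)[of n], of "norm u"] by simp
      then show "norm (Z (?Y n u) - ?Y n (?Y n u)) \<le> (l - ?y n) * (1 * norm u)"
        using Z_diff[of "?Y n u" n] l(2)[of n] mult_left_mono[of "norm (?Y n u)" "1 * norm u" "l - ?y n"]
        by simp
    qed
    finally show "norm (?Y n (?Y n u) - Z (Z u)) \<le> 2 * ((l - ?y n) * norm u)"
      by (simp only: mult_1_left mult_2)
  next
    have "(\<lambda>n. 2 * ((l - ?y n) * norm u)) \<longlonglongrightarrow> 2 * ((l - l) * norm u)" by (intro tendsto_intros l)
    then show "(\<lambda>n. 2 * ((l - ?y n) * norm u)) \<longlonglongrightarrow> 0" by simp
  qed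
  have fixpoint: "Z u = (1 / 2) *\<^sub>R (T u + Z (Z u))" for u
  proof (rule LIMSEQ_unique[OF LIMSEQ_Suc[OF Z(2)]])
    show "(\<lambda>n. ?Y (Suc n) u) \<longlonglongrightarrow> (1 / 2) *\<^sub>R (T u + Z (Z u))"
      unfolding sqrt_iter.simps by (intro tendsto_intros ZZ)
  qed
  define S where "S u = u - Z u" for u
  have "bounded_clinear S"
    unfolding S_def by (intro bounded_clinear_diff bounded_clinear_ident Z)
  moreover have "S (S u) = u - T u" for u
  proof -
    have "2 *\<^sub>R Z u = T u + Z (Z u)" by (subst fixpoint) simp
    then have "T u = Z u + Z u - Z (Z u)" by (simp add: scaleR_2)
    then show ?thesis by (simp add: S_def linear_diff[OF linZ])
  qed
  moreover have "inner (S u) v = inner u (S v)" for u v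
  proof -
    have "inner (?Y n u) v = inner u (?Y n v)" for n u v
      by (induction n arbitrary: u v) (simp_all add: inner_add_left inner_add_right sa)
    then have "(\<lambda>n. inner (?Y n u) v) \<longlonglongrightarrow> inner u (Z v)"
      by (simp only:) (intro tendsto_intros Z)
    moreover have "(\<lambda>n. inner (?Y n u) v) \<longlonglongrightarrow> inner (Z u) v" by (intro tendsto_intros Z)
    ultimately have "inner (Z u) v = inner u (Z v)" by (rule LIMSEQ_unique[symmetric])
    then show ?thesis by (simp add: S_def inner_diff_left inner_diff_right)
  qed
  moreover have "inner (S u) u \<ge> 0" for u
  proof -
    have "inner (Z u) u \<le> norm (Z u) * norm u" by (rule norm_cauchy_schwarz)
    also have "\<dots> \<le> norm u * norm u" by (intro mult_right_mono Z_norm) auto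
    finally show ?thesis
      by (simp add: S_def inner_diff_left power2_norm_eq_inner flip: power2_eq_square)
  qed
  ultimately show ?thesis by blast
qed

text \<open>The limit \<open>r\<close> of minimizing residuals \<open>e - S y\<close> is orthogonal to the range, hence in the
  kernel of \<open>S\<close>.\<close>

lemma dense_range_selfadjoint:
  fixes S :: "'a::{real_inner,complete_space} \<Rightarrow> 'a"
  assumes S: "bounded_linear S" and sa: "\<And>u v. inner (S u) v = inner u (S v)"
    and inj: "\<And>u. S u = 0 \<Longrightarrow> u = 0" and "\<epsilon> > 0"
  shows "\<exists>y. norm (e - S y) < \<epsilon>"
proof -
  interpret S: bounded_linear S by fact
  define \<delta> where "\<delta> = (INF y. norm (e - S y))"
  have bdd: "bdd_below (range (\<lambda>y. norm (e - S y)))" by (rule bdd_belowI[of _ 0]) auto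
  have lower: "\<delta> \<le> norm (e - S y)" for y unfolding \<delta>_def by (rule cINF_lower[OF bdd]) simp
  have \<delta>0: "\<delta> \<ge> 0" unfolding \<delta>_def by (rule cINF_greatest) auto
  have "\<exists>y. norm (e - S y) < \<delta> + inverse (real (Suc n))" for n
    using cINF_less_iff[OF _ bdd, of "\<delta> + inverse (real (Suc n))"] unfolding \<delta>_def[symmetric] by auto
  then obtain y where y: "\<And>n. norm (e - S (y n)) < \<delta> + inverse (real (Suc n))" by metis
  define r where "r n = e - S (y n)" for n
  have par: "(norm (r m - r n))\<^sup>2 \<le> 2 * (norm (r m))\<^sup>2 + 2 * (norm (r n))\<^sup>2 - 4 * \<delta>\<^sup>2" for m n
  proof -
    \<comment> \<open>The mean of two residuals is again a residual, hence of norm at least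
      \<delta>; the parallelogram law then forces the minimizing residuals to be Cauchy.\<close>
    have "r m + r n = 2 *\<^sub>R (e - S ((1/2) *\<^sub>R (y m + y n)))"
      by (simp add: r_def S.add S.scaleR scaleR_diff_right scaleR_2)
    then have "norm (r m + r n) \<ge> 2 * \<delta>" using lower by simp
    then have "(2 * \<delta>)\<^sup>2 \<le> (norm (r m + r n))\<^sup>2" using \<delta>0 by (intro power_mono) auto
    moreover have "(norm (r m - r n))\<^sup>2 = 2 * (norm (r m))\<^sup>2 + 2 * (norm (r n))\<^sup>2 - (norm (r m + r n))\<^sup>2"
      by (simp add: power2_norm_eq_inner inner_add_left inner_add_right inner_diff_left
          inner_diff_right)
    ultimately show ?thesis by (simp add: power_mult_distrib)
  qed
  have norm_r: "(\<lambda>n. norm (r n)) \<longlonglongrightarrow> \<delta>"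
  proof (rule tendsto_sandwich[where f = "\<lambda>_. \<delta>"])
    show "(\<lambda>n. \<delta> + inverse (real (Suc n))) \<longlonglongrightarrow> \<delta>" by (rule LIMSEQ_inverse_real_of_nat_add)
    show "\<forall>\<^sub>F n in sequentially. norm (r n) \<le> \<delta> + inverse (real (Suc n))"
      using y less_imp_le unfolding r_def by (intro always_eventually allI) blast
  qed (use lower in \<open>auto simp: r_def\<close>)
  have "\<exists>x. r \<longlonglongrightarrow> x"
  proof (rule convergent_eq_Cauchy[THEN iffD2], rule metric_CauchyI)
    fix t :: real assume t: "t > 0"
    have "(\<lambda>n. (norm (r n))\<^sup>2) \<longlonglongrightarrow> \<delta>\<^sup>2" by (intro tendsto_intros norm_r)
    then have "eventually (\<lambda>n. (norm (r n))\<^sup>2 < \<delta>\<^sup>2 + t\<^sup>2 / 4) sequentially"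
      using t by (intro order_tendstoD(2)) auto
    then obtain M where M: "\<And>n. n \<ge> M \<Longrightarrow> (norm (r n))\<^sup>2 < \<delta>\<^sup>2 + t\<^sup>2 / 4"
      by (auto simp: eventually_sequentially)
    have "dist (r m) (r n) < t" if "m \<ge> M" "n \<ge> M" for m n
    proof -
      have "(norm (r m - r n))\<^sup>2 < t\<^sup>2" using par[of m n] M[OF that(1)] M[OF that(2)] by simp
      then show ?thesis using t by (simp add: dist_norm power2_less_imp_less)
    qed
    then show "\<exists>M. \<forall>m\<ge>M. \<forall>n\<ge>M. dist (r m) (r n) < t" by blast
  qed
  then obtain x where x: "r \<longlonglongrightarrow> x" ..
  have norm_x: "norm x = \<delta>" by (rule LIMSEQ_unique[OF tendsto_norm[OF x] norm_r])
  have lower_x: "\<delta> \<le> norm (x - S v)" for v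
  proof (rule LIMSEQ_le_const)
    show "(\<lambda>n. norm (r n - S v)) \<longlonglongrightarrow> norm (x - S v)" by (intro tendsto_intros x)
    show "\<exists>N. \<forall>n\<ge>N. \<delta> \<le> norm (r n - S v)"
      using lower[of "y _ + v"] by (auto simp: r_def S.add diff_diff_eq)
  qed
  have "inner x (S v) = 0" for v
  proof (cases "S v = 0")
    case False
    \<comment> \<open>The multiple of \<open>S v\<close> closest to \<open>x\<close>.\<close>
    define t where "t = inner x (S v) / (norm (S v))\<^sup>2"
    have "\<delta>\<^sup>2 \<le> (norm (x - S (t *\<^sub>R v)))\<^sup>2" using lower_x \<delta>0 by (intro power_mono) auto
    also have "\<dots> = \<delta>\<^sup>2 - 2 * t * inner x (S v) + t\<^sup>2 * (norm (S v))\<^sup>2"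
      unfolding norm_x[symmetric] power2_norm_eq_inner
      by (simp add: S.scaleR inner_diff_left inner_diff_right inner_commute[of "S v" x] power2_eq_square
          right_diff_distrib)
    also have "t\<^sup>2 * (norm (S v))\<^sup>2 = t * inner x (S v)" using False by (simp add: t_def power2_eq_square)
    finally have "t * inner x (S v) \<le> 0" by simp
    then have "(inner x (S v))\<^sup>2 \<le> 0" using False
      by (simp add: t_def divide_le_0_iff power2_eq_square flip: power2_norm_eq_inner)
        (metis False mult_le_0_iff norm_le_zero_iff zero_le_square order_trans)
    then show ?thesis by simp
  qed simp
  then have "inner (S x) (S x) = 0" by (simp add: sa)
  then have "x = 0" using inj by simp
  then have "\<delta> = 0" using norm_x by simp
  moreover obtain n where "inverse (real (Suc n)) < \<epsilon>" using reals_Archimedean[OF \<open>\<epsilon> > 0\<close>] by blast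
  ultimately show ?thesis using y[of n] by (intro exI[of _ "y n"]) simp
qed

section \<open>The law of inertia for a multiplier between two copies of a self-adjoint
  operator\<close>

definition orthonormal :: "'a::complex_hilbert set \<Rightarrow> bool" where
  "orthonormal B \<longleftrightarrow> finite B \<and> (\<forall>u\<in>B. \<forall>v\<in>B. cinner u v = of_bool (u = v))"

lemma orthonormal_coord:
  assumes "orthonormal B" "C \<subseteq> B" "v \<in> B"
  shows "cinner (\<Sum>b\<in>C. c b *\<^sub>C b) v = (if v \<in> C then c v else 0)"
proof -
  have "cinner (\<Sum>b\<in>C. c b *\<^sub>C b) v = (\<Sum>b\<in>C. if b = v then c v else 0)"
    unfolding cinner_sum_left
    by (rule sum.cong) (use assms in \<open>auto simp: orthonormal_def cinner_scaleC_left\<close>)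
  also have "\<dots> = (if v \<in> C then c v else 0)"
    using assms finite_subset[OF assms(2)] by (simp add: orthonormal_def)
  finally show ?thesis .
qed

lemma inner_multiplier:
  assumes "\<And>i. \<bar>a i\<bar> \<le> B"
  shows "inner (wcomp (\<lambda>i. complex_of_real (a i)) id x) x = (\<Sum>\<^sub>\<infinity>i. a i * (cmod (Rep_ell2 x i))\<^sup>2)"
proof -
  have B: "\<And>i. cmod (complex_of_real (a i)) \<le> B" using assms by simp
  show ?thesis
    unfolding inner_ell2_eq Rep_wcomp[where c = "\<lambda>i. complex_of_real (a i)", OF inj_on_id B] id_apply
    by (simp only: mult.assoc complex_norm_square[symmetric] of_real_mult[symmetric] Re_complex_of_real)
qed

lemma inner_multiplier_nonneg:
  assumes "\<And>i. \<bar>a i\<bar> \<le> B" "\<And>i. a i \<ge> 0 \<or> Rep_ell2 x i = 0"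
  shows "inner (wcomp (\<lambda>i. complex_of_real (a i)) id x) x \<ge> 0"
  unfolding inner_multiplier[OF assms(1)]
  by (rule infsum_nonneg) (use assms(2) in \<open>metis mult_nonneg_nonneg norm_zero order_refl mult_zero_right power2_eq_square zero_le_power2\<close>)

text \<open>The finiteness of the set of negative weights takes the role of compactness: it makes
  \<open>K\<close> a finite-rank perturbation of a nonnegative operator, so that below 0 there is
  nothing but eigenvalues. Injectivity of the self-adjoint \<open>S\<close> provides dense range,
  which replaces the invertible change of variables in Sylvester's law.\<close>

locale sandwiched_multiplier =
  fixes S :: "'i ell2 \<Rightarrow> 'i ell2" and a :: "'i \<Rightarrow> real" and B :: real
  assumes S: "bounded_clinear S"
    and S_sa: "\<And>u v. inner (S u) v = inner u (S v)"
    and S_inj: "\<And>u. S u = 0 \<Longrightarrow> u = 0"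
    and a_bound: "\<And>i. \<bar>a i\<bar> \<le> B"
    and neg_finite: "finite {i. a i < 0}"
begin

definition A where "A = wcomp (\<lambda>i. complex_of_real (a i)) id"
definition K where "K u = S (A (S u))"
abbreviation "Neg \<equiv> {i. a i < 0}"

lemma B_nonneg: "B \<ge> 0" using a_bound[of undefined] by linarith

lemma A: "bounded_clinear A" "norm (A x) \<le> B * norm x" "cinner (A u) v = cinner u (A v)"
  "Rep_ell2 (A u) i = of_real (a i) * Rep_ell2 u i"
proof -
  have B: "\<And>i. cmod (complex_of_real (a i)) \<le> B" using a_bound by simp
  show "bounded_clinear A" "norm (A x) \<le> B * norm x" "Rep_ell2 (A u) i = of_real (a i) * Rep_ell2 u i"
    unfolding A_def using wcomp[where c = "\<lambda>i. complex_of_real (a i)", OF inj_on_id B] by auto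
  show "cinner (A u) v = cinner u (A v)"
    unfolding A_def
    using cinner_wcomp[where \<pi> = id and \<pi>' = id and c = "\<lambda>p. complex_of_real (a p)", OF _ _ B] by simp
qed

lemma S_csa: "cinner (S u) v = cinner u (S v)"
proof -
  have "S (\<i> *\<^sub>C v) = \<i> *\<^sub>C S v" using S by (simp add: bounded_clinear_def)
  then show ?thesis using S_sa by (simp add: cinner_def)
qed

lemma K: "bounded_clinear K" "cinner (K u) v = cinner u (K v)"
proof -
  show "bounded_clinear K"
    unfolding K_def by (intro bounded_clinear_compose[OF S] bounded_clinear_compose[OF A(1)] S)
  show "cinner (K u) v = cinner u (K v)" by (simp add: K_def S_csa A(3))
qed

lemma K_linear: "linear K" "K (c *\<^sub>C u) = c *\<^sub>C K u" "bounded_linear K"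
  using K(1) by (auto simp: bounded_clinear_def bounded_linear.linear)

lemma inner_K: "inner (K u) v = inner (A (S u)) (S v)"
  by (simp add: K_def S_sa)

lemma inner_K_sa: "inner (K u) v = inner u (K v)"
  using K(2) by (metis Re_cinner)

definition negative_system :: "'i ell2 set \<Rightarrow> bool" where
  "negative_system E \<longleftrightarrow> orthonormal E \<and> (\<forall>u\<in>E. \<exists>\<mu><0. K u = complex_of_real \<mu> *\<^sub>C u)"

text \<open>With more vectors than negative weights, some nontrivial combination \<open>w\<close>
  has \<open>S w\<close> vanishing on \<open>Neg\<close>. The form of \<open>K\<close> at
  \<open>w\<close> would be nonnegative by its diagonal structure and negative by the
  eigenvalues.\<close>

lemma card_negative_system_le:
  assumes "negative_system E"
  shows "card E \<le> card Neg"
proof (rule ccontr)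
  assume "\<not> card E \<le> card Neg"
  moreover have fin: "finite E" using assms by (simp add: negative_system_def orthonormal_def)
  ultimately obtain c where c: "\<exists>u\<in>E. c u \<noteq> 0"
    "\<And>i. i \<in> Neg \<Longrightarrow> (\<Sum>u\<in>E. c u * Rep_ell2 (S u) i) = 0"
    using homogeneous_system[OF neg_finite fin, of "\<lambda>u i. Rep_ell2 (S u) i"] by auto
  obtain \<mu> where \<mu>: "\<And>u. u \<in> E \<Longrightarrow> \<mu> u < 0 \<and> K u = complex_of_real (\<mu> u) *\<^sub>C u"
    using assms unfolding negative_system_def by metis
  define w where "w = (\<Sum>u\<in>E. c u *\<^sub>C u)"
  have "S w = (\<Sum>u\<in>E. c u *\<^sub>C S u)"
    using S by (simp add: w_def bounded_clinear_def bounded_linear.linear linear_sum)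
  then have "Rep_ell2 (S w) i = 0" if "i \<in> Neg" for i
    using c(2)[OF that] by (simp add: Rep_ell2_sum scaleC_ell2.rep_eq)
  then have "inner (K w) w \<ge> 0"
    unfolding inner_K A_def
    by (intro inner_multiplier_nonneg[OF a_bound]) (metis mem_Collect_eq not_le)
  moreover have "inner (K w) w < 0"
  proof -
    obtain u where u: "u \<in> E" "c u \<noteq> 0" using c(1) by blast
    have on: "orthonormal E" using assms by (simp add: negative_system_def)
    have "K w = (\<Sum>u\<in>E. (c u * of_real (\<mu> u)) *\<^sub>C u)"
      unfolding w_def using \<mu> by (simp add: linear_sum K_linear scaleC_scaleC)
    then have "cinner (K w) u = c u * of_real (\<mu> u)" if "u \<in> E" for u
      using orthonormal_coord[OF on _ that] that by simp
    then have "cinner (K w) w = (\<Sum>u\<in>E. cnj (c u) * (c u * of_real (\<mu> u)))"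
      by (subst (2) w_def) (simp add: cinner_sum_right cinner_scaleC_right)
    also have "\<dots> = of_real (\<Sum>u\<in>E. \<mu> u * (cmod (c u))\<^sup>2)"
      unfolding of_real_sum of_real_mult complex_norm_square by (rule sum.cong) (simp_all add: mult_ac)
    finally have "inner (K w) w = (\<Sum>u\<in>E. \<mu> u * (cmod (c u))\<^sup>2)"
      by (metis Re_cinner Re_complex_of_real)
    also have "(\<Sum>u\<in>E. \<mu> u * (cmod (c u))\<^sup>2) < (\<Sum>u\<in>E. 0)"
    proof (rule sum_strict_mono_ex1[OF fin])
      show "\<forall>u\<in>E. \<mu> u * (cmod (c u))\<^sup>2 \<le> 0"
        using \<mu> by (auto intro!: mult_nonpos_nonneg dest!: less_imp_le)
      show "\<exists>u\<in>E. \<mu> u * (cmod (c u))\<^sup>2 < 0"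
        using \<mu> u by (intro bexI[of _ u]) (auto intro!: mult_neg_pos)
    qed
    finally show ?thesis by simp
  qed
  ultimately show False by simp
qed

lemma maximal_negative_system:
  obtains E where "negative_system E" "\<And>E'. negative_system E' \<Longrightarrow> card E' \<le> card E"
proof -
  have "negative_system {}" by (simp add: negative_system_def orthonormal_def)
  then show thesis
    using ex_has_greatest_nat[of negative_system "{}" card "Suc (card Neg)"] card_negative_system_le that
    by (metis less_Suc_eq_le)
qed

context
  fixes E
  assumes E: "negative_system E" and max: "\<And>E'. negative_system E' \<Longrightarrow> card E' \<le> card E"
begin

text \<open>Otherwise the normalized rest would be a further eigenvector orthogonal to
  \<open>E\<close>, contradicting maximality. Orthogonality to the members with other eigenvalues
  comes from self-adjointness of \<open>K\<close>.\<close>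

lemma eigenspace_expansion:
  assumes "\<mu> < 0" "K u = complex_of_real \<mu> *\<^sub>C u"
  shows "u = (\<Sum>v | v \<in> E \<and> K v = complex_of_real \<mu> *\<^sub>C v. cinner u v *\<^sub>C v)"
proof (rule ccontr)
  let ?E = "{v. v \<in> E \<and> K v = complex_of_real \<mu> *\<^sub>C v}"
  let ?P = "\<Sum>v\<in>?E. cinner u v *\<^sub>C v"
  assume ne: "u \<noteq> ?P"
  have on: "orthonormal E" using E by (simp add: negative_system_def)
  define d where "d = u - ?P"
  have d0: "norm d > 0" using ne by (simp add: d_def)
  have "K ?P = complex_of_real \<mu> *\<^sub>C ?P"
    by (simp add: linear_sum K_linear complex_vector.scale_sum_right scaleC_scaleC mult.commute)
  then have Kd: "K d = complex_of_real \<mu> *\<^sub>C d"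
    by (simp add: d_def linear_diff K_linear assms(2) complex_vector.scale_right_diff_distrib)
  have orth: "cinner d v = 0" if v: "v \<in> E" for v
  proof (cases "v \<in> ?E")
    case True
    then show ?thesis
      using orthonormal_coord[OF on _ v, of ?E "\<lambda>b. cinner u b"] by (auto simp: d_def cinner_diff_left)
  next
    case False
    obtain \<mu>' where \<mu>': "K v = complex_of_real \<mu>' *\<^sub>C v" using E v by (auto simp: negative_system_def)
    have "of_real \<mu> * cinner d v = of_real \<mu>' * cinner d v"
      using K(2)[of d v] by (simp add: Kd \<mu>' cinner_scaleC_left cinner_scaleC_right)
    moreover have "\<mu> \<noteq> \<mu>'" using False v \<mu>' by auto
    ultimately show ?thesis by simp
  qed
  define e where "e = complex_of_real (1 / norm d) *\<^sub>C d"
  have "cinner e e = 1"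
  proof -
    have "norm e = 1" unfolding e_def scaleR_scaleC[symmetric] using d0 by simp
    then show ?thesis by (simp add: cinner_self)
  qed
  moreover have "cinner e v = 0" "cinner v e = 0" if "v \<in> E" for v
    using orth[OF that] cinner_commute[of v d] by (simp_all add: e_def cinner_scaleC_left cinner_scaleC_right)
  moreover have "e \<notin> E" using calculation by auto
  moreover have "K e = complex_of_real \<mu> *\<^sub>C e"
    by (simp add: e_def K_linear Kd scaleC_scaleC mult.commute)
  ultimately have "negative_system (insert e E)" "card (insert e E) = Suc (card E)"
    using E assms(1) by (auto simp: negative_system_def orthonormal_def)
  then show False using max[of "insert e E"] by simp
qed

text \<open>If the infimum \<open>\<alpha>\<close> of the quadratic form of \<open>K\<close> on the unit sphere of the complement of \<open>E\<close>
  were negative, then \<open>K - \<alpha>\<close> would be boundedly invertible there, since it is a finite-rank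
  perturbation of a coercive operator and \<open>\<alpha>\<close> has no eigenvectors in the complement. By the
  Cauchy-Schwarz inequality for the form of \<open>K - \<alpha>\<close>, the infimum could be increased.\<close>

lemma nonneg_on_complement:
  assumes "\<And>v. v \<in> E \<Longrightarrow> cinner u v = 0"
  shows "inner (K u) u \<ge> 0"
proof (rule ccontr)
  assume neg: "\<not> inner (K u) u \<ge> 0"
  have on: "orthonormal E" using E by (simp add: negative_system_def)
  define W where "W = {u. \<forall>v\<in>E. cinner u v = 0}"
  have uW: "u \<in> W" using assms by (simp add: W_def)
  have W: "x - r *\<^sub>R y \<in> W" "c *\<^sub>C x \<in> W" "x - y \<in> W" if "x \<in> W" "y \<in> W" for x y c r
    using that by (simp_all add: W_def cinner_diff_left scaleR_scaleC cinner_scaleC_left)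
  have KW: "K x \<in> W" if "x \<in> W" for x
  proof -
    have "cinner (K x) v = 0" if v: "v \<in> E" for v
    proof -
      obtain \<mu> where "K v = complex_of_real \<mu> *\<^sub>C v" using E v by (auto simp: negative_system_def)
      then show ?thesis using \<open>x \<in> W\<close> v by (simp add: K(2) cinner_scaleC_right W_def)
    qed
    then show ?thesis by (simp add: W_def)
  qed
  obtain C where C: "C > 0" "\<And>x. norm (K x) \<le> norm x * C"
    using bounded_linear.pos_bounded[OF K_linear(3)] by blast
  define q where "q x = inner (K x) x" for x
  have q_scale: "q (complex_of_real r *\<^sub>C x) = r\<^sup>2 * q x" for r x
    by (simp add: q_def K_linear inner_scaleC_scaleC)
  let ?S = "q ` {x \<in> W. norm x = 1}"
  define \<alpha> where "\<alpha> = Inf ?S"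
  have "- C \<le> q x" if "norm x = 1" for x
    using C(2)[of x] Cauchy_Schwarz_ineq2[of "K x" x] that by (simp add: q_def abs_le_iff)
  then have bdd: "bdd_below ?S" by (intro bdd_belowI[of _ "- C"]) auto
  have lower: "\<alpha> \<le> q x" if "x \<in> W" "norm x = 1" for x
    unfolding \<alpha>_def using that by (intro cInf_lower[OF _ bdd]) auto
  define u1 where "u1 = complex_of_real (1 / norm u) *\<^sub>C u"
  have "u \<noteq> 0" using neg linear_0[OF K_linear(1)] by auto
  then have u1: "u1 \<in> W" "norm u1 = 1" "q u1 < 0"
  proof -
    show "u1 \<in> W" unfolding u1_def by (rule W(2)[OF uW uW])
    show "norm u1 = 1" unfolding u1_def scaleR_scaleC[symmetric] using \<open>u \<noteq> 0\<close> by simp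
    show "q u1 < 0"
      unfolding u1_def q_scale using \<open>u \<noteq> 0\<close> neg by (intro mult_pos_neg) (simp_all add: q_def)
  qed
  then have \<alpha>: "\<alpha> < 0" using lower[of u1] by simp
  have hom: "\<alpha> * (norm x)\<^sup>2 \<le> q x" if "x \<in> W" for x
  proof (cases "x = 0")
    case True
    then show ?thesis by (simp add: q_def)
  next
    case False
    then have "\<alpha> \<le> q (complex_of_real (1 / norm x) *\<^sub>C x)"
      by (intro lower W(2)[OF that that]) (unfold scaleR_scaleC[symmetric], simp)
    then show ?thesis using False unfolding q_scale by (simp add: power_divide pos_le_divide_eq)
  qed
  let ?E = "{v. v \<in> E \<and> K v = complex_of_real \<alpha> *\<^sub>C v}"
  \<comment> \<open>The projection onto the members of \<open>E\<close> with eigenvalue \<alpha>, if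
    there are any. Adding it makes \<open>K - \<alpha>\<close> injective on the whole space without
    changing it on \<open>W\<close>.\<close>
  define P where "P x = (\<Sum>v\<in>?E. cinner x v *\<^sub>C v)" for x
  have on': "orthonormal ?E" using on by (auto simp: orthonormal_def)
  \<comment> \<open>The positive part of the weight only adds to the coercivity
    \<open>- \<alpha>\<close> of \<open>G\<close>; the negative part has finite support and goes
    into the finite-rank term.\<close>
  define a1 where "a1 i = max (a i) 0" for i
  define a2 where "a2 i = max (- a i) 0" for i
  have a1: "\<bar>a1 i\<bar> \<le> B" and a2: "\<bar>a2 i\<bar> \<le> B" for i
    using a_bound[of i] by (auto simp: a1_def a2_def)
  define A1 where "A1 = wcomp (\<lambda>i. complex_of_real (a1 i)) id"
  define A2 where "A2 = wcomp (\<lambda>i. complex_of_real (a2 i)) id"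
  have cB: "cmod (complex_of_real (a1 i)) \<le> B" "cmod (complex_of_real (a2 i)) \<le> B" for i
    using a1[of i] a2[of i] by simp_all
  have A12: "A x = A1 x - A2 x" for x
  proof (rule Rep_ell2_inject[THEN iffD1], rule ext)
    fix i
    have "complex_of_real (a i) = of_real (a1 i) - of_real (a2 i)"
      by (simp add: a1_def a2_def max_def flip: of_real_diff)
    then show "Rep_ell2 (A x) i = Rep_ell2 (A1 x - A2 x) i"
      unfolding minus_ell2.rep_eq A(4) A1_def A2_def
        Rep_wcomp[where c = "\<lambda>i. complex_of_real (a1 i)", OF inj_on_id cB(1)]
        Rep_wcomp[where c = "\<lambda>i. complex_of_real (a2 i)", OF inj_on_id cB(2)]
      by (simp add: left_diff_distrib)
  qed
  have linS: "bounded_linear S" "linear S" using S by (auto simp: bounded_clinear_def bounded_linear.linear)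
  have "bounded_linear A1"
    using bounded_clinear_wcomp[where c = "\<lambda>i. complex_of_real (a1 i)", OF inj_on_id cB(1)]
    by (simp add: A1_def bounded_clinear_def)
  define G where "G x = S (A1 (S x)) - complex_of_real \<alpha> *\<^sub>C x" for x
  define F where "F x = S (A2 (S x)) + - P x" for x
  have "bounded_linear G"
    unfolding G_def
    by (rule bounded_linear_sub[OF bounded_linear_compose[OF linS(1)
            bounded_linear_compose[OF \<open>bounded_linear A1\<close> linS(1)]] bounded_linear_scaleC])
  moreover have "finite_rank F"
  proof -
    have "finite {i. complex_of_real (a2 i) \<noteq> 0}"
      by (rule finite_subset[OF _ neg_finite]) (auto simp: a2_def max_def split: if_splits)
    then have "finite_rank A2" unfolding A2_def by (intro finite_rank_wcomp) auto
    moreover have "finite_rank (\<lambda>x. P x)"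
      unfolding P_def using on'
      by (intro finite_rank_sum finite_rank_functional bounded_linear_cinner_left)
        (simp add: orthonormal_def)
    ultimately show ?thesis
      unfolding F_def by (intro finite_rank_add finite_rank_compose[OF linS(1) _ linS(1)] finite_rank_minus)
  qed
  moreover have "- \<alpha> * (norm x)\<^sup>2 \<le> inner (G x) x" for x
  proof -
    have "inner (S (A1 (S x))) x \<ge> 0"
      unfolding S_sa A1_def by (rule inner_multiplier_nonneg[OF a1]) (simp add: a1_def)
    then show ?thesis by (simp add: G_def inner_diff_left inner_scaleC_self)
  qed
  moreover have GF: "G x - F x = K x - complex_of_real \<alpha> *\<^sub>C x + P x" for x
    by (simp add: G_def F_def K_def A12 linear_diff[OF linS(2)])
  moreover have "x = 0" if "G x = F x" for x
  proof -
    have eq: "K x - complex_of_real \<alpha> *\<^sub>C x + P x = 0" using GF[of x] that by simp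
    have "cinner x v = 0" if v: "v \<in> ?E" for v
    proof -
      have "cinner (K x - complex_of_real \<alpha> *\<^sub>C x + P x) v = cinner (P x) v"
        using v by (simp add: cinner_add_left cinner_diff_left K(2) cinner_scaleC_right cinner_scaleC_left)
      also have "\<dots> = cinner x v"
        unfolding P_def using orthonormal_coord[OF on', of ?E v] v by simp
      finally show ?thesis by (simp add: eq)
    qed
    then have "P x = 0" by (simp add: P_def)
    then have "K x = complex_of_real \<alpha> *\<^sub>C x" using eq by simp
    from eigenspace_expansion[OF \<alpha> this] \<open>P x = 0\<close> show "x = 0" by (simp add: P_def)
  qed
  ultimately obtain R where R: "bounded_linear R" "\<And>x. R (G x - F x) = x"
    using fredholm_finite_rank[of G "- \<alpha>" F] \<alpha> by auto
  obtain C1 where C1: "C1 > 0" "\<And>x. norm (R x) \<le> norm x * C1"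
    using bounded_linear.pos_bounded[OF R(1)] by blast
  define M where "M x = K x - complex_of_real \<alpha> *\<^sub>C x" for x
  have M_inv: "norm x \<le> norm (M x) * C1" if "x \<in> W" for x
  proof -
    have "P x = 0" using that by (simp add: P_def W_def)
    then have "R (M x) = x" using R(2)[of x] by (simp add: GF M_def)
    then show ?thesis using C1(2)[of "M x"] by simp
  qed
  define C2 where "C2 = C + \<bar>\<alpha>\<bar>"
  have C2: "C2 > 0" using C(1) by (simp add: C2_def)
  have M_norm: "norm (M x) \<le> norm x * C2" for x
    using norm_triangle_ineq4[of "K x" "complex_of_real \<alpha> *\<^sub>C x"] C(2)[of x]
    by (simp add: M_def C2_def norm_scaleC algebra_simps)
  have M_sa: "inner (M x) y = inner x (M y)" for x y
    by (simp add: M_def inner_diff_left inner_diff_right inner_K_sa flip: scaleR_scaleC)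
  have M_pos: "inner (M x) x \<ge> 0" if "x \<in> W" for x
    using hom[OF that] by (simp add: M_def inner_diff_left inner_scaleC_self q_def)
  have M_W: "M x \<in> W" if "x \<in> W" for x
    unfolding M_def using W(2)[OF that that] KW[OF that] W(3) by blast
  have M_lin: "M (x - r *\<^sub>R y) = M x - r *\<^sub>R M y" for x y r
    by (simp add: M_def linear_diff K_linear linear_scale scaleR_scaleC scaleC_scaleC mult.commute
        complex_vector.scale_right_diff_distrib algebra_simps)
  have cs: "(norm (M x))\<^sup>2 \<le> C2 * inner (M x) x" if x: "x \<in> W" for x
  proof -
    \<comment> \<open>Nonnegativity of the form at \<open>x - t *\<^sub>R M x\<close> yields the
      lower bound \<open>(2 * t - t\<^sup>2 * C2) * (norm (M x))\<^sup>2\<close> for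
      \<open>inner (M x) x\<close>, and this \<open>t\<close> maximizes it.\<close>
    define t where "t = 1 / C2"
    have t: "t > 0" "t * C2 = 1" using C2 by (simp_all add: t_def)
    have "0 \<le> inner (M (x - t *\<^sub>R M x)) (x - t *\<^sub>R M x)"
      by (intro M_pos W(1) x M_W)
    also have "\<dots> = inner (M x) x - 2 * t * (norm (M x))\<^sup>2 + t\<^sup>2 * inner (M (M x)) (M x)"
      unfolding M_lin power2_norm_eq_inner
      by (simp add: inner_diff_left inner_diff_right M_sa[of "M x" x] power2_eq_square right_diff_distrib)
    also have "inner (M (M x)) (M x) \<le> C2 * (norm (M x))\<^sup>2"
      using norm_cauchy_schwarz[of "M (M x)" "M x"] mult_right_mono[OF M_norm[of "M x"], of "norm (M x)"]
      by (simp add: power2_eq_square mult_ac)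
    then have "t\<^sup>2 * inner (M (M x)) (M x) \<le> t\<^sup>2 * (C2 * (norm (M x))\<^sup>2)" by (intro mult_left_mono) auto
    also have "t\<^sup>2 * (C2 * (norm (M x))\<^sup>2) = t * (t * C2) * (norm (M x))\<^sup>2"
      by (simp add: power2_eq_square mult_ac)
    finally have "t * (norm (M x))\<^sup>2 \<le> inner (M x) x" by (simp add: t(2))
    then have "C2 * (t * (norm (M x))\<^sup>2) \<le> C2 * inner (M x) x" using C2 by (intro mult_left_mono) auto
    then show ?thesis using t(2) by (simp add: mult.assoc[symmetric] mult.commute[of C2])
  qed
  \<comment> \<open>For unit vectors in \<open>W\<close>, \<open>M_inv\<close> and \<open>cs\<close>
    combine to \<open>1 \<le> C1\<^sup>2 * C2 * inner (M x) x\<close>.\<close>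
  define \<delta> where "\<delta> = 1 / (C1\<^sup>2 * C2)"
  have "\<delta> > 0" using C1(1) C2 by (simp add: \<delta>_def)
  have "\<alpha> + \<delta> \<le> q x" if x: "x \<in> W" "norm x = 1" for x
  proof -
    have "1 \<le> (norm (M x) * C1)\<^sup>2" using M_inv[OF x(1)] x(2) by (simp add: one_le_power)
    also have "\<dots> = C1\<^sup>2 * (norm (M x))\<^sup>2" by (simp add: power_mult_distrib)
    also have "\<dots> \<le> C1\<^sup>2 * (C2 * inner (M x) x)" by (intro mult_left_mono cs x) auto
    finally have "\<delta> \<le> inner (M x) x"
      using C1(1) C2 by (simp add: \<delta>_def pos_divide_le_eq mult_ac)
    then show ?thesis by (simp add: M_def inner_diff_left inner_scaleC_self x(2) q_def)
  qed
  then have "\<alpha> + \<delta> \<le> Inf ?S" using u1 by (intro cInf_greatest) auto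
  then have "\<alpha> + \<delta> \<le> \<alpha>" by (simp only: \<alpha>_def[symmetric])
  then show False using \<open>\<delta> > 0\<close> by simp
qed

text \<open>The unit vectors at the negative weights are approximated by vectors
  \<open>S (y i)\<close>. If \<open>E\<close> had fewer elements than \<open>Neg\<close>, some
  combination of the \<open>y i\<close> would be orthogonal to \<open>E\<close>, although the form
  of \<open>K\<close> is still negative there; this contradicts
  \<open>nonneg_on_complement\<close>.\<close>

lemma card_maximal_negative_system: "card E = card Neg"
proof (rule antisym[OF card_negative_system_le[OF E]], rule ccontr)
  assume "\<not> card Neg \<le> card E"
  then have less: "card E < card Neg" by simp
  then have Neg: "Neg \<noteq> {}" "finite Neg" using neg_finite by (metis card.empty not_less_zero, blast)
  have finE: "finite E" using E by (simp add: negative_system_def orthonormal_def)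
  define \<eta> where "\<eta> = Min ((\<lambda>i. - a i) ` Neg)"
  have \<eta>: "\<eta> > 0" "\<And>i. i \<in> Neg \<Longrightarrow> a i \<le> - \<eta>"
  proof -
    show "\<eta> > 0" unfolding \<eta>_def using Neg by (subst Min_gr_iff) auto
    show "a i \<le> - \<eta>" if "i \<in> Neg" for i
    proof -
      have "\<eta> \<le> - a i" unfolding \<eta>_def using Neg that by (intro Min_le) auto
      then show ?thesis by simp
    qed
  qed
  define N where "N = real (card Neg)"
  have N: "N > 0" using Neg by (simp add: N_def card_gt_0_iff)
  \<comment> \<open>The error \<open>r\<close> raises the form by at most \<open>3 * B * t\<close>
    times \<open>(norm x)\<^sup>2\<close>: two parts from the cross terms and one from the square,
    where \<open>t \<le> 1\<close> gives \<open>norm r \<le> norm x\<close>. The summand 1 keeps the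
    denominator positive when \<open>B = 0\<close>.\<close>
  define t where "t = min 1 (\<eta> / (3 * B + 1))"
  have t: "t > 0" "t \<le> 1" "3 * B * t < \<eta>"
  proof -
    show "t > 0" "t \<le> 1" using \<eta>(1) B_nonneg by (auto simp: t_def)
    have "3 * B * t \<le> 3 * B * (\<eta> / (3 * B + 1))"
      using B_nonneg by (intro mult_left_mono) (auto simp: t_def)
    also have "\<dots> < \<eta>" using \<eta>(1) B_nonneg by (simp add: field_simps)
    finally show "3 * B * t < \<eta>" .
  qed
  have linS: "bounded_linear S" "linear S" using S by (auto simp: bounded_clinear_def bounded_linear.linear)
  have "\<exists>y. norm (unit_ell2 i - S y) < t / N" for i :: 'i
    using dense_range_selfadjoint[OF linS(1) S_sa S_inj] t N by simp
  then obtain y where y: "\<And>i::'i. norm (unit_ell2 i - S (y i)) < t / N" by metis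
  obtain c where c: "\<exists>i\<in>Neg. c i \<noteq> 0" "\<And>v. v \<in> E \<Longrightarrow> (\<Sum>i\<in>Neg. c i * cinner (y i) v) = 0"
    using homogeneous_system[OF finE Neg(2) less, of "\<lambda>i v. cinner (y i) v"] by blast
  define u where "u = (\<Sum>i\<in>Neg. c i *\<^sub>C y i)"
  define x where "x = (\<Sum>i\<in>Neg. c i *\<^sub>C unit_ell2 i)"
  define r where "r = S u - x"
  have "cinner u v = 0" if "v \<in> E" for v
    using c(2)[OF that] by (simp add: u_def cinner_sum_left cinner_scaleC_left)
  then have pos: "inner (K u) u \<ge> 0" by (rule nonneg_on_complement)
  have Rep_x: "Rep_ell2 x i = (if i \<in> Neg then c i else 0)" for i
  proof -
    have "Rep_ell2 x i = (\<Sum>j\<in>Neg. if j = i then c i else 0)"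
      by (auto simp: x_def Rep_ell2_sum scaleC_ell2.rep_eq Rep_unit_ell2 intro!: sum.cong)
    then show ?thesis using Neg(2) by simp
  qed
  have c_le: "cmod (c i) \<le> norm x" if "i \<in> Neg" for i
    using norm_Rep_ell2_le[of x i] that by (simp add: Rep_x)
  then have x0: "norm x > 0" using c(1) by (metis norm_le_zero_iff not_le order_trans)
  have "r = (\<Sum>i\<in>Neg. c i *\<^sub>C (S (y i) - unit_ell2 i))"
    using S by (simp add: r_def u_def x_def linear_sum[OF linS(2)] bounded_clinear_def
        complex_vector.scale_right_diff_distrib sum_subtractf)
  then have "norm r \<le> (\<Sum>i\<in>Neg. cmod (c i) * norm (S (y i) - unit_ell2 i))"
    using norm_sum[of "\<lambda>i. c i *\<^sub>C (S (y i) - unit_ell2 i)" Neg] by (simp add: norm_scaleC)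
  also have "\<dots> \<le> (\<Sum>i\<in>Neg. norm x * (t / N))"
    using y by (intro sum_mono mult_mono c_le) (auto simp: norm_minus_commute less_imp_le)
  also have "\<dots> = t * norm x" using N by (simp add: N_def)
  finally have r: "norm r \<le> t * norm x" .
  have Ax: "inner (A x) x \<le> - \<eta> * (norm x)\<^sup>2"
  proof -
    have sm: "(\<lambda>i. (cmod (Rep_ell2 x i))\<^sup>2) summable_on UNIV" by (rule Rep_ell2_summable)
    have "inner (A x) x = (\<Sum>\<^sub>\<infinity>i. a i * (cmod (Rep_ell2 x i))\<^sup>2)"
      unfolding A_def by (rule inner_multiplier[OF a_bound])
    also have "\<dots> = (\<Sum>\<^sub>\<infinity>i\<in>Neg. a i * (cmod (Rep_ell2 x i))\<^sup>2)"
      by (rule infsum_cong_neutral) (auto simp: Rep_x)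
    also have "\<dots> = (\<Sum>i\<in>Neg. a i * (cmod (Rep_ell2 x i))\<^sup>2)" by (rule infsum_finite[OF Neg(2)])
    also have "\<dots> \<le> (\<Sum>i\<in>Neg. - \<eta> * (cmod (Rep_ell2 x i))\<^sup>2)"
      by (intro sum_mono mult_right_mono \<eta>) auto
    also have "\<dots> = - \<eta> * (\<Sum>i\<in>Neg. (cmod (Rep_ell2 x i))\<^sup>2)" by (simp add: sum_distrib_left)
    also have "(\<Sum>i\<in>Neg. (cmod (Rep_ell2 x i))\<^sup>2) = (\<Sum>\<^sub>\<infinity>i\<in>Neg. (cmod (Rep_ell2 x i))\<^sup>2)"
      by (rule infsum_finite[OF Neg(2), symmetric])
    also have "\<dots> = (\<Sum>\<^sub>\<infinity>i. (cmod (Rep_ell2 x i))\<^sup>2)"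
      by (rule infsum_cong_neutral) (auto simp: Rep_x)
    also have "\<dots> = (norm x)\<^sup>2" by (simp add: norm_ell2_def infsum_nonneg)
    finally show ?thesis .
  qed
  have linA: "linear A" using A(1) by (simp add: bounded_clinear_def bounded_linear.linear)
  have "inner (K u) u = inner (A (x + r)) (x + r)" by (simp add: inner_K r_def)
  also have "\<dots> = inner (A x) x + 2 * inner (A x) r + inner (A r) r"
  proof -
    have "inner (A r) x = inner (A x) r"
      using A(3)[of r x] by (metis Re_cinner inner_commute)
    then show ?thesis by (simp add: linear_add[OF linA] inner_add_left inner_add_right)
  qed
  also have "\<dots> \<le> - \<eta> * (norm x)\<^sup>2 + 2 * (B * norm x * (t * norm x)) + B * (norm x * (t * norm x))"
  proof (intro add_mono Ax)
    have "inner (A x) r \<le> norm (A x) * norm r" by (rule norm_cauchy_schwarz)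
    also have "\<dots> \<le> B * norm x * (t * norm x)"
      using A(2) r B_nonneg by (intro mult_mono) auto
    finally show "2 * inner (A x) r \<le> 2 * (B * norm x * (t * norm x))" by simp
    have "norm r \<le> norm x" using r t mult_right_mono[of t 1 "norm x"] by simp
    have "inner (A r) r \<le> norm (A r) * norm r" by (rule norm_cauchy_schwarz)
    also have "\<dots> \<le> B * norm r * norm r" by (intro mult_right_mono A) auto
    also have "\<dots> \<le> B * (norm x * (t * norm x))"
      using \<open>norm r \<le> norm x\<close> r B_nonneg by (simp add: mult.assoc mult_left_mono mult_mono)
    finally show "inner (A r) r \<le> B * (norm x * (t * norm x))" .
  qed
  also have "\<dots> = (3 * B * t - \<eta>) * (norm x)\<^sup>2" by (simp add: power2_eq_square algebra_simps)
  also have "\<dots> < 0" using t(3) x0 by (intro mult_neg_pos) auto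
  finally show False using pos by simp
qed

end

end

section \<open>The reduced operators\<close>

lemma l2_iff: "u \<in> l2 \<longleftrightarrow> (\<lambda>m. (cmod (u m))\<^sup>2) summable_on UNIV"
  by (simp add: l2_def)

lemma Rep_ell2_l2 [simp]: "Rep_ell2 u \<in> l2"
  by (simp add: l2_iff Rep_ell2_summable)

lemma Rep_Abs_l2: "u \<in> l2 \<Longrightarrow> Rep_ell2 (Abs_ell2 u) = u"
  by (simp add: l2_iff Abs_ell2_inverse)

lemma l2_norm_Rep: "l2_norm (Rep_ell2 u) = norm u"
  by (simp add: l2_norm_def norm_ell2_def)

lemma l2_inner_Rep: "l2_inner (Rep_ell2 u) (Rep_ell2 v) = cinner u v"
  by (simp add: l2_inner_def cinner_ell2)

lemma Rep_ell2_add: "Rep_ell2 (u + v) = Rep_ell2 u + Rep_ell2 v"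
  by (simp add: plus_ell2.rep_eq fun_eq_iff)

lemma Rep_ell2_scaleC: "Rep_ell2 (c *\<^sub>C u) = c *\<^sub>C Rep_ell2 u"
  by (simp add: scaleC_ell2.rep_eq fun_eq_iff scaleC_fun_apply)

lemma positive_selfadjoint_Rep:
  assumes "bounded_clinear S" "\<And>u v. inner (S u) v = inner u (S v)" "\<And>u. inner (S u) u \<ge> 0"
  shows "positive_selfadjoint (\<lambda>u. Rep_ell2 (S (Abs_ell2 u)))"
proof -
  have lin: "S (u + v) = S u + S v" "S (c *\<^sub>C u) = c *\<^sub>C S u" for u v c
    using assms(1) by (auto simp: bounded_clinear_def linear_add bounded_linear.linear)
  have csa: "cinner (S u) v = cinner u (S v)" for u v
    using assms(2) by (simp add: cinner_def flip: lin)
  obtain M where M: "\<And>u. norm (S u) \<le> norm u * M"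
    using assms(1) bounded_linear.bounded unfolding bounded_clinear_def by blast
  have ex: "\<exists>u'. u = Rep_ell2 u'" if "u \<in> l2" for u using Rep_Abs_l2[OF that] by metis
  have abs: "Abs_ell2 (Rep_ell2 u + Rep_ell2 v) = u + v" "Abs_ell2 (c *\<^sub>C Rep_ell2 u) = c *\<^sub>C u"
    for u v :: "int ell2" and c
    by (simp_all only: Rep_ell2_add[symmetric] Rep_ell2_scaleC[symmetric] Rep_ell2_inverse)
  show ?thesis
    unfolding positive_selfadjoint_def bounded_linear_between_def
  proof (intro conjI ballI allI exI[of _ M])
    fix u v :: "int \<Rightarrow> complex" and c assume "u \<in> l2"
    then obtain u' where u: "u = Rep_ell2 u'" using ex by blast
    show "Rep_ell2 (S (Abs_ell2 u)) \<in> l2" by simp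
    show "Rep_ell2 (S (Abs_ell2 (c *\<^sub>C u))) = c *\<^sub>C Rep_ell2 (S (Abs_ell2 u))"
      by (simp add: u abs lin Rep_ell2_scaleC Rep_ell2_inverse)
    show "l2_norm (Rep_ell2 (S (Abs_ell2 u))) \<le> M * l2_norm u"
      using M[of u'] by (simp add: u l2_norm_Rep Rep_ell2_inverse mult.commute)
    show "0 \<le> Re (l2_inner (Rep_ell2 (S (Abs_ell2 u))) u)"
      using assms(3)[of u'] by (simp add: u l2_inner_Rep Rep_ell2_inverse Re_cinner)
    assume "v \<in> l2"
    then obtain v' where v: "v = Rep_ell2 v'" using ex by blast
    show "Rep_ell2 (S (Abs_ell2 (u + v))) = Rep_ell2 (S (Abs_ell2 u)) + Rep_ell2 (S (Abs_ell2 v))"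
      by (simp add: u v abs lin Rep_ell2_add Rep_ell2_inverse)
    show "l2_inner (Rep_ell2 (S (Abs_ell2 u))) v = l2_inner u (Rep_ell2 (S (Abs_ell2 v)))"
      by (simp add: u v l2_inner_Rep Rep_ell2_inverse csa)
  qed
qed

text \<open>The square root is chosen among functions on families that are controlled only on
  \<open>l2\<close>; this turns whichever one is chosen into an operator on
  \<open>ell2\<close>.\<close>

lemma positive_selfadjoint_Abs:
  assumes "positive_selfadjoint \<sigma>"
  defines "S \<equiv> \<lambda>u. Abs_ell2 (\<sigma> (Rep_ell2 u))"
  shows "Rep_ell2 (S u) = \<sigma> (Rep_ell2 u)" "bounded_clinear S" "inner (S u) v = inner u (S v)"
proof -
  note * = assms(1)[unfolded positive_selfadjoint_def bounded_linear_between_def]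
  have R: "Rep_ell2 (S u) = \<sigma> (Rep_ell2 u)" for u
    unfolding S_def using * by (intro Rep_Abs_l2) simp
  then show "Rep_ell2 (S u) = \<sigma> (Rep_ell2 u)" .
  obtain M where M: "\<And>u. u \<in> l2 \<Longrightarrow> l2_norm (\<sigma> u) \<le> M * l2_norm u" using * by blast
  show "bounded_clinear S"
  proof (rule bounded_clinearI)
    show "S (x + y) = S x + S y" for x y
      using * by (intro Rep_ell2_inject[THEN iffD1]) (simp add: R Rep_ell2_add)
    show "S (c *\<^sub>C x) = c *\<^sub>C S x" for c x
      using * by (intro Rep_ell2_inject[THEN iffD1]) (simp add: R Rep_ell2_scaleC)
    show "norm (S x) \<le> M * norm x" for x
      using M[of "Rep_ell2 x"] by (simp add: l2_norm_Rep flip: R)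
  qed
  have "cinner (S u) v = cinner u (S v)"
    unfolding l2_inner_Rep[symmetric] R using * by simp
  then show "inner (S u) v = inner u (S v)" by (metis Re_cinner)
qed

section \<open>The operator D and its positive square root\<close>

definition cosine :: "int \<Rightarrow> int ell2 \<Rightarrow> int ell2" where
  "cosine k u = (1 / 2) *\<^sub>C (wcomp (\<lambda>_. 1) (\<lambda>m. m - k) u + wcomp (\<lambda>_. 1) (\<lambda>m. m + k) u)"

lemma cosine:
  shows Rep_cosine: "Rep_ell2 (cosine k u) = cos_mult1 k (Rep_ell2 u)"
    and bounded_clinear_cosine: "bounded_clinear (cosine k)"
    and norm_cosine_le: "norm (cosine k u) \<le> norm u"
    and cinner_cosine: "cinner (cosine k u) v = cinner u (cosine k v)"
proof -
  have inj: "inj (\<lambda>m::int. m - k)" "inj (\<lambda>m::int. m + k)" by (auto simp: inj_def)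
  have 1: "\<And>i::int. cmod 1 \<le> 1" by simp
  note w = wcomp[where c = "\<lambda>_. 1", OF inj(1) 1] wcomp[where c = "\<lambda>_. 1", OF inj(2) 1]
  show "Rep_ell2 (cosine k u) = cos_mult1 k (Rep_ell2 u)"
    by (rule ext) (simp add: cosine_def scaleC_ell2.rep_eq plus_ell2.rep_eq w(1,4) cos_mult1_eq)
  show "bounded_clinear (cosine k)"
    unfolding cosine_def
    by (rule bounded_clinear_compose[OF bounded_clinear_scaleC bounded_clinear_add[OF w(3,6)]])
  show "norm (cosine k u) \<le> norm u"
    using norm_triangle_ineq[of "wcomp (\<lambda>_. 1) (\<lambda>m. m - k) u" "wcomp (\<lambda>_. 1) (\<lambda>m. m + k) u"] w(2,5)[of u]
    by (simp add: cosine_def norm_scaleC)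
  have "cinner (wcomp (\<lambda>_. 1) (\<lambda>m. m - k) u) v = cinner u (wcomp (\<lambda>_. 1) (\<lambda>m. m + k) v)"
    "cinner (wcomp (\<lambda>_. 1) (\<lambda>m. m + k) u) v = cinner u (wcomp (\<lambda>_. 1) (\<lambda>m. m - k) v)"
    using cinner_wcomp[where c = "\<lambda>_. 1" and \<pi> = "\<lambda>m::int. m - k" and \<pi>' = "\<lambda>m. m + k", OF _ _ 1]
      cinner_wcomp[where c = "\<lambda>_. 1" and \<pi> = "\<lambda>m::int. m + k" and \<pi>' = "\<lambda>m. m - k", OF _ _ 1] by simp_all
  then show "cinner (cosine k u) v = cinner u (cosine k v)"
    by (simp add: cosine_def cinner_scaleC_left cinner_scaleC_right cinner_add_left cinner_add_right)
qed

text \<open>A function in the kernel has \<open>2k\<close>-periodic modulus.\<close>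

lemma cosine_inj:
  assumes "k \<noteq> 0" "cosine k u = 0"
  shows "u = 0"
proof (rule ccontr)
  assume "u \<noteq> 0"
  then obtain m where m: "Rep_ell2 u m \<noteq> 0"
    by (auto simp: Rep_ell2_inject[symmetric] zero_ell2.rep_eq fun_eq_iff)
  have "Rep_ell2 u (j + 2 * k) = - Rep_ell2 u j" for j
  proof -
    have "cos_mult1 k (Rep_ell2 u) (j + k) = 0"
      using assms(2) Rep_cosine[of k u] by (metis zero_ell2.rep_eq)
    moreover have "j + k - k = j" "j + k + k = j + 2 * k" by simp_all
    ultimately have "Rep_ell2 u j + Rep_ell2 u (j + 2 * k) = 0" unfolding cos_mult1_eq by simp
    then show ?thesis by (simp only: eq_neg_iff_add_eq_0 add.commute)
  qed
  then have per: "cmod (Rep_ell2 u (j + 2 * k)) = cmod (Rep_ell2 u j)" for j by simp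
  have const: "cmod (Rep_ell2 u (m + 2 * k * int i)) = cmod (Rep_ell2 u m)" for i
  proof (induction i)
    case (Suc i)
    then show ?case using per[of "m + 2 * k * int i"] by (simp add: algebra_simps)
  qed simp
  obtain N :: nat where N: "real N * (cmod (Rep_ell2 u m))\<^sup>2 > (norm u)\<^sup>2"
    using m reals_Archimedean3[of "(cmod (Rep_ell2 u m))\<^sup>2"] by auto
  have inj: "inj_on (\<lambda>i. m + 2 * k * int i) {..<N}" using assms(1) by (auto simp: inj_on_def)
  have "(\<Sum>j\<in>(\<lambda>i. m + 2 * k * int i) ` {..<N}. (cmod (Rep_ell2 u j))\<^sup>2) \<le> (norm u)\<^sup>2"
    by (rule sum_Rep_ell2_le) simp
  then show False using N by (simp add: sum.reindex[OF inj] const)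
qed

lemma symA_eq: "symA k (m, n) = ((of_int m)\<^sup>2 + (of_int n)\<^sup>2 - (of_int k)\<^sup>2) / ((of_int m)\<^sup>2 + (of_int n)\<^sup>2 + 1)"
proof -
  have "rho (m, n) \<noteq> 0" by simp
  then show ?thesis by (simp add: symA_def rho_def divide_simps add_ac)
qed

lemma symB_eq: "symB k (m, n) = (1 + (of_int k)\<^sup>2) / ((of_int m)\<^sup>2 + (of_int n)\<^sup>2)"
  by (simp add: symB_def rho_def)

lemma opA1_eq: "opA1 k n u m = of_real (symA k (m, n)) * u m"
  by (simp add: opA1_def fourier_multiplier_def symA_eq)

lemma opB1_eq: "opB1 k n u m = of_real (symB k (m, n)) * u m"
  by (simp add: opB1_def fourier_multiplier_def symB_eq)

lemma abs_symA_le: "\<bar>symA k p\<bar> \<le> 1 + (of_int k)\<^sup>2"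
proof -
  have "0 < (1 + (real_of_int k)\<^sup>2) / rho p" by (intro divide_pos_pos) (auto simp: add_pos_nonneg)
  moreover have "(1 + (real_of_int k)\<^sup>2) / rho p \<le> (1 + (of_int k)\<^sup>2) / 1"
    using rho_ge_1[of p] by (intro divide_left_mono) auto
  moreover have "\<bar>1 - x\<bar> \<le> y" if "0 < x" "x \<le> y" "1 \<le> y" for x y :: real
    using that by (simp add: abs_le_iff)
  ultimately show ?thesis by (simp add: symA_def)
qed

lemma symA_neg_iff: "symA k (m, n) < 0 \<longleftrightarrow> m\<^sup>2 + n\<^sup>2 < k\<^sup>2"
proof -
  have "symA k (m, n) < 0 \<longleftrightarrow> real_of_int (m\<^sup>2 + n\<^sup>2) < real_of_int (k\<^sup>2)"
    unfolding symA_eq divide_less_0_iff by (simp add: add_nonneg_pos not_less add_nonneg_nonneg)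
      (smt (verit) zero_le_power2)
  then show ?thesis by (simp only: of_int_less_iff)
qed

context
  fixes k n :: int
  assumes k: "k \<noteq> 0" and n: "n \<noteq> 0"
begin

lemma symB_bounds: "0 < symB k (m, n)" "symB k (m, n) \<le> 1 + (of_int k)\<^sup>2"
proof -
  have "1 \<le> n\<^sup>2" using n by (simp add: int_one_le_iff_zero_less)
  then have "real_of_int 1 \<le> real_of_int (n\<^sup>2)" by (simp only: of_int_le_iff)
  then have "1 \<le> (real_of_int n)\<^sup>2" by simp
  then have d: "1 \<le> (real_of_int m)\<^sup>2 + (real_of_int n)\<^sup>2"
    using zero_le_power2[of "real_of_int m"] by linarith
  have p: "0 < 1 + (real_of_int k)\<^sup>2" by (simp add: add_pos_nonneg)
  show "0 < symB k (m, n)" unfolding symB_eq using d p by (intro divide_pos_pos) auto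
  have "(1 + (of_int k)\<^sup>2) / ((of_int m)\<^sup>2 + (of_int n)\<^sup>2) \<le> (1 + (real_of_int k)\<^sup>2) / 1"
    using d p by (intro divide_left_mono) auto
  then show "symB k (m, n) \<le> 1 + (of_int k)\<^sup>2" by (simp add: symB_eq)
qed

definition hatB :: "int ell2 \<Rightarrow> int ell2" where
  "hatB = wcomp (\<lambda>m. complex_of_real (symB k (m, n))) id"

definition hatD :: "int ell2 \<Rightarrow> int ell2" where
  "hatD u = cosine k (hatB (cosine k u))"

text \<open>The fourth part compares the square of the operator with the operator itself. Inherited
  by \<open>hatD\<close>, it makes \<open>1 - hatD / c\<close> a contraction, as the construction of
  the square root requires.\<close>

lemma hatB: "Rep_ell2 (hatB u) = opB1 k n (Rep_ell2 u)" "bounded_clinear hatB"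
  "cinner (hatB u) v = cinner u (hatB v)"
  "(norm (hatB u))\<^sup>2 \<le> (1 + (of_int k)\<^sup>2) * inner (hatB u) u"
  "inner (hatB u) u = 0 \<Longrightarrow> u = 0"
proof -
  have B: "\<bar>symB k (m, n)\<bar> \<le> 1 + (of_int k)\<^sup>2" for m using symB_bounds[of m] by simp
  have cB: "cmod (complex_of_real (symB k (m, n))) \<le> 1 + (of_int k)\<^sup>2" for m using B by simp
  note w = wcomp[where c = "\<lambda>m. complex_of_real (symB k (m, n))", OF inj_on_id cB]
  show Rep: "Rep_ell2 (hatB u) = opB1 k n (Rep_ell2 u)" for u
    unfolding hatB_def by (rule ext) (simp add: w(1) opB1_eq)
  show "bounded_clinear hatB" unfolding hatB_def by (rule w)
  show "cinner (hatB u) v = cinner u (hatB v)"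
    unfolding hatB_def
    using cinner_wcomp[where c = "\<lambda>m. complex_of_real (symB k (m, n))" and \<pi> = id and \<pi>' = id, OF _ _ cB]
    by simp
  have inner: "inner (hatB u) u = (\<Sum>\<^sub>\<infinity>m. symB k (m, n) * (cmod (Rep_ell2 u m))\<^sup>2)"
    unfolding hatB_def by (rule inner_multiplier[OF B])
  have sm: "(\<lambda>m. symB k (m, n) * (cmod (Rep_ell2 u m))\<^sup>2) summable_on UNIV"
  proof (rule summable_on_comparison_test)
    show "(\<lambda>m. (1 + (of_int k)\<^sup>2) * (cmod (Rep_ell2 u m))\<^sup>2) summable_on UNIV"
      by (intro summable_on_cmult_right Rep_ell2_summable)
  qed (auto intro!: mult_right_mono mult_nonneg_nonneg symB_bounds(2) less_imp_le[OF symB_bounds(1)])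
  have "(norm (hatB u))\<^sup>2 = (\<Sum>\<^sub>\<infinity>m. (cmod (Rep_ell2 (hatB u) m))\<^sup>2)"
    by (simp add: norm_ell2_def infsum_nonneg)
  also have "\<dots> \<le> (\<Sum>\<^sub>\<infinity>m. (1 + (of_int k)\<^sup>2) * (symB k (m, n) * (cmod (Rep_ell2 u m))\<^sup>2))"
  proof (rule infsum_mono)
    show "(\<lambda>m. (cmod (Rep_ell2 (hatB u) m))\<^sup>2) summable_on UNIV" by (rule Rep_ell2_summable)
    show "(\<lambda>m. (1 + (of_int k)\<^sup>2) * (symB k (m, n) * (cmod (Rep_ell2 u m))\<^sup>2)) summable_on UNIV"
      by (intro summable_on_cmult_right sm)
    show "(cmod (Rep_ell2 (hatB u) m))\<^sup>2 \<le> (1 + (of_int k)\<^sup>2) * (symB k (m, n) * (cmod (Rep_ell2 u m))\<^sup>2)" for m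
    proof -
      have "(cmod (Rep_ell2 (hatB u) m))\<^sup>2 = symB k (m, n) * (symB k (m, n) * (cmod (Rep_ell2 u m))\<^sup>2)"
        by (simp add: Rep opB1_eq norm_mult power_mult_distrib power2_eq_square)
      also have "\<dots> \<le> (1 + (of_int k)\<^sup>2) * (symB k (m, n) * (cmod (Rep_ell2 u m))\<^sup>2)"
        using symB_bounds[of m] by (intro mult_right_mono) auto
      finally show ?thesis .
    qed
  qed
  also have "\<dots> = (1 + (of_int k)\<^sup>2) * inner (hatB u) u"
    unfolding inner by (rule infsum_cmult_right')
  finally show "(norm (hatB u))\<^sup>2 \<le> (1 + (of_int k)\<^sup>2) * inner (hatB u) u" .
  show "u = 0" if "inner (hatB u) u = 0"
  proof -
    have "symB k (m, n) * (cmod (Rep_ell2 u m))\<^sup>2 = 0" for m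
      using that unfolding inner
      by (intro nonneg_infsum_le_0D[OF _ sm])
        (auto intro!: mult_nonneg_nonneg less_imp_le[OF symB_bounds(1)])
    then have "Rep_ell2 u m = 0" for m
      using \<open>\<And>m. symB k (m, n) * (cmod (Rep_ell2 u m))\<^sup>2 = 0\<close>[of m] symB_bounds(1)[of m] by auto
    then show ?thesis by (simp add: Rep_ell2_inject[symmetric] zero_ell2.rep_eq fun_eq_iff)
  qed
qed

lemma hatD: "Rep_ell2 (hatD u) = opD k n (Rep_ell2 u)" "bounded_clinear hatD"
  "inner (hatD u) v = inner u (hatD v)"
  "(norm (hatD u))\<^sup>2 \<le> (1 + (of_int k)\<^sup>2) * inner (hatD u) u"
  "hatD u = 0 \<Longrightarrow> u = 0"
proof -
  show "Rep_ell2 (hatD u) = opD k n (Rep_ell2 u)"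
    by (simp add: hatD_def opD_def Rep_cosine hatB(1))
  show "bounded_clinear hatD"
    unfolding hatD_def
    by (rule bounded_clinear_compose[OF bounded_clinear_cosine
          bounded_clinear_compose[OF hatB(2) bounded_clinear_cosine]])
  have "cinner (hatD u) v = cinner u (hatD v)" by (simp add: hatD_def cinner_cosine hatB(3))
  then show "inner (hatD u) v = inner u (hatD v)" by (metis Re_cinner)
  have inner: "inner (hatD u) u = inner (hatB (cosine k u)) (cosine k u)"
    using cinner_cosine[of k "hatB (cosine k u)" u] by (metis Re_cinner hatD_def)
  have "(norm (hatD u))\<^sup>2 \<le> (norm (hatB (cosine k u)))\<^sup>2"
    unfolding hatD_def by (intro power_mono norm_cosine_le) auto
  also have "\<dots> \<le> (1 + (of_int k)\<^sup>2) * inner (hatD u) u" unfolding inner by (rule hatB)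
  finally show "(norm (hatD u))\<^sup>2 \<le> (1 + (of_int k)\<^sup>2) * inner (hatD u) u" .
  show "u = 0" if "hatD u = 0"
    using inner that hatB(5) cosine_inj[OF k] by simp
qed

lemma op_sqrt_opD:
  "positive_selfadjoint (op_sqrt (opD k n))"
  "u \<in> l2 \<Longrightarrow> op_sqrt (opD k n) (op_sqrt (opD k n) u) = opD k n u"
proof -
  define c where "c = 1 + (real_of_int k)\<^sup>2"
  have c: "c > 0" by (simp add: c_def add_pos_nonneg)
  \<comment> \<open>Then \<open>1 - T\<close> is \<open>hatD / c\<close>; its square root is scaled
    by \<open>sqrt c\<close> afterwards.\<close>
  define T where "T u = u - complex_of_real (1 / c) *\<^sub>C hatD u" for u
  have "bounded_clinear T"
    unfolding T_def
    by (rule bounded_clinear_diff[OF bounded_clinear_ident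
          bounded_clinear_compose[OF bounded_clinear_scaleC hatD(2)]])
  moreover have "norm (T u) \<le> norm u" for u
  proof (rule power2_le_imp_le)
    have "(norm (T u))\<^sup>2 = (norm u)\<^sup>2 - 2 / c * inner (hatD u) u + (norm (hatD u))\<^sup>2 / c\<^sup>2"
      unfolding T_def scaleR_scaleC[symmetric] power2_norm_eq_inner
      by (simp add: inner_diff_left inner_diff_right inner_commute[of u "hatD u"] power2_eq_square
          diff_divide_distrib)
    also have "(norm (hatD u))\<^sup>2 / c\<^sup>2 \<le> c * inner (hatD u) u / c\<^sup>2"
      using hatD(4)[of u] by (intro divide_right_mono) (auto simp: c_def)
    also have "c * inner (hatD u) u / c\<^sup>2 = 1 / c * inner (hatD u) u"
      using c by (simp add: power2_eq_square)
    finally have "(norm (T u))\<^sup>2 \<le> (norm u)\<^sup>2 - 1 / c * inner (hatD u) u" by simp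
    moreover have "inner (hatD u) u \<ge> 0"
      using hatD(4)[of u] c order_trans[OF zero_le_power2 hatD(4)] by (simp add: c_def[symmetric] zero_le_mult_iff)
    ultimately show "(norm (T u))\<^sup>2 \<le> (norm u)\<^sup>2" using c
      by (smt (verit) divide_nonneg_nonneg mult_nonneg_nonneg zero_le_one)
  qed simp
  moreover have "inner (T u) v = inner u (T v)" for u v
    unfolding T_def scaleR_scaleC[symmetric] by (simp add: inner_diff_left inner_diff_right hatD(3))
  ultimately obtain S where S: "bounded_clinear S" "\<And>u. S (S u) = u - T u"
    "\<And>u v. inner (S u) v = inner u (S v)" "\<And>u. inner (S u) u \<ge> 0"
    using exists_sqrt[of T] by blast
  define R where "R u = complex_of_real (sqrt c) *\<^sub>C S u" for u
  have R: "positive_selfadjoint (\<lambda>u. Rep_ell2 (R (Abs_ell2 u)))"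
  proof (rule positive_selfadjoint_Rep)
    show "bounded_clinear R"
      unfolding R_def by (rule bounded_clinear_compose[OF bounded_clinear_scaleC S(1)])
    show "inner (R u) v = inner u (R v)" "inner (R u) u \<ge> 0" for u v
      unfolding R_def scaleR_scaleC[symmetric] using S(3,4) c by simp_all
  qed
  have RR: "R (R u) = hatD u" for u
  proof -
    have "R (R u) = complex_of_real (sqrt c) *\<^sub>C complex_of_real (sqrt c) *\<^sub>C S (S u)"
      using S(1) by (simp add: R_def bounded_clinear_def)
    also have "\<dots> = hatD u"
      using c by (simp add: S(2) T_def scaleC_scaleC scaleC_one flip: of_real_mult)
    finally show ?thesis .
  qed
  have "\<forall>u\<in>l2. Rep_ell2 (R (Abs_ell2 (Rep_ell2 (R (Abs_ell2 u))))) = opD k n u"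
    by (simp add: Rep_ell2_inverse RR hatD(1) Rep_Abs_l2)
  with R have "positive_selfadjoint (op_sqrt (opD k n)) \<and>
      (\<forall>u\<in>l2. op_sqrt (opD k n) (op_sqrt (opD k n) u) = opD k n u)"
    unfolding op_sqrt_def
    by (intro someI[of "\<lambda>S. positive_selfadjoint S \<and> (\<forall>u\<in>l2. S (S u) = opD k n u)"]) (rule conjI)
  then show "positive_selfadjoint (op_sqrt (opD k n))"
    "u \<in> l2 \<Longrightarrow> op_sqrt (opD k n) (op_sqrt (opD k n) u) = opD k n u" by blast+
qed

definition hatS :: "int ell2 \<Rightarrow> int ell2" where
  "hatS u = Abs_ell2 (op_sqrt (opD k n) (Rep_ell2 u))"

lemma hatS: "Rep_ell2 (hatS u) = op_sqrt (opD k n) (Rep_ell2 u)" "bounded_clinear hatS"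
  "inner (hatS u) v = inner u (hatS v)" "hatS (hatS u) = hatD u" "hatS u = 0 \<Longrightarrow> u = 0"
proof -
  show R: "Rep_ell2 (hatS u) = op_sqrt (opD k n) (Rep_ell2 u)" for u
    unfolding hatS_def by (rule positive_selfadjoint_Abs[OF op_sqrt_opD(1)])
  show lin: "bounded_clinear hatS"
    using positive_selfadjoint_Abs(2)[OF op_sqrt_opD(1)] by (simp add: hatS_def[abs_def])
  show "inner (hatS u) v = inner u (hatS v)"
    unfolding hatS_def by (rule positive_selfadjoint_Abs[OF op_sqrt_opD(1)])
  show SS: "hatS (hatS u) = hatD u"
    by (rule Rep_ell2_inject[THEN iffD1]) (simp add: R op_sqrt_opD(2) hatD(1))
  show "u = 0" if "hatS u = 0"
    using SS that hatD(5)[of u] lin by (simp add: bounded_clinear_def bounded_linear.linear linear_0)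
qed

lemma finite_Neg: "finite {m. symA k (m, n) < 0}"
proof (rule finite_subset)
  show "{m. symA k (m, n) < 0} \<subseteq> {- \<bar>k\<bar>..\<bar>k\<bar>}"
  proof (rule subsetI)
    fix m assume "m \<in> {m. symA k (m, n) < 0}"
    then have "m\<^sup>2 + n\<^sup>2 < k\<^sup>2" by (simp add: symA_neg_iff)
    then have "m\<^sup>2 < k\<^sup>2" using zero_le_power2[of n] by linarith
    then have "\<bar>m\<bar> < \<bar>k\<bar>" by (simp add: abs_square_less_1 power2_less_imp_less abs_le_square_iff flip: not_le)
    then show "m \<in> {- \<bar>k\<bar>..\<bar>k\<bar>}" by auto
  qed
qed simp

end

section \<open>Negative eigenvalues of K and the eigenvalue problem for D A\<close>

context
  fixes k n :: int
  assumes k: "k \<noteq> 0" and n: "n \<noteq> 0"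
begin

interpretation K: sandwiched_multiplier "hatS k n" "\<lambda>m. symA k (m, n)" "1 + (of_int k)\<^sup>2"
  by unfold_locales (fact hatS[OF k n] abs_symA_le finite_Neg[OF k n])+

lemma Rep_hatA: "Rep_ell2 (K.A u) = opA1 k n (Rep_ell2 u)"
  by (rule ext) (simp add: K.A opA1_eq)

lemma Rep_hatK: "Rep_ell2 (K.K u) = opK k n (Rep_ell2 u)"
  by (simp add: K.K_def opK_def hatS(1)[OF k n] Rep_hatA)

lemma eigenspace_opK: "eigenspace l2 (opK k n) \<mu> = Rep_ell2 ` {u. K.K u = \<mu> *\<^sub>C u}"
proof (intro equalityI subsetI)
  fix u assume "u \<in> eigenspace l2 (opK k n) \<mu>"
  then have u: "u \<in> l2" "opK k n u = \<mu> *\<^sub>C u" by (auto simp: eigenspace_def)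
  have "K.K (Abs_ell2 u) = \<mu> *\<^sub>C Abs_ell2 u"
    by (rule Rep_ell2_inject[THEN iffD1]) (simp add: Rep_hatK Rep_ell2_scaleC Rep_Abs_l2 u)
  then have "Abs_ell2 u \<in> {u. K.K u = \<mu> *\<^sub>C u}" by (rule CollectI)
  from imageI[OF this, of Rep_ell2] show "u \<in> Rep_ell2 ` {u. K.K u = \<mu> *\<^sub>C u}"
    by (simp only: Rep_Abs_l2[OF u(1)])
next
  fix u assume "u \<in> Rep_ell2 ` {u. K.K u = \<mu> *\<^sub>C u}"
  then obtain v where "u = Rep_ell2 v" "K.K v = \<mu> *\<^sub>C v" by blast
  then have "u \<in> l2" "opK k n u = \<mu> *\<^sub>C u"
    using Rep_hatK[of v] Rep_ell2_scaleC[of \<mu> v] by simp_all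
  then show "u \<in> eigenspace l2 (opK k n) \<mu>" by (simp add: eigenspace_def)
qed

lemma eigenvalue_opK_iff: "eigenvalue l2 (opK k n) \<mu> \<longleftrightarrow> (\<exists>u. u \<noteq> 0 \<and> K.K u = \<mu> *\<^sub>C u)"
proof -
  have "Rep_ell2 u = 0 \<longleftrightarrow> u = 0" for u :: "int ell2"
    by (simp add: Rep_ell2_inject[symmetric] zero_ell2.rep_eq fun_eq_iff)
  then show ?thesis unfolding eigenvalue_def eigenspace_opK by auto
qed

lemma eigenvalue_opK_real:
  assumes "eigenvalue l2 (opK k n) \<mu>"
  shows "\<mu> \<in> \<real>"
proof -
  obtain u where u: "u \<noteq> 0" "K.K u = \<mu> *\<^sub>C u" using assms unfolding eigenvalue_opK_iff by blast
  have "\<mu> * cinner u u = cnj \<mu> * cinner u u"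
    using K.K(2)[of u u] by (simp add: u(2) cinner_scaleC_left cinner_scaleC_right)
  then have "\<mu> = cnj \<mu>" using u(1) by (simp add: cinner_self)
  then show ?thesis by (metis Reals_cnj_iff)
qed

lemma card_Neg: "card {m. symA k (m, n) < 0} = Nneg k n"
  by (simp add: Nneg_def symA_neg_iff)

text \<open>That an enumeration of the prescribed length exists is the law of inertia: a maximal
  negative system has exactly \<open>Nneg k n\<close> elements. Listing it by a bijection
  \<open>h\<close>, with the value \<open>ev\<close> of the form at each unit eigenvector, gives the
  witness for the choice in \<open>nu\<close>.\<close>

lemma nu:
  "enumerates_negative_eigenvalues l2 (opK k n) (Nneg k n) (nu k n)"
  "\<mu> < 0 \<Longrightarrow> eigenvalue l2 (opK k n) (complex_of_real \<mu>) \<longleftrightarrow> (\<exists>j\<in>{1..Nneg k n}. - nu k n j = \<mu>)"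
proof -
  obtain E where E: "K.negative_system E" "\<And>E'. K.negative_system E' \<Longrightarrow> card E' \<le> card E"
    using K.maximal_negative_system by blast
  have cardE: "card E = Nneg k n"
    using K.card_maximal_negative_system[OF E] by (simp add: card_Neg)
  have on: "orthonormal E" and finE: "finite E"
    using E(1) by (auto simp: K.negative_system_def orthonormal_def)
  define ev where "ev v = inner (K.K v) v" for v
  have ev: "K.K v = complex_of_real \<mu> *\<^sub>C v \<longleftrightarrow> ev v = \<mu>" "ev v < 0" if v: "v \<in> E" for v \<mu>
  proof -
    obtain \<mu>' where \<mu>': "\<mu>' < 0" "K.K v = complex_of_real \<mu>' *\<^sub>C v"
      using E(1) v by (auto simp: K.negative_system_def)
    have "cinner v v = 1" using on v by (simp add: orthonormal_def)
    then have "complex_of_real ((norm v)\<^sup>2) = complex_of_real 1" by (simp only: cinner_self of_real_1)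
    then have "(norm v)\<^sup>2 = 1" by (simp only: of_real_eq_iff)
    then have "norm v = 1" using norm_ge_zero[of v] unfolding power2_eq_1_iff by linarith
    then have *: "K.K v = complex_of_real \<mu> *\<^sub>C v \<Longrightarrow> ev v = \<mu>" for \<mu>
      by (simp add: ev_def inner_scaleC_self)
    then show "K.K v = complex_of_real \<mu> *\<^sub>C v \<longleftrightarrow> ev v = \<mu>" "ev v < 0" using \<mu>' by auto
  qed
  define Em where "Em \<mu> = {v \<in> E. ev v = \<mu>}" for \<mu>
  have Em: "Em \<mu> = {v. v \<in> E \<and> K.K v = complex_of_real \<mu> *\<^sub>C v}" for \<mu>
    using ev(1) by (auto simp: Em_def)
  have expand: "u = (\<Sum>v\<in>Em \<mu>. cinner u v *\<^sub>C v)" if "\<mu> < 0" "K.K u = complex_of_real \<mu> *\<^sub>C u" for u \<mu>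
    unfolding Em by (rule K.eigenspace_expansion[OF E that])
  have Rep_sum: "Rep_ell2 (\<Sum>v\<in>I. f v) = (\<Sum>v\<in>I. Rep_ell2 (f v))" for I :: "int ell2 set" and f :: "int ell2 \<Rightarrow> int ell2"
    by (induction I rule: infinite_finite_induct) (simp_all add: Rep_ell2_add zero_ell2.rep_eq zero_fun_def)
  have finEm: "finite (Em \<mu>)" for \<mu> using finE by (simp add: Em_def)
  have span: "eigenspace l2 (opK k n) (complex_of_real \<mu>) \<subseteq> complex_vector.span (Rep_ell2 ` Em \<mu>)"
    if "\<mu> < 0" for \<mu>
  proof (rule subsetI)
    fix w assume "w \<in> eigenspace l2 (opK k n) (complex_of_real \<mu>)"
    then obtain u where u: "w = Rep_ell2 u" "K.K u = complex_of_real \<mu> *\<^sub>C u"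
      unfolding eigenspace_opK by blast
    have "w = (\<Sum>v\<in>Em \<mu>. cinner u v *\<^sub>C Rep_ell2 v)"
      unfolding u(1) by (subst expand[OF that u(2)]) (simp add: Rep_sum Rep_ell2_scaleC)
    also have "\<dots> \<in> complex_vector.span (Rep_ell2 ` Em \<mu>)"
      by (rule complex_vector.span_sum, rule complex_vector.span_scale, rule complex_vector.span_base,
          rule imageI)
    finally show "w \<in> complex_vector.span (Rep_ell2 ` Em \<mu>)" .
  qed
  have inj: "inj_on Rep_ell2 (Em \<mu>)" for \<mu> by (simp add: inj_on_def Rep_ell2_inject)
  have indep: "complex_vector.independent (Rep_ell2 ` Em \<mu>)" for \<mu>
  proof (rule complex_vector.independent_if_scalars_zero)
    show "finite (Rep_ell2 ` Em \<mu>)" using finEm by simp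
    fix f x assume "(\<Sum>x\<in>Rep_ell2 ` Em \<mu>. f x *\<^sub>C x) = 0" and x: "x \<in> Rep_ell2 ` Em \<mu>"
    then have "Rep_ell2 (\<Sum>v\<in>Em \<mu>. f (Rep_ell2 v) *\<^sub>C v) = Rep_ell2 0"
      by (simp add: Rep_sum Rep_ell2_scaleC sum.reindex[OF inj] zero_ell2.rep_eq zero_fun_def)
    then have 0: "(\<Sum>v\<in>Em \<mu>. f (Rep_ell2 v) *\<^sub>C v) = 0" by (simp only: Rep_ell2_inject)
    obtain v where v: "v \<in> Em \<mu>" "x = Rep_ell2 v" using x by blast
    then have "Em \<mu> \<subseteq> E" "v \<in> E" by (auto simp: Em_def)
    from orthonormal_coord[OF on this, of "\<lambda>v. f (Rep_ell2 v)"] show "f x = 0"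
      using v by (simp add: 0)
  qed
  have dim: "complex_vector.dim (eigenspace l2 (opK k n) (complex_of_real \<mu>)) = card (Em \<mu>)" if "\<mu> < 0" for \<mu>
  proof (rule complex_vector.dim_unique)
    show "Rep_ell2 ` Em \<mu> \<subseteq> eigenspace l2 (opK k n) (complex_of_real \<mu>)"
      unfolding eigenspace_opK Em by blast
    show "card (Rep_ell2 ` Em \<mu>) = card (Em \<mu>)" by (rule card_image[OF inj])
  qed (use span[OF that] indep in auto)
  have fd: "finite_dimensional (eigenspace l2 (opK k n) (complex_of_real \<mu>))" if "\<mu> < 0" for \<mu>
    unfolding finite_dimensional_def using span[OF that] finEm by blast
  have evl: "eigenvalue l2 (opK k n) (complex_of_real \<mu>) \<longleftrightarrow> Em \<mu> \<noteq> {}" if "\<mu> < 0" for \<mu>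
  proof
    assume "eigenvalue l2 (opK k n) (complex_of_real \<mu>)"
    then show "Em \<mu> \<noteq> {}" unfolding eigenvalue_opK_iff using expand[OF that] by force
  next
    assume "Em \<mu> \<noteq> {}"
    then obtain v where v: "v \<in> E" "K.K v = complex_of_real \<mu> *\<^sub>C v" unfolding Em by blast
    have "cinner v v = 1" using on v(1) by (simp add: orthonormal_def)
    then have "v \<noteq> 0" by auto
    then show "eigenvalue l2 (opK k n) (complex_of_real \<mu>)" unfolding eigenvalue_opK_iff using v by blast
  qed
  obtain h where h: "bij_betw h {1..card E} E" using ex_bij_betw_nat_finite_1[OF finE] by blast
  have "enumerates_negative_eigenvalues l2 (opK k n) (Nneg k n) (\<lambda>j. - ev (h j))"
    unfolding enumerates_negative_eigenvalues_def
  proof (intro conjI ballI allI impI)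
    fix j assume "j \<in> {1..Nneg k n}"
    then show "- (- ev (h j)) < 0" using h ev(2) by (auto simp: cardE bij_betw_def)
  next
    fix \<mu> :: real assume \<mu>: "\<mu> < 0"
    show "finite_dimensional (eigenspace l2 (opK k n) (complex_of_real \<mu>))" by (rule fd[OF \<mu>])
    let ?J = "{j\<in>{1..Nneg k n}. - (- ev (h j)) = \<mu>}"
    have img: "h ` {1..Nneg k n} = E" and inj_h: "inj_on h {1..Nneg k n}"
      using h unfolding cardE bij_betw_def by auto
    have "h ` ?J = Em \<mu>" unfolding Em_def img[symmetric] by auto
    moreover have "card (h ` ?J) = card ?J"
      by (rule card_image[OF inj_on_subset[OF inj_h]]) auto
    ultimately show "card {j\<in>{1..Nneg k n}. - (- ev (h j)) = \<mu>} =
        complex_vector.dim (eigenspace l2 (opK k n) (complex_of_real \<mu>))"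
      unfolding dim[OF \<mu>] by (simp only:)
  qed
  then show en: "enumerates_negative_eigenvalues l2 (opK k n) (Nneg k n) (nu k n)"
    unfolding nu_def by (rule someI[of "enumerates_negative_eigenvalues l2 (opK k n) (Nneg k n)"])
  show "eigenvalue l2 (opK k n) (complex_of_real \<mu>) \<longleftrightarrow> (\<exists>j\<in>{1..Nneg k n}. - nu k n j = \<mu>)" if "\<mu> < 0"
  proof -
    have "card {j\<in>{1..Nneg k n}. - nu k n j = \<mu>} = card (Em \<mu>)"
      using en that unfolding enumerates_negative_eigenvalues_def by (simp add: dim[OF that])
    then have "{j\<in>{1..Nneg k n}. - nu k n j = \<mu>} = {} \<longleftrightarrow> Em \<mu> = {}"
      using card_eq_0_iff[of "Em \<mu>"] card_eq_0_iff[of "{j\<in>{1..Nneg k n}. - nu k n j = \<mu>}"] finEm[of \<mu>]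
      by simp
    then show ?thesis unfolding evl[OF that] by auto
  qed
qed

text \<open>With \<open>D = S S\<close> and \<open>K = S A S\<close>, an eigenvector
  \<open>u\<close> of \<open>K\<close> yields \<open>S u\<close> for \<open>D A\<close>, and
  conversely \<open>F\<close> yields \<open>S (A F)\<close>. A nonzero eigenvalue keeps both images
  from vanishing.\<close>

lemma eigenvalue_opD_opA:
  assumes "\<mu> \<noteq> 0"
  shows "eigenvalue l2 (opK k n) \<mu> \<longleftrightarrow> (\<exists>F\<in>l2. F \<noteq> 0 \<and> opD k n (opA1 k n F) = \<mu> *\<^sub>C F)"
proof
  assume "eigenvalue l2 (opK k n) \<mu>"
  then obtain u where u: "u \<noteq> 0" "K.K u = \<mu> *\<^sub>C u" unfolding eigenvalue_opK_iff by blast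
  define F where "F = hatS k n u"
  have lin: "hatS k n (c *\<^sub>C u) = c *\<^sub>C hatS k n u" "hatS k n 0 = 0" "K.A 0 = 0" for c u
    using hatS(2)[OF k n] K.A(1) by (auto simp: bounded_clinear_def bounded_linear.linear linear_0)
  have "hatD k n (K.A F) = \<mu> *\<^sub>C F"
    unfolding F_def hatS(4)[OF k n, symmetric] using arg_cong[OF u(2), of "hatS k n"] by (simp add: K.K_def lin)
  then have "opD k n (opA1 k n (Rep_ell2 F)) = \<mu> *\<^sub>C Rep_ell2 F"
    using hatD(1)[OF k n, of "K.A F"] by (simp add: Rep_hatA Rep_ell2_scaleC)
  moreover have "F \<noteq> 0"
  proof
    assume "F = 0"
    then have "K.K u = 0" by (simp add: K.K_def F_def[symmetric] lin)
    then show False using u assms by (simp add: complex_vector.scale_eq_0_iff)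
  qed
  then have "Rep_ell2 F \<noteq> 0" by (simp add: Rep_ell2_inject[symmetric] zero_ell2.rep_eq fun_eq_iff)
  ultimately show "\<exists>F\<in>l2. F \<noteq> 0 \<and> opD k n (opA1 k n F) = \<mu> *\<^sub>C F"
    by (intro bexI[of _ "Rep_ell2 F"]) auto
next
  assume "\<exists>F\<in>l2. F \<noteq> 0 \<and> opD k n (opA1 k n F) = \<mu> *\<^sub>C F"
  then obtain F where F: "F \<in> l2" "F \<noteq> 0" "opD k n (opA1 k n F) = \<mu> *\<^sub>C F" by blast
  define G where "G = Abs_ell2 F"
  have Rep: "Rep_ell2 G = F" using F(1) by (simp add: G_def Rep_Abs_l2)
  have D: "hatD k n (K.A G) = \<mu> *\<^sub>C G"
    by (intro Rep_ell2_inject[THEN iffD1])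
      (simp add: hatD(1)[OF k n] Rep_hatA Rep_ell2_scaleC Rep F(3))
  define v where "v = hatS k n (K.A G)"
  have lin: "hatS k n (c *\<^sub>C u) = c *\<^sub>C hatS k n u" "hatS k n 0 = 0" "K.A (c *\<^sub>C u) = c *\<^sub>C K.A u" for c u
    using hatS(2)[OF k n] K.A(1) by (auto simp: bounded_clinear_def bounded_linear.linear linear_0)
  have Sv: "hatS k n v = \<mu> *\<^sub>C G" by (simp add: v_def hatS(4)[OF k n] D)
  have "K.K v = \<mu> *\<^sub>C v" by (simp only: K.K_def Sv lin v_def[symmetric])
  moreover have "v \<noteq> 0"
  proof
    assume "v = 0"
    then have "\<mu> *\<^sub>C G = 0" using Sv lin(2) by simp
    then have "G = 0" using assms by (simp add: complex_vector.scale_eq_0_iff)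
    then show False using F(2) Rep by (auto simp: zero_ell2.rep_eq fun_eq_iff)
  qed
  ultimately show "eigenvalue l2 (opK k n) \<mu>" unfolding eigenvalue_opK_iff by blast
qed

end

section \<open>Unstable eigenvalues\<close>

text \<open>The families that occur as row \<open>n\<close> of elements of
  \<open>sobolev t\<close>.\<close>

definition weighted_l2 :: "int \<Rightarrow> real \<Rightarrow> (int \<Rightarrow> complex) set" where
  "weighted_l2 n t = {u. (\<lambda>m. rho (m, n) powr t * (cmod (u m))\<^sup>2) summable_on UNIV}"

lemma weighted_l2_0: "weighted_l2 n 0 = l2"
  by (simp add: weighted_l2_def l2_def)

lemma weighted_l2_mono: "s \<le> t \<Longrightarrow> weighted_l2 n t \<subseteq> weighted_l2 n s"
  unfolding weighted_l2_def
  by (auto elim!: summable_on_comparison_test intro!: mult_right_mono powr_mono rho_ge_1)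

lemma weighted_l2_multiplier:
  assumes "u \<in> weighted_l2 n t" "\<And>m. rho (m, n) powr r * \<bar>a m\<bar> \<le> M"
  shows "(\<lambda>m. of_real (a m) * u m) \<in> weighted_l2 n (t + 2 * r)"
  unfolding weighted_l2_def
proof (rule CollectI, rule summable_on_comparison_test)
  show "(\<lambda>m. M\<^sup>2 * (rho (m, n) powr t * (cmod (u m))\<^sup>2)) summable_on UNIV"
    using assms(1) by (intro summable_on_cmult_right) (simp add: weighted_l2_def)
  fix m
  have "rho (m, n) powr (t + 2 * r) * (cmod (of_real (a m) * u m))\<^sup>2 =
      (rho (m, n) powr r * \<bar>a m\<bar>)\<^sup>2 * (rho (m, n) powr t * (cmod (u m))\<^sup>2)"
  proof -
    have "rho (m, n) powr (t + 2 * r) = rho (m, n) powr t * (rho (m, n) powr r)\<^sup>2"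
      by (simp only: powr_add mult_2 power2_eq_square)
    then show ?thesis by (simp only: norm_mult norm_of_real power_mult_distrib mult_ac)
  qed
  also have "\<dots> \<le> M\<^sup>2 * (rho (m, n) powr t * (cmod (u m))\<^sup>2)"
    using assms(2)[of m] by (intro mult_right_mono power_mono) auto
  finally show "rho (m, n) powr (t + 2 * r) * (cmod (of_real (a m) * u m))\<^sup>2 \<le>
    M\<^sup>2 * (rho (m, n) powr t * (cmod (u m))\<^sup>2)" .
qed simp

lemma weighted_l2_shift:
  assumes "u \<in> weighted_l2 n t"
  shows "(\<lambda>m. u (m + j)) \<in> weighted_l2 n t"
proof -
  obtain M where M: "\<And>p. norm ((rho p / rho (shift1 j p)) powr t) \<le> M"
    using bounded_of_tendsto_cofinite[OF tendsto_rho_ratio_powr] by blast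
  have bij: "bij (\<lambda>m::int. m + j)" by (rule bij_plus_right)
  have "(\<lambda>m. rho (m + j, n) powr t * (cmod (u (m + j)))\<^sup>2) summable_on UNIV"
    using assms summable_on_reindex_bij_betw[OF bij, of "\<lambda>m. rho (m, n) powr t * (cmod (u m))\<^sup>2"]
    by (simp add: weighted_l2_def)
  then have sm: "(\<lambda>m. M * (rho (m + j, n) powr t * (cmod (u (m + j)))\<^sup>2)) summable_on UNIV"
    by (rule summable_on_cmult_right)
  show ?thesis
    unfolding weighted_l2_def
  proof (rule CollectI, rule summable_on_comparison_test[OF sm])
    fix m
    have "rho (m, n) powr t = (rho (m, n) / rho (m + j, n)) powr t * rho (m + j, n) powr t"
      by (simp add: powr_divide)
    also have "\<dots> \<le> M * rho (m + j, n) powr t"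
      using M[of "(m, n)"] by (intro mult_right_mono) (auto simp: shift1_def)
    finally show "rho (m, n) powr t * (cmod (u (m + j)))\<^sup>2 \<le> M * (rho (m + j, n) powr t * (cmod (u (m + j)))\<^sup>2)"
      unfolding mult.assoc[symmetric] by (rule mult_right_mono) simp
  qed simp
qed

lemma weighted_l2_add:
  assumes "u \<in> weighted_l2 n t" "v \<in> weighted_l2 n t"
  shows "(\<lambda>m. u m + v m) \<in> weighted_l2 n t"
proof -
  have eq: "rho (m, n) powr t * (cmod z)\<^sup>2 = (cmod (of_real (rho (m, n) powr (t / 2)) * z))\<^sup>2" for m z
    by (simp only: weighted_square sobolev_weight_rho)
  show ?thesis
    using assms square_summable_add[of "\<lambda>m. of_real (rho (m, n) powr (t / 2)) * u m" UNIV
        "\<lambda>m. of_real (rho (m, n) powr (t / 2)) * v m"]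
    unfolding weighted_l2_def mem_Collect_eq eq by (simp only: distrib_left)
qed

lemma weighted_l2_scale: "u \<in> weighted_l2 n t \<Longrightarrow> (\<lambda>m. c * u m) \<in> weighted_l2 n t"
  using summable_on_cmult_right[of "\<lambda>m. rho (m, n) powr t * (cmod (u m))\<^sup>2" UNIV "(cmod c)\<^sup>2"]
  by (simp add: weighted_l2_def norm_mult power_mult_distrib mult_ac)

lemma weighted_l2_cos_mult1: "u \<in> weighted_l2 n t \<Longrightarrow> cos_mult1 k u \<in> weighted_l2 n t"
  using weighted_l2_scale[OF weighted_l2_add[OF weighted_l2_shift[of u n t "- k"] weighted_l2_shift[of u n t k]], of "1 / 2"]
  by (simp add: cos_mult1_eq[abs_def])

lemma weighted_l2_opA1: "u \<in> weighted_l2 n t \<Longrightarrow> opA1 k n u \<in> weighted_l2 n t"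
  using weighted_l2_multiplier[of u n t 0 "\<lambda>m. symA k (m, n)" "1 + (of_int k)\<^sup>2"]
  by (simp add: abs_symA_le opA1_eq[abs_def])

lemma weighted_l2_opB1:
  assumes "n \<noteq> 0" "u \<in> weighted_l2 n t"
  shows "opB1 k n u \<in> weighted_l2 n (t + 2)"
proof -
  have "rho (m, n) powr 1 * \<bar>symB k (m, n)\<bar> \<le> 2 * (1 + (of_int k)\<^sup>2)" for m
  proof -
    have "1 \<le> n\<^sup>2" using assms(1) by (simp add: int_one_le_iff_zero_less)
    then have "real_of_int 1 \<le> real_of_int (n\<^sup>2)" by (simp only: of_int_le_iff)
    then have "1 \<le> (real_of_int n)\<^sup>2" by simp
    then have r: "1 \<le> rho (m, n) - 1"
      using zero_le_power2[of "real_of_int m"] unfolding rho_def fst_conv snd_conv by linarith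
    then have "rho (m, n) / (rho (m, n) - 1) \<le> 2" by (simp add: pos_divide_le_eq)
    then have "(1 + (of_int k)\<^sup>2) * (rho (m, n) / (rho (m, n) - 1)) \<le> (1 + (of_int k)\<^sup>2) * 2"
      by (intro mult_left_mono) auto
    moreover have "\<bar>symB k (m, n)\<bar> = symB k (m, n)"
      using r unfolding symB_def by (intro abs_of_nonneg divide_nonneg_nonneg) auto
    moreover have "rho (m, n) powr 1 * symB k (m, n) = (1 + (of_int k)\<^sup>2) * (rho (m, n) / (rho (m, n) - 1))"
      by (simp add: symB_def less_imp_le)
    ultimately show ?thesis by (simp only: mult.commute[of 2])
  qed
  from weighted_l2_multiplier[OF assms(2) this] show ?thesis by (simp add: opB1_eq[abs_def])
qed

text \<open>Elliptic regularity: \<open>D\<close> gains two derivatives.\<close>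

lemma eigenfunction_regular:
  assumes "n \<noteq> 0" "F \<in> l2" "opD k n (opA1 k n F) = \<mu> *\<^sub>C F" "\<mu> \<noteq> 0"
  shows "F \<in> weighted_l2 n t"
proof -
  have "F \<in> weighted_l2 n (2 * real i)" for i
  proof (induction i)
    case 0
    then show ?case using assms(2) by (simp add: weighted_l2_0)
  next
    case (Suc i)
    then have "opD k n (opA1 k n F) \<in> weighted_l2 n (2 * real i + 2)"
      unfolding opD_def o_def
      by (intro weighted_l2_cos_mult1 weighted_l2_opB1 weighted_l2_opA1 assms(1))
    from weighted_l2_scale[OF this, of "inverse \<mu>"] show ?case
      using assms(4) by (simp add: assms(3) scaleC_fun_apply mult.assoc[symmetric] algebra_simps)
  qed
  moreover obtain i where "t \<le> 2 * real i"
    using real_arch_simple[of t] by (metis mult_2 le_add_same_cancel1 of_nat_0_le_iff order_trans)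
  ultimately show ?thesis using weighted_l2_mono by blast
qed

section \<open>Rows of states and the correspondence of eigenvalues\<close>

definition on_row :: "int \<Rightarrow> (int \<Rightarrow> complex) \<Rightarrow> int \<times> int \<Rightarrow> complex" where
  "on_row n u = (\<lambda>p. if snd p = n then u (fst p) else 0)"

lemma on_row_sobolev:
  assumes "u \<in> weighted_l2 n t"
  shows "on_row n u \<in> sobolev t"
proof -
  have "(\<lambda>p. sobolev_weight t p * (cmod (on_row n u p))\<^sup>2) summable_on (\<lambda>m. (m, n)) ` UNIV"
    using assms by (subst summable_on_reindex)
      (auto simp: inj_on_def o_def weighted_l2_def on_row_def sobolev_weight_rho)
  then have "(\<lambda>p. sobolev_weight t p * (cmod (on_row n u p))\<^sup>2) summable_on UNIV"
    by (rule summable_on_cong_neutral[THEN iffD1, rotated -1]) (auto simp: on_row_def image_iff prod_eq_iff)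
  then show ?thesis by (simp add: sobolev_def)
qed

lemma slice_l2:
  assumes "F \<in> sobolev s" "s \<ge> 0"
  shows "(\<lambda>m. F (m, n)) \<in> l2"
proof -
  have "(\<lambda>p. sobolev_weight s p * (cmod (F p))\<^sup>2) summable_on (\<lambda>m. (m, n)) ` UNIV"
    using assms(1) by (auto simp: sobolev_def intro: summable_on_subset_banach)
  then have "(\<lambda>m. rho (m, n) powr s * (cmod (F (m, n)))\<^sup>2) summable_on UNIV"
    by (subst (asm) summable_on_reindex) (auto simp: inj_on_def o_def sobolev_weight_rho)
  then have "(\<lambda>m. F (m, n)) \<in> weighted_l2 n s" by (simp add: weighted_l2_def)
  then show ?thesis using weighted_l2_mono[OF assms(2)] weighted_l2_0 by blast
qed

lemma opL_slice:
  "fst (opL k (w, F)) (m, n) = - (\<i> * of_int k * of_int n) * cos_mult1 k (opA1 k n (\<lambda>m. F (m, n))) m"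
  "snd (opL k (w, F)) (m, n) = - (\<i> * of_int k * of_int n) * cos_mult1 k (opB1 k n (\<lambda>m. w (m, n))) m"
  by (simp_all add: opL_eq cos_mult1_eq opA1_eq opB1_eq shift1_def)

lemma cos_mult1_scale: "cos_mult1 k (\<lambda>m. c * u m) m = c * cos_mult1 k u m"
  by (simp add: cos_mult1_eq algebra_simps)

lemma eigenvalue_opL_imp:
  assumes "s \<ge> 0" "k \<ge> 1" "eigenvalue (Xspace s) (opL k) z" "Re z > 0"
  obtains n j where "0 < \<bar>n\<bar>" "\<bar>n\<bar> < k" "1 \<le> j" "j \<le> Nneg k n" "z = complex_of_real (lam k n j)"
proof -
  obtain w F where x: "(w, F) \<in> Xspace s" "opL k (w, F) = z *\<^sub>C (w, F)" "(w, F) \<noteq> 0"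
    using assms(3) by (auto simp: eigenvalue_def eigenspace_def)
  have z: "z \<noteq> 0" using assms(4) by auto
  have e1: "z * w (m, n) = - (\<i> * of_int k * of_int n) * cos_mult1 k (opA1 k n (\<lambda>m. F (m, n))) m"
    and e2: "z * F (m, n) = - (\<i> * of_int k * of_int n) * cos_mult1 k (opB1 k n (\<lambda>m. w (m, n))) m" for m n
    using opL_slice[of k w F m n] by (simp_all add: x(2) scaleC_prod_def scaleC_fun_apply)
  obtain m0 n where ne: "w (m0, n) \<noteq> 0 \<or> F (m0, n) \<noteq> 0"
    using x(3) by (auto simp: zero_prod_def fun_eq_iff)
  \<comment> \<open>For \<open>n = 0\<close> the right-hand sides of \<open>e1\<close> and
    \<open>e2\<close> vanish, and \<open>z\<close> is nonzero.\<close>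
  have n: "n \<noteq> 0" using ne e1[of m0 n] e2[of m0 n] z by auto
  define Fn where "Fn m = F (m, n)" for m
  have wn: "w (m, n) = (- (\<i> * of_int k * of_int n) / z) * cos_mult1 k (opA1 k n Fn) m" for m
  proof -
    have "(\<lambda>m. F (m, n)) = Fn" by (simp add: Fn_def fun_eq_iff)
    then show ?thesis using e1[of m n] z by (simp add: field_simps)
  qed
  have Fn: "Fn \<in> l2" unfolding Fn_def using x(1) by (intro slice_l2[OF _ assms(1)]) (simp add: Xspace_def)
  have "opB1 k n (\<lambda>m. w (m, n)) = (\<lambda>m. (- (\<i> * of_int k * of_int n) / z) * opB1 k n (cos_mult1 k (opA1 k n Fn)) m)"
    by (rule ext) (simp only: opB1_eq wn mult_ac)
  then have "z * Fn m = - (\<i> * of_int k * of_int n) * ((- (\<i> * of_int k * of_int n) / z) *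
      opD k n (opA1 k n Fn) m)" for m
    unfolding Fn_def e2 by (simp only: cos_mult1_scale opD_def o_def Fn_def[symmetric])
  then have "z * Fn m = - ((of_int k * of_int n)\<^sup>2 / z) * opD k n (opA1 k n Fn) m" for m
    by (simp add: power2_eq_square mult_ac)
  then have zz: "z\<^sup>2 * Fn m = - (of_int k * of_int n)\<^sup>2 * opD k n (opA1 k n Fn) m" for m
    using z by (simp add: power2_eq_square field_simps)
  have k: "k \<noteq> 0" using assms(2) by simp
  \<comment> \<open>With \<open>c = - \<i> k n\<close>, row \<open>n\<close> reads
    \<open>z w = c C A F\<close> and \<open>z F = c C B w\<close>, hence
    \<open>z\<^sup>2 F = c\<^sup>2 D A F\<close> with
    \<open>c\<^sup>2 = - (k n)\<^sup>2\<close>.\<close>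
  define \<mu> where "\<mu> = - z\<^sup>2 / (of_int k * of_int n)\<^sup>2"
  have \<mu>0: "\<mu> \<noteq> 0" using z k n by (simp add: \<mu>_def)
  have "opD k n (opA1 k n Fn) = \<mu> *\<^sub>C Fn"
    using zz k n by (auto simp: fun_eq_iff scaleC_fun_apply \<mu>_def field_simps)
  moreover have "Fn \<noteq> 0"
  proof
    assume 0: "Fn = 0"
    have "opA1 k n Fn = (\<lambda>m. 0)" by (rule ext) (simp add: 0 opA1_eq)
    then have "w (m0, n) = 0" by (simp add: wn cos_mult1_eq)
    moreover have "F (m0, n) = 0" using 0 by (metis Fn_def zero_fun_apply)
    ultimately show False using ne by simp
  qed
  ultimately have ev: "eigenvalue l2 (opK k n) \<mu>"
    using eigenvalue_opD_opA[OF k n \<mu>0] Fn by blast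
  \<comment> \<open>Self-adjointness of \<open>K\<close> makes \<mu> and therefore
    \<open>z\<^sup>2\<close> real. As \<open>Re z > 0\<close> excludes imaginary values,
    \<open>z\<close> is real and \<mu> is negative.\<close>
  have \<mu>: "\<mu> = complex_of_real (Re \<mu>)" using eigenvalue_opK_real[OF k n ev] by (simp add: complex_is_Real_iff complex_eq_iff)
  define r where "r = (real_of_int k * real_of_int n)\<^sup>2"
  have r: "r > 0" using k n by (simp add: r_def)
  have "z\<^sup>2 = - \<mu> * of_real r" using k n by (simp add: \<mu>_def r_def)
  also have "\<dots> = complex_of_real (- Re \<mu> * r)" by (subst \<mu>) simp
  finally have z2: "z\<^sup>2 = complex_of_real (- Re \<mu> * r)" .
  have "Im z = 0 \<or> Re z = 0" using arg_cong[OF z2, of Im] by (simp add: power2_eq_square)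
  then have Im: "Im z = 0" using assms(4) by simp
  have Re: "(Re z)\<^sup>2 = - Re \<mu> * r" using arg_cong[OF z2, of Re] Im by (simp add: power2_eq_square)
  have neg: "Re \<mu> < 0"
  proof (rule ccontr)
    assume "\<not> Re \<mu> < 0"
    then have "- Re \<mu> * r \<le> 0" using r by (intro mult_nonpos_nonneg) auto
    then show False using zero_less_power[OF assms(4), of 2] Re by linarith
  qed
  obtain j where j: "j \<in> {1..Nneg k n}" "- nu k n j = Re \<mu>"
    using nu(2)[OF k n neg] ev \<mu> by metis
  have "(Re z)\<^sup>2 = (lam k n j)\<^sup>2"
  proof -
    have "nu k n j = - Re \<mu>" using j(2) by simp
    then show ?thesis using Re neg by (simp add: lam_def r_def power_mult_distrib mult_ac)
  qed
  moreover have "lam k n j \<ge> 0"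
    using assms(2) j(2) neg unfolding lam_def by (intro mult_nonneg_nonneg real_sqrt_ge_zero) auto
  ultimately have "Re z = lam k n j" using assms(4) by (simp add: power2_eq_iff_nonneg)
  then have "z = complex_of_real (lam k n j)" using Im by (simp add: complex_eq_iff)
  \<comment> \<open>The existence of the index \<open>j\<close> forces this: for larger
    \<open>\<bar>n\<bar>\<close> there are no negative weights at all.\<close>
  moreover have "\<bar>n\<bar> < k"
  proof -
    have "Nneg k n \<noteq> 0" using j(1) by auto
    then have "{m::int. m\<^sup>2 + n\<^sup>2 < k\<^sup>2} \<noteq> {}" unfolding Nneg_def by (metis card.empty)
    then obtain m :: int where "m\<^sup>2 + n\<^sup>2 < k\<^sup>2" by blast
    then have "\<bar>n\<bar>\<^sup>2 < k\<^sup>2" using zero_le_power2[of m] unfolding power2_abs by linarith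
    then show ?thesis by (rule power2_less_imp_less) (use assms(2) in simp)
  qed
  ultimately show thesis using that[of n j] j(1) n by auto
qed

text \<open>The eigenfunction of \<open>D A\<close> is known only to lie in \<open>l2\<close>.
  Regularity places it in every weighted space, so that the state built from it on the single row
  \<open>n\<close> belongs to \<open>Xspace s\<close> for every \<open>s\<close>; it has mean zero
  because \<open>n \<noteq> 0\<close>.\<close>

lemma lam_eigenvalue:
  assumes "k \<ge> 1" "n \<noteq> 0" "1 \<le> j" "j \<le> Nneg k n"
  shows "lam k n j > 0" "eigenvalue (Xspace s) (opL k) (complex_of_real (lam k n j))"
proof -
  have k: "k \<noteq> 0" using assms(1) by simp
  have j: "j \<in> {1..Nneg k n}" using assms by simp
  have pos: "nu k n j > 0"
    using nu(1)[OF k assms(2)] j by (auto simp: enumerates_negative_eigenvalues_def)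
  then show lam: "lam k n j > 0" using assms by (simp add: lam_def)
  define z where "z = complex_of_real (lam k n j)"
  define \<mu> where "\<mu> = complex_of_real (- nu k n j)"
  have \<mu>0: "\<mu> \<noteq> 0" using pos by (simp add: \<mu>_def)
  have z0: "z \<noteq> 0" using lam by (simp add: z_def)
  have zz: "z\<^sup>2 = - (of_int k * of_int n)\<^sup>2 * \<mu>"
  proof -
    have "(lam k n j)\<^sup>2 = (real_of_int k * real_of_int n)\<^sup>2 * nu k n j"
      using pos by (simp add: lam_def power_mult_distrib mult_ac)
    then have "complex_of_real ((lam k n j)\<^sup>2) = of_real ((real_of_int k * real_of_int n)\<^sup>2 * nu k n j)"
      by (rule arg_cong)
    then show ?thesis by (simp add: z_def \<mu>_def)
  qed
  have "eigenvalue l2 (opK k n) \<mu>"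
    unfolding \<mu>_def using nu(2)[OF k assms(2), of "- nu k n j"] pos j by auto
  then obtain F where F: "F \<in> l2" "F \<noteq> 0" "opD k n (opA1 k n F) = \<mu> *\<^sub>C F"
    using eigenvalue_opD_opA[OF k assms(2) \<mu>0] by blast
  define c where "c = - (\<i> * of_int k * of_int n)"
  have c: "c * c = - (of_int k * of_int n)\<^sup>2" by (simp add: c_def power2_eq_square mult_ac) 
  \<comment> \<open>Chosen to satisfy the first eigenvalue equation; the second one then reduces to
    the equation for \<open>D A\<close>.\<close>
  define w where "w m = c / z * cos_mult1 k (opA1 k n F) m" for m
  have regF: "F \<in> weighted_l2 n t" for t by (rule eigenfunction_regular[OF assms(2) F(1,3) \<mu>0])
  have regw: "w \<in> weighted_l2 n t" for t
    unfolding w_def by (intro weighted_l2_scale weighted_l2_cos_mult1 weighted_l2_opA1 regF)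
  have X: "(on_row n w, on_row n F) \<in> Xspace s"
    using assms(2) by (simp add: Xspace_def sobolev_mean_zero_def on_row_sobolev regF regw) (simp add: on_row_def)
  have zero: "opA1 k i (\<lambda>m. 0) = (\<lambda>m. 0)" "opB1 k i (\<lambda>m. 0) = (\<lambda>m. 0)" "cos_mult1 k (\<lambda>m. 0) = (\<lambda>m. 0)" for i
    by (simp_all add: fun_eq_iff opA1_eq opB1_eq cos_mult1_eq)
  have slice: "(\<lambda>m. on_row n u (m, i)) = (if i = n then u else (\<lambda>m. 0))" for u i
    by (simp add: on_row_def)
  have "opL k (on_row n w, on_row n F) = z *\<^sub>C (on_row n w, on_row n F)"
  proof (intro prod_eqI ext)
    fix p :: "int \<times> int"
    obtain m i where p: "p = (m, i)" by (cases p)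
    show "fst (opL k (on_row n w, on_row n F)) p = fst (z *\<^sub>C (on_row n w, on_row n F)) p"
    proof (cases "i = n")
      case True
      then show ?thesis
        using z0 by (simp add: p opL_slice slice scaleC_prod_def scaleC_fun_apply)
          (simp add: on_row_def w_def c_def)
    next
      case False
      then show ?thesis
        by (simp add: p opL_slice slice zero scaleC_prod_def scaleC_fun_apply) (simp add: on_row_def)
    qed
    show "snd (opL k (on_row n w, on_row n F)) p = snd (z *\<^sub>C (on_row n w, on_row n F)) p"
    proof (cases "i = n")
      case True
      have "opB1 k n w = (\<lambda>m. c / z * opB1 k n (cos_mult1 k (opA1 k n F)) m)"
        by (rule ext) (simp only: opB1_eq w_def mult_ac)
      then have "c * cos_mult1 k (opB1 k n w) m = c * (c / z * opD k n (opA1 k n F) m)"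
        by (simp only: cos_mult1_scale opD_def o_def)
      also have "\<dots> = (c * c) * \<mu> / z * F m" by (simp add: F(3) scaleC_fun_apply)
      also have "\<dots> = z\<^sup>2 / z * F m" by (simp only: c zz)
      also have "\<dots> = z * F m" using z0 by (simp add: power2_eq_square)
      finally show ?thesis
        using True by (simp add: p opL_slice slice scaleC_prod_def scaleC_fun_apply flip: c_def)
          (simp add: on_row_def)
    next
      case False
      then show ?thesis
        by (simp add: p opL_slice slice zero scaleC_prod_def scaleC_fun_apply) (simp add: on_row_def)
    qed
  qed
  moreover have "(on_row n w, on_row n F) \<noteq> 0"
  proof
    assume "(on_row n w, on_row n F) = 0"
    then have "on_row n F (m, n) = 0" for m by (simp add: zero_prod_def)
    then show False using F(2) by (simp add: on_row_def fun_eq_iff)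
  qed
  ultimately show "eigenvalue (Xspace s) (opL k) (complex_of_real (lam k n j))"
    unfolding eigenvalue_def eigenspace_def z_def[symmetric] using X by blast
qed

theorem theorem3p3:
  fixes k :: int and s :: real
  assumes "k \<ge> 1" and "s \<ge> 0"
  shows "finite (spectrum (Xspace s) (Xnorm s) (opL k) \<inter> {z. Re z > 0}) \<and>
    (\<forall>z \<in> spectrum (Xspace s) (Xnorm s) (opL k) \<inter> {z. Re z > 0}.
       z \<in> \<real> \<and> Re z > 0 \<and>
       eigenvalue (Xspace s) (opL k) z \<and>
       z isolated_in spectrum (Xspace s) (Xnorm s) (opL k) \<and>
       finite_algebraic_multiplicity (Xspace s) (Xnorm s) (opL k) z) \<and>
    spectrum (Xspace s) (Xnorm s) (opL k) \<inter> {z. Re z > 0} =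
      (\<Union>n \<in> {n::int. 0 < \<bar>n\<bar> \<and> \<bar>n\<bar> < k}.
         {complex_of_real (lam k n j) | j. 1 \<le> j \<and> j \<le> Nneg k n})"
proof -
  let ?\<sigma> = "spectrum (Xspace s) (Xnorm s) (opL k)" and ?H = "{z. Re z > 0}"
  let ?U = "\<Union>n \<in> {n::int. 0 < \<bar>n\<bar> \<and> \<bar>n\<bar> < k}. {complex_of_real (lam k n j) | j. 1 \<le> j \<and> j \<le> Nneg k n}"
  have eq: "?\<sigma> \<inter> ?H = ?U"
    unfolding opL.spectrum_half_plane
  proof (intro equalityI subsetI)
    fix z assume "z \<in> {z. 0 < Re z \<and> eigenvalue (Xspace s) (opL k) z}"
    then have "eigenvalue (Xspace s) (opL k) z" "Re z > 0" by simp_all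
    then obtain n j where nj: "0 < \<bar>n\<bar>" "\<bar>n\<bar> < k" "1 \<le> j" "j \<le> Nneg k n"
      "z = complex_of_real (lam k n j)"
      using eigenvalue_opL_imp[OF assms(2,1)] by metis
    then show "z \<in> ?U" by blast
  next
    fix z assume "z \<in> ?U"
    then show "z \<in> {z. 0 < Re z \<and> eigenvalue (Xspace s) (opL k) z}"
      using lam_eigenvalue[OF assms(1)] by auto
  qed
  have "finite {n::int. 0 < \<bar>n\<bar> \<and> \<bar>n\<bar> < k}"
    by (rule finite_subset[of _ "{-k..k}"]) auto
  moreover have "{complex_of_real (lam k n j) | j. 1 \<le> j \<and> j \<le> Nneg k n} =
      (\<lambda>j. complex_of_real (lam k n j)) ` {1..Nneg k n}" for n by auto
  ultimately have fin: "finite (?\<sigma> \<inter> ?H)" unfolding eq by simp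
  have "z \<in> \<real> \<and> Re z > 0 \<and> eigenvalue (Xspace s) (opL k) z \<and> z isolated_in ?\<sigma> \<and>
      finite_algebraic_multiplicity (Xspace s) (Xnorm s) (opL k) z" if z: "z \<in> ?\<sigma> \<inter> ?H" for z
  proof -
    obtain r where r: "z = complex_of_real r" using z unfolding eq by auto
    have ev: "eigenvalue (Xspace s) (opL k) z"
      using z unfolding opL.spectrum_half_plane by simp
    \<comment> \<open>The half-plane with the finitely many other unstable points removed is an open
      neighbourhood of \<open>z\<close>; being contained in the half-plane, it avoids the spectrum
      on the imaginary axis and to its left.\<close>
    have "open (?H - (?\<sigma> \<inter> ?H - {z}))"
      by (intro open_Diff open_halfspace_Re_gt finite_imp_closed finite_Diff fin)
    moreover have "(?H - (?\<sigma> \<inter> ?H - {z})) \<inter> ?\<sigma> = {z}" using z by auto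
    ultimately have iso: "z isolated_in ?\<sigma>" unfolding isolated_in_def using z by blast
    have "finite_algebraic_multiplicity (Xspace s) (Xnorm s) (opL k) z"
      using finite_algebraic_multiplicity_opL[OF assms(2), of r k] z ev iso by (simp add: r)
    then show ?thesis using z ev iso r by auto
  qed
  then show ?thesis using fin eq by blast
qed

end
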